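(* Let $X$ be a spectrally negative Lévy process with Laplace exponent $\psi$, right-inverse $\Phi$ of $\psi$, and scale functions $W^{(p)}$, $p\ge0$. Let $q>0$ and $\lambda>0$. (1) (Problem 1) Let $R:\mathbb R\to\mathbb R$ be strictly increasing with $\mathbb E_x\big[\sum_{k=0}^\infty e^{-qT_k}|R(X(T_k))|\big]<\infty$ for all $x\in\mathbb R$. Then the Gittins index $\Gamma$ associated with $R$ satisfies, for all $x\in\mathbb R$, $$\Gamma(x)=\frac{\Phi(q)}{\Phi(q+\lambda)}\left(R(x)+(\Phi(q+\lambda)-\Phi(q))\int_0^\infty R(x+y)e^{-\Phi(q)y}\,\mathrm dy\right).$$ (2) (Problem 2) Let $r:\mathbb R\to\mathbb R$ be strictly increasing and continuous with $\mathbb E_x\big[\int_0^\infty e^{-qt}|r(X(t))|\,\mathrm dt\big]<\infty$ for all $x\in\mathbb R$, and let $R(x):=\mathbb E_x\big[\int_0^\infty e^{-(q+\lambda)t}r(X(t))\,\mathrm dt\big]$. Then the Gittins index $\Gamma$ associated with this $R$ satisfies, for all $x\in\mathbb R$, $$\Gamma(x)=\frac{\Phi(q)}{\Phi(q+\lambda)}\Bigg[\int_{\mathbb R}r(x+u)g^{(q+\lambda)}(u)\,\mathrm du+(\Phi(q+\lambda)-\Phi(q))\int_0^\infty e^{-\Phi(q)y}\int_{\mathbb R}r(x+y+u)g^{(q+\lambda)}(u)\,\mathrm du\,\mathrm dy\Bigg],$$ where $g^{(p)}(u):=\dfrac{e^{-\Phi(p)u}}{\psi'(\Phi(p))}-W^{(p)}(-u)$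 for $u\in\mathbb R$.
   Context: $\mathbb P_x$ is the law under which $X(0)=x$, $\mathbb E_x$ its expectation, $\mathbb E=\mathbb E_0$. A spectrally negative Lévy process is a real-valued Lévy process without positive jumps whose paths are not a.s. monotone. Its Laplace exponent is $\psi(\theta)=\log\mathbb E[e^{\theta X(1)}]$, $\theta\ge0$, and $\Phi(p):=\sup\{s\ge0:\psi(s)=p\}$, $p\ge0$. The $p$-scale function $W^{(p)}:\mathbb R\to[0,\infty)$ is zero on $(-\infty,0)$, and on $[0,\infty)$ is the continuous strictly increasing function with $\int_0^\infty e^{-\theta x}W^{(p)}(x)\,\mathrm dx=1/(\psi(\theta)-p)$ for $\theta>\Phi(p)$. $N$ is a Poisson process of rate $\lambda$ independent of $X$, with arrival times $\mathcal T=\{T_1,T_2,\dots\}$, $T_0:=0$. With $T_x^-:=\inf\{S\in\mathcal T:X(S)\le x\}$ ($\inf\emptyset=\infty$), the Gittins index associated with the reward function $R$ is $$\Gamma(x)=\frac{R(x)+\lambda\,\mathbb E_x\big[\int_0^{T_x^-}e^{-qs}R(X(s))1_{\{X(s)>x\}}\,\mathrm ds\big]}{1+\lambda\,\mathbb E_x\big[\int_0^{T_x^-}e^{-qs}1_{\{X(s)>x\}}\,\mathrm ds\big]},\quad x\in\mathbb R.$$ (Equivalently, $\Gamma(x)$ is the unique $\gamma$ for which $\sup_{M\ge1}\mathbb E_x[\sum_{k=0}^{M-1}e^{-qT_k}(R(X(T_k))-\gamma)]=0$, the supremum being over stopping times $M\ge1$ of the filtration $\mathcal A_k=\sigma(T_i,1\le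 i\le k;X(t),t\le T_k)$.) *)

theory Defs
  imports "HOL-Probability.Probability"
begin

(* Processes are indexed by real times; only times t >= 0 matter.  The paths are cadlag for
   every \<omega>, as on the canonical path space, so that path functionals are measurable even
   if M is not complete.  The process started from x is \<lambda>t \<omega>. x + X t \<omega>. *)

definition cadlag :: "(real \<Rightarrow> real) \<Rightarrow> bool" where
  "cadlag f \<longleftrightarrow>
     (\<forall>t\<ge>0. (f \<longlongrightarrow> f t) (at_right t)) \<and> (\<forall>t>0. \<exists>l. (f \<longlongrightarrow> l) (at_left t))"

(* Mentioning infinite sequences of times in the independence of increments is no restriction:
   a finite partition is an eventually constant sequence, and independence of an infinite
   family is independence of its finite subfamilies. *)
definition levy_process :: "'a measure \<Rightarrow> (real \<Rightarrow> 'a \<Rightarrow> real) \<Rightarrow> bool" where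
  "levy_process M X \<longleftrightarrow>
     prob_space M \<and>
     (\<forall>t\<ge>0. X t \<in> borel_measurable M) \<and>
     (AE \<omega> in M. X 0 \<omega> = 0) \<and>
     (\<forall>\<omega>\<in>space M. cadlag (\<lambda>t. X t \<omega>)) \<and>
     (\<forall>t :: nat \<Rightarrow> real. incseq t \<longrightarrow> 0 \<le> t 0 \<longrightarrow>
        prob_space.indep_vars M (\<lambda>_. borel) (\<lambda>i \<omega>. X (t (Suc i)) \<omega> - X (t i) \<omega>) UNIV) \<and>
     (\<forall>s\<ge>0. \<forall>t\<ge>0. distr M borel (\<lambda>\<omega>. X (s + t) \<omega> - X s \<omega>) = distr M borel (X t))"

definition spectrally_negative_levy :: "'a measure \<Rightarrow> (real \<Rightarrow> 'a \<Rightarrow> real) \<Rightarrow> bool" where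
  "spectrally_negative_levy M X \<longleftrightarrow>
     levy_process M X \<and>
     (AE \<omega> in M. \<forall>t>0. \<forall>l. ((\<lambda>s. X s \<omega>) \<longlongrightarrow> l) (at_left t) \<longrightarrow> X t \<omega> \<le> l) \<and>
     \<not> (AE \<omega> in M. mono_on {0..} (\<lambda>t. X t \<omega>) \<or> antimono_on {0..} (\<lambda>t. X t \<omega>))"

definition laplace_exponent :: "'a measure \<Rightarrow> (real \<Rightarrow> 'a \<Rightarrow> real) \<Rightarrow> real \<Rightarrow> real" where
  "laplace_exponent M X \<theta> = ln (\<integral>\<omega>. exp (\<theta> * X 1 \<omega>) \<partial>M)"

definition right_inverse :: "(real \<Rightarrow> real) \<Rightarrow> real \<Rightarrow> real" where
  "right_inverse \<psi> p = Sup {s. 0 \<le> s \<and> \<psi> s = p}"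

definition is_scale_function :: "(real \<Rightarrow> real) \<Rightarrow> real \<Rightarrow> (real \<Rightarrow> real) \<Rightarrow> bool" where
  "is_scale_function \<psi> p W \<longleftrightarrow>
     (\<forall>x. 0 \<le> W x) \<and> (\<forall>x<0. W x = 0) \<and>
     continuous_on {0..} W \<and> strict_mono_on {0..} W \<and>
     (\<forall>\<theta>>right_inverse \<psi> p.
        set_integrable lborel {0..} (\<lambda>x. exp (- \<theta> * x) * W x) \<and>
        (LBINT x:{0..}. exp (- \<theta> * x) * W x) = 1 / (\<psi> \<theta> - p))"

(* T 1 < T 2 < ... are the arrival times of a Poisson process of rate lam, described by its
   independent exponential interarrival times; T 0 = 0 is not an arrival. *)
definition poisson_arrival_times :: "'a measure \<Rightarrow> real \<Rightarrow> (nat \<Rightarrow> 'a \<Rightarrow> real) \<Rightarrow> bool" where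
  "poisson_arrival_times M lam T \<longleftrightarrow>
     (\<forall>\<omega>\<in>space M. T 0 \<omega> = 0 \<and> strict_mono (\<lambda>k. T k \<omega>)) \<and>
     prob_space.indep_vars M (\<lambda>_. borel) (\<lambda>k \<omega>. T (Suc k) \<omega> - T k \<omega>) UNIV \<and>
     (\<forall>k. distributed M lborel (\<lambda>\<omega>. T (Suc k) \<omega> - T k \<omega>) (exponential_density lam))"

definition indep_process_arrivals ::
    "'a measure \<Rightarrow> (real \<Rightarrow> 'a \<Rightarrow> real) \<Rightarrow> (nat \<Rightarrow> 'a \<Rightarrow> real) \<Rightarrow> bool" where
  "indep_process_arrivals M X T \<longleftrightarrow>
     prob_space.indep_set M
       (sets (vimage_algebra (space M) (\<lambda>\<omega>. \<lambda>t\<in>{0..}. X t \<omega>) (PiM {0..} (\<lambda>_. borel))))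
       (sets (vimage_algebra (space M) (\<lambda>\<omega> k. T k \<omega>) (PiM UNIV (\<lambda>_. borel))))"

(* First arrival time at which Y is at or below x; Inf {} = \<infinity> in ereal. *)
definition passage_time ::
    "(nat \<Rightarrow> 'a \<Rightarrow> real) \<Rightarrow> (real \<Rightarrow> 'a \<Rightarrow> real) \<Rightarrow> real \<Rightarrow> 'a \<Rightarrow> ereal" where
  "passage_time T Y x \<omega> = Inf {ereal (T k \<omega>) | k. 1 \<le> k \<and> Y (T k \<omega>) \<omega> \<le> x}"

definition gittins_index ::
    "'a measure \<Rightarrow> (real \<Rightarrow> 'a \<Rightarrow> real) \<Rightarrow> (nat \<Rightarrow> 'a \<Rightarrow> real) \<Rightarrow> real \<Rightarrow> real \<Rightarrow> (real \<Rightarrow> real) \<Rightarrow>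
     real \<Rightarrow> real" where
  "gittins_index M X T q lam R x =
     (let Y = (\<lambda>t \<omega>. x + X t \<omega>);
          E = (\<lambda>f. \<integral>\<omega>. (LBINT s:{s. 0 \<le> s \<and> ereal s < passage_time T Y x \<omega>}.
                   exp (- q * s) * f (Y s \<omega>) * indicator {x<..} (Y s \<omega>)) \<partial>M)
      in (R x + lam * E R) / (1 + lam * E (\<lambda>_. 1)))"

(* E_x [ \<integral> e^(-pt) r(X(t)) dt ] *)
definition resolvent ::
    "'a measure \<Rightarrow> (real \<Rightarrow> 'a \<Rightarrow> real) \<Rightarrow> real \<Rightarrow> (real \<Rightarrow> real) \<Rightarrow> real \<Rightarrow> real" where
  "resolvent M X p r x = (\<integral>\<omega>. (LBINT t:{0..}. exp (- p * t) * r (x + X t \<omega>)) \<partial>M)"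

definition resolvent_density ::
    "(real \<Rightarrow> real) \<Rightarrow> (real \<Rightarrow> real \<Rightarrow> real) \<Rightarrow> real \<Rightarrow> real \<Rightarrow> real" where
  "resolvent_density \<psi> W p u =
     exp (- right_inverse \<psi> p * u) / deriv \<psi> (right_inverse \<psi> p) - W p (- u)"

end

theory Submission
  imports Defs "HOL-Complex_Analysis.Complex_Analysis"
begin

text \<open>
  Write \<open>\<phi> = \<Phi>(q)\<close> and \<open>\<beta> = \<Phi>(q + \<lambda>)\<close>.  Sampled at the Poisson times and discounted, \<open>X\<close> is a killed random
  walk whose step law is \<open>\<lambda>\<close> times the \<open>(q + \<lambda>)\<close>-resolvent measure.  On \<open>(0, \<infinity>)\<close> this law has an
  exponential density of rate \<open>\<beta>\<close>, and its moment generating function at \<open>\<phi>\<close> is \<open>\<lambda> / (q + \<lambda> - q) = 1\<close>.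
  These two facts say precisely that \<open>(\<beta> - \<phi>) e\<^sup>-\<^sup>\<phi>\<^sup>y dy\<close> solves the renewal equation of the walk killed on
  leaving \<open>(0, \<infinity>)\<close>; as the steps lose mass, the solution is unique and equals the occupation measure
  in the Gittins index.

  The resolvent density itself comes from Laplace transforms alone.  The transforms of the resolvent
  measure (left of \<open>\<beta>\<close>) and of the scale function (right of \<open>\<beta>\<close>) are both given by \<open>1 / (p - \<psi>)\<close> up to
  sign, so they glue to one function with a simple pole at \<open>\<beta>\<close>.  Its growth is controlled by the
  distance to the line \<open>Re z = \<beta>\<close>, and Liouville's theorem identifies it as \<open>c / (\<beta> - z)\<close>.
\<close>

section \<open>Laplace transforms of measures on the line\<close>

text \<open>The two transforms to be glued share no strip: that of the resolvent measure stops at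
  \<beta>, where that of the scale function begins. The obstacle is to cross this line without a
  complex extension of \<psi>. An auxiliary resolvent measure with a larger rate \<open>r\<close>
  has a transform \<open>u\<close> that is analytic across it, and
  \<open>1 / (p - \<psi>) = u / (1 - (r - p) * u)\<close> with \<open>u = 1 / (r - \<psi>)\<close>
  expresses the glued function through it; any further pole would be a zero of this denominator on
  the line. The probabilistic side is a computation with kernels: conditioning on the gaps between
  arrivals makes the arrival times deterministic, so the Markov property at fixed times suffices.
  Integrals stay in the extended nonnegative reals until the occupation measure is identified as a
  measure, and only there do signed rewards enter. The prefactor \<phi> / \<beta> is the reciprocal
  of 1 plus the occupation mass (\<beta> - \<phi>) / \<phi>.\<close>

definition laplace_tr :: "real measure \<Rightarrow> complex \<Rightarrow> complex" where
  "laplace_tr \<mu> z = (\<integral>y. exp (z * complex_of_real y) \<partial>\<mu>)"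

lemma exp_le_exp_endpoints:
  fixes x :: real
  assumes "a \<le> x" "x \<le> b"
  shows "exp (x * y) \<le> exp (a * y) + exp (b * y)"
proof (cases "0 \<le> y")
  case True
  then have "exp (x * y) \<le> exp (b * y)" using assms by (simp add: mult_right_mono)
  then show ?thesis by (simp add: add_increasing)
next
  case False
  then have "exp (x * y) \<le> exp (a * y)" using assms by (simp add: mult_right_mono_neg)
  then show ?thesis by (simp add: add_increasing2)
qed

lemma integrable_exp_between:
  fixes \<mu> :: "real measure"
  assumes [measurable_cong]: "sets \<mu> = sets borel"
    and "integrable \<mu> (\<lambda>y. exp (a * y))" "integrable \<mu> (\<lambda>y. exp (b * y))"
    and "a \<le> x" "x \<le> b"
  shows "integrable \<mu> (\<lambda>y. exp (x * y))"
proof (rule Bochner_Integration.integrable_bound)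
  show "integrable \<mu> (\<lambda>y. exp (a * y) + exp (b * y))"
    using assms by simp
qed (use exp_le_exp_endpoints[OF assms(4,5)] in \<open>auto simp: add_nonneg_nonneg\<close>)

lemma integrable_cexp:
  fixes \<mu> :: "real measure"
  assumes [measurable_cong]: "sets \<mu> = sets borel"
    and "integrable \<mu> (\<lambda>y. exp (Re z * y))"
  shows "integrable \<mu> (\<lambda>y. exp (z * complex_of_real y))"
  by (rule Bochner_Integration.integrable_bound[OF assms(2)]) auto

lemma norm_laplace_tr_le:
  assumes [measurable_cong]: "sets \<mu> = sets borel"
    and "integrable \<mu> (\<lambda>y. exp (Re z * y))"
  shows "norm (laplace_tr \<mu> z) \<le> (\<integral>y. exp (Re z * y) \<partial>\<mu>)"
proof -
  have "norm (laplace_tr \<mu> z) \<le> (\<integral>y. norm (exp (z * complex_of_real y)) \<partial>\<mu>)"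
    unfolding laplace_tr_def by (rule integral_norm_bound)
  then show ?thesis by simp
qed

lemma laplace_tr_of_real:
  "laplace_tr \<mu> (of_real \<theta>) = of_real (\<integral>y. exp (\<theta> * y) \<partial>\<mu>)"
proof -
  have "laplace_tr \<mu> (of_real \<theta>) = (\<integral>y. complex_of_real (exp (\<theta> * y)) \<partial>\<mu>)"
    by (simp add: laplace_tr_def exp_of_real[symmetric])
  then show ?thesis by simp
qed

text \<open>Mean value inequality on the ball of radius \<open>norm w\<close>, where the derivative
  \<open>exp\<close> is at most \<open>exp (norm w)\<close> in modulus. It dominates the difference
  quotients of the transform.\<close>

lemma norm_exp_minus_one_le:
  fixes w :: complex
  shows "norm (exp w - 1) \<le> norm w * exp (norm w)"
proof -
  have "norm (exp w - exp 0) \<le> exp (norm w) * norm (w - 0)"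
  proof (rule field_differentiable_bound)
    show "convex (cball (0::complex) (norm w))" by simp
    show "(exp has_field_derivative exp z) (at z within cball 0 (norm w))" for z :: complex
      by (rule DERIV_subset[OF DERIV_exp]) simp
    show "norm (exp z) \<le> exp (norm w)" if "z \<in> cball 0 (norm w)" for z :: complex
      using that complex_Re_le_cmod[of z] by (simp add: norm_exp_eq_Re)
  qed auto
  then show ?thesis by (simp add: mult.commute)
qed

text \<open>Differentiation under the integral by dominated convergence. Of the margin 2\<delta> on
  either side of \<open>Re z\<close>, one \<delta> pays for the increment \<open>h\<close> and the
  other for the factor \<open>y\<close>, which is at most
  \<open>exp (\<delta> * \<bar>y\<bar>) / \<delta>\<close> in modulus.\<close>

lemma laplace_tr_has_field_derivative:
  assumes [measurable_cong]: "sets \<mu> = sets borel"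
    and \<delta>: "0 < \<delta>"
    and int: "integrable \<mu> (\<lambda>y. exp ((Re z - 2 * \<delta>) * y))" "integrable \<mu> (\<lambda>y. exp ((Re z + 2 * \<delta>) * y))"
  shows "(laplace_tr \<mu> has_field_derivative (\<integral>y. y * exp (z * complex_of_real y) \<partial>\<mu>)) (at z)"
  unfolding has_field_derivative_iff
proof (subst LIM_offset_zero_iff)
  let ?q = "\<lambda>h y. (exp ((z + h) * complex_of_real y) - exp (z * complex_of_real y)) / h"
  let ?B = "\<lambda>y. (exp ((Re z - 2 * \<delta>) * y) + exp ((Re z + 2 * \<delta>) * y)) / \<delta>"
  have near: "integrable \<mu> (\<lambda>y. exp ((z + h) * complex_of_real y))" if "norm h < \<delta>" for h
  proof (rule integrable_cexp[OF assms(1)])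
    show "integrable \<mu> (\<lambda>y. exp (Re (z + h) * y))"
      by (rule integrable_exp_between[OF assms(1) int])
        (use that \<delta> abs_Re_le_cmod[of h] in auto)
  qed
  have bound: "norm (?q h y) \<le> ?B y" if h: "norm h < \<delta>" "h \<noteq> 0" for h y
  proof -
    have "norm (?q h y) = exp (Re z * y) * (norm (exp (h * of_real y) - 1) / norm h)"
    proof -
      have "?q h y = exp (z * of_real y) * ((exp (h * of_real y) - 1) / h)"
        by (simp add: ring_distribs exp_add diff_divide_distrib)
      then have "norm (?q h y) = norm (exp (z * of_real y) * ((exp (h * of_real y) - 1) / h))"
        by (rule arg_cong)
      then show ?thesis by (simp add: norm_mult norm_divide del: mult_eq_0_iff)
    qed
    also have "norm (exp (h * of_real y) - 1) / norm h \<le> \<bar>y\<bar> * exp (norm h * \<bar>y\<bar>)"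
      using norm_exp_minus_one_le[of "h * of_real y"] h by (simp add: norm_mult field_simps)
    also have "\<bar>y\<bar> * exp (norm h * \<bar>y\<bar>) \<le> (exp (\<delta> * \<bar>y\<bar>) / \<delta>) * exp (\<delta> * \<bar>y\<bar>)"
    proof (intro mult_mono)
      show "\<bar>y\<bar> \<le> exp (\<delta> * \<bar>y\<bar>) / \<delta>"
        using exp_ge_add_one_self[of "\<delta> * \<bar>y\<bar>"] \<delta>
        by (simp add: pos_le_divide_eq mult.commute del: exp_ge_add_one_self)
    qed (use h \<delta> in \<open>auto simp: mult_right_mono\<close>)
    also have "\<dots> = exp (2 * \<delta> * \<bar>y\<bar>) / \<delta>" by (simp flip: exp_add)
    also have "\<dots> \<le> (exp (- 2 * \<delta> * y) + exp (2 * \<delta> * y)) / \<delta>"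
      using \<delta> by (intro divide_right_mono) (auto simp: abs_if add_increasing add_increasing2)
    finally have "norm (?q h y) \<le> exp (Re z * y) * ((exp (- 2 * \<delta> * y) + exp (2 * \<delta> * y)) / \<delta>)"
      by (simp add: mult_left_mono)
    also have "\<dots> = ?B y" by (simp add: ring_distribs exp_add exp_diff field_simps exp_minus)
    finally show ?thesis .
  qed
  show "((\<lambda>h. (laplace_tr \<mu> (z + h) - laplace_tr \<mu> z) / (z + h - z)) \<longlongrightarrow> (\<integral>y. y *
      exp (z * complex_of_real y) \<partial>\<mu>)) (at 0)"
    unfolding tendsto_at_iff_sequentially o_def
  proof (intro allI impI)
    fix H :: "nat \<Rightarrow> complex" assume H0: "\<forall>i. H i \<in> UNIV - {0}" and H: "H \<longlonglongrightarrow> 0"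
    \<comment> \<open>The domination holds only for increments shorter than \<delta>, so the
      sequence is shifted past an index \<open>N\<close>.\<close>
    from tendstoD[OF H \<delta>] obtain N where N: "\<And>n. n \<ge> N \<Longrightarrow> norm (H n) < \<delta>"
      by (auto simp: eventually_sequentially)
    have "(\<lambda>i. \<integral>y. ?q (H (i + N)) y \<partial>\<mu>) \<longlonglongrightarrow> (\<integral>y. y * exp (z * complex_of_real y) \<partial>\<mu>)"
    proof (rule integral_dominated_convergence[where w="?B"])
      show "integrable \<mu> ?B" using int by simp
      show "AE y in \<mu>. (\<lambda>i. ?q (H (i + N)) y) \<longlonglongrightarrow> y * exp (z * complex_of_real y)"
      proof (rule AE_I2)
        fix y
        have "((\<lambda>w. exp (w * complex_of_real y)) has_field_derivative y *
            exp (z * complex_of_real y)) (at z)"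
          by (auto intro!: derivative_eq_intros)
        then have "((\<lambda>h. ?q h y) \<longlongrightarrow> y * exp (z * complex_of_real y)) (at 0)"
          by (simp only: DERIV_def)
        then have "(\<lambda>i. ?q (H i) y) \<longlonglongrightarrow> y * exp (z * complex_of_real y)"
          using H0 H unfolding tendsto_at_iff_sequentially o_def by blast
        then show "(\<lambda>i. ?q (H (i + N)) y) \<longlonglongrightarrow> y * exp (z * complex_of_real y)"
          by (rule LIMSEQ_ignore_initial_segment)
      qed
      show "AE y in \<mu>. norm (?q (H (i + N)) y) \<le> ?B y" for i
        using N[of "i + N"] H0 by (intro AE_I2 bound) auto
    qed measurable
    moreover have "(\<integral>y. ?q (H (i + N)) y \<partial>\<mu>) = (laplace_tr \<mu> (z + H (i + N)) - laplace_tr \<mu> z) / H (i +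
        N)" for i
    proof -
      have "(\<integral>y. ?q (H (i + N)) y \<partial>\<mu>) =
          (\<integral>y. exp ((z + H (i + N)) * complex_of_real y) - exp (z * complex_of_real y) \<partial>\<mu>) / H (i + N)"
        by (rule integral_divide_zero)
      also have "(\<integral>y. exp ((z + H (i + N)) * complex_of_real y) - exp (z * complex_of_real y) \<partial>\<mu>) =
          laplace_tr \<mu> (z + H (i + N)) - laplace_tr \<mu> z"
        unfolding laplace_tr_def
        using near[of "H (i + N)"] near[of 0] N[of "i + N"] \<delta>
          by (intro Bochner_Integration.integral_diff) auto
      finally show ?thesis .
    qed
    ultimately have "(\<lambda>i. (laplace_tr \<mu> (z + H (i + N)) - laplace_tr \<mu> z) / H (i + N)) \<longlonglongrightarrow> (\<integral>y. y *
        exp (z * complex_of_real y) \<partial>\<mu>)"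
      by (simp only:)
    then show "(\<lambda>i. (laplace_tr \<mu> (z + H i) - laplace_tr \<mu> z) / (z + H i - z)) \<longlonglongrightarrow> (\<integral>y. y *
        exp (z * complex_of_real y) \<partial>\<mu>)"
      by (simp add: LIMSEQ_offset)
  qed
qed simp

lemma holomorphic_laplace_tr:
  assumes "sets \<mu> = sets borel" "open S"
    and int: "\<And>\<theta>. \<theta> \<in> S \<Longrightarrow> integrable \<mu> (\<lambda>y. exp (\<theta> * y))"
  shows "laplace_tr \<mu> holomorphic_on {z. Re z \<in> S}"
  unfolding holomorphic_on_def
proof (intro ballI)
  fix z :: complex assume "z \<in> {z. Re z \<in> S}"
  then obtain e where e: "e > 0" "ball (Re z) e \<subseteq> S"
    using \<open>open S\<close> by (auto simp: open_contains_ball)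
  \<comment> \<open>With \<delta> = e / 4 the two exponents required are \<open>Re z\<close> plus
    and minus \<open>e / 2\<close>, both inside the ball.\<close>
  have "laplace_tr \<mu> field_differentiable (at z)"
    unfolding field_differentiable_def
  proof (intro exI, rule laplace_tr_has_field_derivative[where \<delta>="e / 4"])
    show "integrable \<mu> (\<lambda>y. exp ((Re z - 2 * (e / 4)) * y))"
      using e by (intro int) (auto simp: dist_real_def subset_iff)
    show "integrable \<mu> (\<lambda>y. exp ((Re z + 2 * (e / 4)) * y))"
      using e by (intro int) (auto simp: dist_real_def subset_iff)
  qed (use e assms in auto)
  then show "laplace_tr \<mu> field_differentiable (at z within {z. Re z \<in> S})"
    by (rule field_differentiable_at_within)
qed

text \<open>Identity theorem: a real interval accumulates at its midpoint, so agreement there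
  spreads to the connected strip. It turns identities for real exponents into identities of complex
  transforms.\<close>

lemma holomorphic_eq_on_strip:
  assumes "f holomorphic_on {z. Re z \<in> {a<..<b}}" "g holomorphic_on {z. Re z \<in> {a<..<b}}"
    and ab: "a < b" and eq: "\<And>\<theta>. \<theta> \<in> {a<..<b} \<Longrightarrow> f (of_real \<theta>) = g (of_real \<theta>)"
    and z: "Re z \<in> {a<..<b}"
  shows "f z = g z"
proof -
  let ?S = "{z. Re z \<in> {a<..<b}}" and ?m = "(a + b) / 2"
  have S: "?S = {z. Re z > a} \<inter> {z. Re z < b}" by auto
  have "f z - g z = 0"
  proof (rule analytic_continuation[of "\<lambda>z. f z - g z" ?S "of_real ` {a<..<b}" "of_real ?m"])
    show "(\<lambda>z. f z - g z) holomorphic_on ?S" by (intro holomorphic_intros assms)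
    show "open ?S" unfolding S by (intro open_Int open_halfspace_Re_gt open_halfspace_Re_lt)
    show "connected ?S" unfolding S
      by (intro convex_connected convex_Int convex_halfspace_Re_gt convex_halfspace_Re_lt)
    show "of_real ?m islimpt (of_real ` {a<..<b} :: complex set)"
      unfolding islimpt_approachable
    proof (intro allI impI)
      fix e :: real assume e: "e > 0"
      define t where "t = min (e / 2) ((b - a) / 4)"
      have t: "0 < t" "t < e" "t < (b - a) / 2" using e ab by (auto simp: t_def min_def)
      show "\<exists>x'\<in>of_real ` {a<..<b}. x' \<noteq> (of_real ?m :: complex) \<and> dist x' (of_real ?m) < e"
      proof (intro bexI conjI)
        show "(of_real (?m + t) :: complex) \<noteq> of_real ?m" using t unfolding of_real_eq_iff by linarith
        show "dist (of_real (?m + t)) (of_real ?m :: complex) < e"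
          unfolding dist_of_real using t by (simp add: dist_real_def)
        show "of_real (?m + t) \<in> (of_real ` {a<..<b} :: complex set)"
          using t by (intro imageI) (simp add: field_simps)
      qed
    qed
  qed (use ab eq z in auto)
  then show ?thesis by simp
qed

text \<open>Exponential tilting: weighting by \<open>exp (t * y)\<close> and normalising gives
  probability measures whose characteristic functions are the transforms on the line
  \<open>Re z = t\<close>. Levy's uniqueness theorem identifies them, and the reciprocal density
  undoes the tilt.\<close>

lemma laplace_uniqueness:
  fixes \<mu> \<nu> :: "real measure"
  assumes sets_\<mu>[measurable_cong]: "sets \<mu> = sets borel" and sets_\<nu>[measurable_cong]: "sets \<nu> =
      sets borel"
    and ab: "a < b"
    and int_\<mu>: "\<And>\<theta>. \<theta> \<in> {a<..<b} \<Longrightarrow> integrable \<mu> (\<lambda>y. exp (\<theta> * y))"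
    and int_\<nu>: "\<And>\<theta>. \<theta> \<in> {a<..<b} \<Longrightarrow> integrable \<nu> (\<lambda>y. exp (\<theta> * y))"
    and eq: "\<And>\<theta>. \<theta> \<in> {a<..<b} \<Longrightarrow> (\<integral>y. exp (\<theta> * y) \<partial>\<mu>) = (\<integral>y. exp (\<theta> * y) \<partial>\<nu>)"
  shows "\<mu> = \<nu>"
proof -
  define t where "t = (a + b) / 2"
  have t: "t \<in> {a<..<b}" using ab by (simp add: t_def)
  have space [simp]: "space \<mu> = UNIV" "space \<nu> = UNIV"
    using sets_eq_imp_space_eq[OF sets_\<mu>] sets_eq_imp_space_eq[OF sets_\<nu>] by simp_all
  have strip: "laplace_tr \<mu> z = laplace_tr \<nu> z" if "Re z \<in> {a<..<b}" for z
  proof (rule holomorphic_eq_on_strip[OF _ _ ab _ that])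
    show "laplace_tr \<mu> holomorphic_on {z. Re z \<in> {a<..<b}}"
      by (rule holomorphic_laplace_tr) (use int_\<mu> sets_\<mu> in auto)
    show "laplace_tr \<nu> holomorphic_on {z. Re z \<in> {a<..<b}}"
      by (rule holomorphic_laplace_tr) (use int_\<nu> sets_\<nu> in auto)
  qed (simp add: laplace_tr_of_real eq)
  define m where "m = (\<integral>y. exp (t * y) \<partial>\<mu>)"
  have m: "m \<ge> 0" "m = (\<integral>y. exp (t * y) \<partial>\<nu>)"
    using eq[OF t] by (simp_all add: m_def)
  show ?thesis
  proof (cases "m = 0")
    case True
    \<comment> \<open>The zero measure cannot be normalised and is treated apart: a positive
      function with integral zero leaves no mass.\<close>
    have null: "emeasure \<rho> A = 0" if [measurable_cong]: "sets \<rho> = sets borel"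
        and i: "integrable \<rho> (\<lambda>y. exp (t * y))" "(\<integral>y. exp (t * y) \<partial>\<rho>) = 0" for \<rho> :: "real measure" and A
    proof -
      have "AE y in \<rho>. exp (t * y) = 0"
        using integral_nonneg_eq_0_iff_AE[OF i(1)] i(2) by simp
      then have "AE y in \<rho>. False" by simp
      then have "emeasure \<rho> (space \<rho>) = 0" by (subst (asm) AE_iff_measurable[OF _ refl]) auto
      then show ?thesis using emeasure_space[of \<rho> A] by simp
    qed
    show ?thesis
      using null[OF sets_\<mu> int_\<mu>[OF t]] null[OF sets_\<nu> int_\<nu>[OF t]] True m m_def sets_\<mu> sets_\<nu>
      by (intro measure_eqI) auto
  next
    case False
    then have m0: "m > 0" using m(1) by linarith
    define N :: "real measure \<Rightarrow> real measure" where "N \<rho> = density \<rho> (\<lambda>y. ennreal (exp (t * y) / m))"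
        for \<rho>
    have N: "real_distribution (N \<rho>)" "char (N \<rho>) = (\<lambda>u. laplace_tr \<rho> (Complex t u) / m)"
        "density (N \<rho>) (\<lambda>y. ennreal (m * exp (- t * y))) = \<rho>"
      if s[measurable_cong]: "sets \<rho> = sets borel" and i: "integrable \<rho> (\<lambda>y. exp (t * y))" "(\<integral>y. exp (t *
          y) \<partial>\<rho>) = m"
      for \<rho> :: "real measure"
    proof -
      have sp: "space \<rho> = UNIV" using sets_eq_imp_space_eq[OF s] by simp
      have "emeasure (N \<rho>) (space (N \<rho>)) = (\<integral>\<^sup>+y. ennreal (exp (t * y) / m) \<partial>\<rho>)"
        by (simp add: N_def emeasure_density sp flip: s)
      also have "\<dots> = ennreal (\<integral>y. exp (t * y) / m \<partial>\<rho>)"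
        using i m0 by (intro nn_integral_eq_integral) auto
      also have "\<dots> = 1" using i m0 by simp
      finally show "real_distribution (N \<rho>)"
        by (intro real_distribution.intro prob_spaceI real_distribution_axioms.intro) (auto simp: N_def
            s)
      show "char (N \<rho>) = (\<lambda>u. laplace_tr \<rho> (Complex t u) / m)"
      proof
        fix u
        have "char (N \<rho>) u = (\<integral>y. (exp (t * y) / m) *\<^sub>R iexp (u * y) \<partial>\<rho>)"
          unfolding char_def N_def using m0 by (intro integral_density) auto
        also have "\<dots> = (\<integral>y. exp (Complex t u * complex_of_real y) / m \<partial>\<rho>)"
          by (intro Bochner_Integration.integral_cong refl)
            (simp add: Complex_eq scaleR_conv_of_real exp_of_real[symmetric] ring_distribs exp_add
                mult.assoc)
        finally show "char (N \<rho>) u = laplace_tr \<rho> (Complex t u) / m"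
          by (simp add: laplace_tr_def)
      qed
      have "density (N \<rho>) (\<lambda>y. ennreal (m * exp (- t * y))) =
          density \<rho> (\<lambda>y. ennreal (exp (t * y) / m) * ennreal (m * exp (- t * y)))"
        unfolding N_def by (rule density_density_eq) auto
      also have "\<dots> = density \<rho> (\<lambda>_. 1)"
        using m0 by (intro arg_cong[where f="density \<rho>"] ext) (simp add: exp_minus field_simps flip:
            ennreal_mult)
      finally show "density (N \<rho>) (\<lambda>y. ennreal (m * exp (- t * y))) = \<rho>" by (simp add: density_1)
    qed
    note N\<mu> = N[OF sets_\<mu> int_\<mu>[OF t] m_def[symmetric]] and N\<nu> = N[OF sets_\<nu> int_\<nu>[OF t] m(2)[symmetric]]
    have "char (N \<mu>) = char (N \<nu>)"
      unfolding N\<mu>(2) N\<nu>(2) using t by (simp add: strip)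
    then have "N \<mu> = N \<nu>" using N\<mu>(1) N\<nu>(1) by (intro Levy_uniqueness)
    then show ?thesis using N\<mu>(3) N\<nu>(3) by simp
  qed
qed

section \<open>Sums of two measures\<close>

definition add_measure :: "'a measure \<Rightarrow> 'a measure \<Rightarrow> 'a measure" where
  "add_measure \<mu> \<nu> = measure_of (space \<mu>) (sets \<mu>) (\<lambda>A. emeasure \<mu> A + emeasure \<nu> A)"

lemma sets_add_measure [simp, measurable_cong]: "sets (add_measure \<mu> \<nu>) = sets \<mu>"
  by (simp add: add_measure_def)

lemma space_add_measure [simp]: "space (add_measure \<mu> \<nu>) = space \<mu>"
  by (simp add: add_measure_def)

lemma emeasure_add_measure:
  assumes "sets \<mu> = sets \<nu>" "A \<in> sets \<mu>"
  shows "emeasure (add_measure \<mu> \<nu>) A = emeasure \<mu> A + emeasure \<nu> A"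
  unfolding add_measure_def
proof (rule emeasure_measure_of_sigma)
  show "sigma_algebra (space \<mu>) (sets \<mu>)" ..
  show "positive (sets \<mu>) (\<lambda>A. emeasure \<mu> A + emeasure \<nu> A)" by (simp add: positive_def)
  show "countably_additive (sets \<mu>) (\<lambda>A. emeasure \<mu> A + emeasure \<nu> A)"
  proof (rule countably_additiveI)
    fix B :: "nat \<Rightarrow> _" assume B: "range B \<subseteq> sets \<mu>" "disjoint_family B"
    have "(\<Sum>i. emeasure \<mu> (B i) + emeasure \<nu> (B i)) = (\<Sum>i. emeasure \<mu> (B i)) + (\<Sum>i. emeasure \<nu> (B i))"
      by (rule suminf_add[symmetric]) auto
    then show "(\<Sum>i. emeasure \<mu> (B i) + emeasure \<nu> (B i)) =
        emeasure \<mu> (\<Union> (range B)) + emeasure \<nu> (\<Union> (range B))"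
      using B assms(1) by (simp add: suminf_emeasure)
  qed
qed fact

lemma nn_integral_add_measure:
  assumes s: "sets \<mu> = sets \<nu>" and "f \<in> borel_measurable \<mu>"
  shows "(\<integral>\<^sup>+x. f x \<partial>add_measure \<mu> \<nu>) = (\<integral>\<^sup>+x. f x \<partial>\<mu>) + (\<integral>\<^sup>+x. f x \<partial>\<nu>)"
  using assms(2)
proof induction
  case (cong f g)
  have "integral\<^sup>N \<rho> f = integral\<^sup>N \<rho> g" if "space \<rho> = space \<mu>" for \<rho>
    using that cong(3) by (intro nn_integral_cong) auto
  then show ?case using cong(4) sets_eq_imp_space_eq[OF s] by simp
next
  case (set A)
  then show ?case using s by (simp add: emeasure_add_measure)
next
  case (mult u c)
  moreover have "u \<in> borel_measurable \<nu>" "u \<in> borel_measurable (add_measure \<mu> \<nu>)"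
    using mult s by (simp_all cong: measurable_cong_sets)
  ultimately show ?case by (simp add: nn_integral_cmult ring_distribs)
next
  case (add u v)
  moreover have "u \<in> borel_measurable \<nu>" "u \<in> borel_measurable (add_measure \<mu> \<nu>)"
     "v \<in> borel_measurable \<nu>" "v \<in> borel_measurable (add_measure \<mu> \<nu>)"
    using add s by (simp_all cong: measurable_cong_sets)
  ultimately show ?case by (simp add: nn_integral_add algebra_simps)
next
  case (seq U)
  have m: "U i \<in> borel_measurable \<nu>" "U i \<in> borel_measurable (add_measure \<mu> \<nu>)" for i
    using seq s by (simp_all cong: measurable_cong_sets)
  have mono: "incseq (\<lambda>i. \<integral>\<^sup>+x. U i x \<partial>\<rho>)" for \<rho>
    using \<open>incseq U\<close> by (auto simp: incseq_def le_fun_def intro!: nn_integral_mono)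
  show ?case
    using seq m by (simp add: SUP_apply nn_integral_monotone_convergence_SUP image_comp
        ennreal_SUP_add[OF mono mono])
qed

lemma integral_exp_eq_nn_integral:
  assumes [measurable_cong]: "sets \<mu> = sets borel"
    and "(\<integral>\<^sup>+y. ennreal (exp (\<theta> * y)) \<partial>\<mu>) = ennreal c" "0 \<le> c"
  shows "integrable \<mu> (\<lambda>y. exp (\<theta> * y))" "(\<integral>y. exp (\<theta> * y) \<partial>\<mu>) = c"
proof -
  show "integrable \<mu> (\<lambda>y. exp (\<theta> * y))"
    by (rule integrableI_bounded) (simp_all add: assms(2))
  show "(\<integral>y. exp (\<theta> * y) \<partial>\<mu>) = c"
    by (subst integral_eq_nn_integral) (simp_all add: assms(2,3))
qed

text \<open>Equality case of the triangle inequality: the real part of the equation says that the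
  nonnegative function \<open>exp (\<theta> * y) * (1 - cos (u * y))\<close> has integral zero. For
  nonzero \<open>u\<close> the measure thus lives on the lattice of multiples of 2 pi / u.\<close>

lemma laplace_tr_periodic:
  assumes [measurable_cong]: "sets \<mu> = sets borel" and i: "integrable \<mu> (\<lambda>y. exp (\<theta> * y))"
    and eq: "laplace_tr \<mu> (Complex \<theta> u) = laplace_tr \<mu> (of_real \<theta>)"
  shows "AE y in \<mu>. cos (u * y) = 1"
proof -
  have i': "integrable \<mu> (\<lambda>y. exp (Complex \<theta> u * complex_of_real y))"
    by (rule integrable_cexp) (use i assms(1) in auto)
  have Re: "Re (exp (Complex \<theta> u * complex_of_real y)) = exp (\<theta> * y) * cos (u * y)" for y
    by (simp add: Re_exp)
  have ic: "integrable \<mu> (\<lambda>y. exp (\<theta> * y) * cos (u * y))"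
    using integrable_Re[OF i'] by (simp add: Re)
  have "(\<integral>y. exp (\<theta> * y) * cos (u * y) \<partial>\<mu>) = Re (laplace_tr \<mu> (Complex \<theta> u))"
    unfolding laplace_tr_def by (simp only: Re flip: integral_Re[OF i'])
  also have "\<dots> = (\<integral>y. exp (\<theta> * y) \<partial>\<mu>)"
    by (simp add: eq laplace_tr_of_real)
  finally have "(\<integral>y. exp (\<theta> * y) * (1 - cos (u * y)) \<partial>\<mu>) = 0"
    using i ic by (simp add: right_diff_distrib)
  moreover have "integrable \<mu> (\<lambda>y. exp (\<theta> * y) * (1 - cos (u * y)))"
    using i ic by (simp add: right_diff_distrib)
  ultimately have "AE y in \<mu>. exp (\<theta> * y) * (1 - cos (u * y)) = 0"
    by (subst (asm) integral_nonneg_eq_0_iff_AE) auto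
  then show ?thesis by eventually_elim simp
qed

text \<open>Converse at an arbitrary exponent: on the lattice the oscillating factor is 1. So
  periodicity found at one real part carries over to another.\<close>

lemma laplace_tr_cos_eq_1:
  assumes "AE y in \<mu>. cos (u * y) = 1" and [measurable_cong]: "sets \<mu> = sets borel"
  shows "laplace_tr \<mu> (Complex \<theta> u) = laplace_tr \<mu> (of_real \<theta>)"
  unfolding laplace_tr_def
proof (rule integral_cong_AE)
  show "AE y in \<mu>. exp (Complex \<theta> u * complex_of_real y) = exp (of_real \<theta> * complex_of_real y)"
    using assms(1)
  proof eventually_elim
    case (elim y)
    have "cis (u * y) = 1" using elim by (simp add: complex_eq_iff cos_one_sin_zero)
    moreover have "exp (Complex \<theta> u * complex_of_real y) =
        exp (of_real \<theta> * complex_of_real y) * cis (u * y)"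
      by (simp add: Complex_eq cis_conv_exp ring_distribs exp_add mult.assoc)
    ultimately show ?case by simp
  qed
qed measurable

section \<open>Exponential integrals over half-lines\<close>

lemma nn_integral_exp_decay:
  fixes a :: real
  assumes "0 < a"
  shows "(\<integral>\<^sup>+t. indicator {0..} t * ennreal (exp (- a * t)) \<partial>lborel) = ennreal (1 / a)"
proof -
  have "(\<integral>\<^sup>+t. ennreal (exp (- a * t)) * indicator {0..} t \<partial>lborel) =
      ennreal (0 - (- exp (- a * 0) / a))"
  proof (rule nn_integral_FTC_atLeast)
    show "((\<lambda>t. - exp (- a * t) / a) has_real_derivative exp (- a * t)) (at t)" for t
      using assms by (auto intro!: derivative_eq_intros)
    have "((\<lambda>t. exp (- (a * t))) \<longlongrightarrow> 0) at_top"
      using assms by (intro filterlim_compose[OF exp_at_bot] filterlim_uminus_at_bot_at_top[THEN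
          filterlim_compose] filterlim_tendsto_pos_mult_at_top[OF tendsto_const] filterlim_ident)
    then have "((\<lambda>t. - exp (- a * t) / a) \<longlongrightarrow> - 0 / a) at_top"
      by (intro tendsto_intros) (use assms in auto)
    then show "((\<lambda>t. - exp (- a * t) / a) \<longlongrightarrow> 0) at_top" by simp
  qed auto
  then show ?thesis by (simp add: mult.commute)
qed

lemma nn_integral_lborel_reflect:
  fixes f :: "real \<Rightarrow> ennreal"
  assumes [measurable]: "f \<in> borel_measurable borel"
  shows "(\<integral>\<^sup>+x. f (- x) \<partial>lborel) = (\<integral>\<^sup>+x. f x \<partial>lborel)"
  by (subst nn_integral_real_affine[where c="-1" and t=0, of f]) auto

lemma nn_integral_exp_tail:
  assumes "0 < a"
  shows "(\<integral>\<^sup>+z. indicator {w..} z * ennreal (exp (- a * z)) \<partial>lborel) = ennreal (exp (- a * w) / a)"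
proof -
  have "(\<integral>\<^sup>+z. indicator {w..} z * ennreal (exp (- a * z)) \<partial>lborel) =
      (\<integral>\<^sup>+z. ennreal (exp (- a * w)) * (indicator {0..} z * ennreal (exp (- a * z))) \<partial>lborel)"
    by (subst nn_integral_real_affine[where c=1 and t=w])
      (auto intro!: nn_integral_cong simp: indicator_def ring_distribs simp flip: ennreal_mult exp_add)
  also have "\<dots> = ennreal (exp (- a * w)) * (\<integral>\<^sup>+z. indicator {0..} z * ennreal (exp (- a * z)) \<partial>lborel)"
    by (rule nn_integral_cmult) measurable
  also have "\<dots> = ennreal (exp (- a * w)) * ennreal (1 / a)"
    by (simp only: nn_integral_exp_decay[OF assms])
  also have "\<dots> = ennreal (exp (- a * w) / a)"
    using assms by (simp flip: ennreal_mult)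
  finally show ?thesis .
qed

lemma exp_convex_ineq:
  fixes u v :: real
  assumes "0 \<le> a" "a \<le> 1"
  shows "exp ((1 - a) * u + a * v) \<le> (1 - a) * exp u + a * exp v"
  using convex_onD[OF exp_convex assms, of u v] by simp

section \<open>The resolvent density\<close>

text \<open>
  \<open>V\<close> and \<open>U\<close> are resolvent measures of the same process, for the rates \<open>p < r\<close>.  The transform of \<open>U\<close>
  lives on a wider strip and continues that of \<open>V\<close> meromorphically across \<open>Re z = \<beta>\<close>.  Of the
  convexity of \<open>\<psi>\<close> only the weaker property \<open>star\<close> is needed.
\<close>

locale scale_resolvent =
  fixes \<psi> :: "real \<Rightarrow> real" and p r \<beta> B :: real and V U :: "real measure" and W :: "real \<Rightarrow> real"
  assumes p: "0 < p" and pr: "p < r" and \<beta>: "0 < \<beta>" and \<beta>B: "\<beta> < B"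
    and star: "\<And>a \<theta>. 0 \<le> a \<Longrightarrow> a \<le> 1 \<Longrightarrow> 0 \<le> \<theta> \<Longrightarrow> \<psi> (a * \<theta>) \<le> a * \<psi> \<theta>"
    and \<psi>\<beta>: "\<psi> \<beta> = p" and \<psi>B: "\<psi> B = r"
    and sets_V [measurable_cong, simp]: "sets V = sets borel"
    and sets_U [measurable_cong, simp]: "sets U = sets borel"
    and nn_V: "\<And>\<theta>. 0 \<le> \<theta> \<Longrightarrow> \<theta> < \<beta> \<Longrightarrow> (\<integral>\<^sup>+y. ennreal (exp (\<theta> * y)) \<partial>V) = ennreal (1 / (p - \<psi> \<theta>))"
    and nn_U: "\<And>\<theta>. 0 \<le> \<theta> \<Longrightarrow> \<theta> < B \<Longrightarrow> (\<integral>\<^sup>+y. ennreal (exp (\<theta> * y)) \<partial>U) = ennreal (1 / (r - \<psi> \<theta>))"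
    and W_meas [measurable]: "W \<in> borel_measurable borel"
    and W_nonneg: "\<And>x. 0 \<le> W x"
    and W_neg: "\<And>x. x < 0 \<Longrightarrow> W x = 0"
    and nn_W: "\<And>\<theta>. \<beta> < \<theta> \<Longrightarrow> (\<integral>\<^sup>+x. ennreal (exp (- \<theta> * x) * W x) \<partial>lborel) = ennreal (1 / (\<psi> \<theta> - p))"
begin

section \<open>Chord bounds and one-sided transforms\<close>

lemma space_V [simp]: "space V = UNIV" and space_U [simp]: "space U = UNIV"
  using sets_eq_imp_space_eq[OF sets_V] sets_eq_imp_space_eq[OF sets_U] by simp_all

text \<open>With \<open>a = \<theta> / \<beta>\<close> in \<open>star\<close>, \<psi> lies below the
  line through the origin and the point (\<beta>, p). The linear gap bounds the transforms near
  \<beta> by a multiple of the reciprocal distance.\<close>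

lemma \<psi>_left: "p * (\<beta> - \<theta>) / \<beta> \<le> p - \<psi> \<theta>" if "0 \<le> \<theta>" "\<theta> \<le> \<beta>"
  using star[of "\<theta> / \<beta>" \<beta>] that \<beta> by (simp add: \<psi>\<beta> field_simps)

text \<open>The same line on its other side: \<open>star\<close> with the factor \<beta> / \<theta>
  keeps \<psi> above it beyond \<beta>.\<close>

lemma \<psi>_right: "p * (\<theta> - \<beta>) / \<beta> \<le> \<psi> \<theta> - p" if "\<beta> \<le> \<theta>"
proof -
  have "p \<le> \<beta> / \<theta> * \<psi> \<theta>"
    using star[of "\<beta> / \<theta>" \<theta>] that \<beta> by (simp add: \<psi>\<beta>)
  then have "p * \<theta> \<le> \<beta> * \<psi> \<theta>"
    using that \<beta> by (simp add: field_simps)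
  then show ?thesis using \<beta> by (simp add: field_simps)
qed

lemma \<psi>_less: "\<psi> \<theta> < p" if "0 \<le> \<theta>" "\<theta> < \<beta>"
proof -
  have "0 < p * (\<beta> - \<theta>) / \<beta>" using that \<beta> p by simp
  then show ?thesis using \<psi>_left[of \<theta>] that by linarith
qed

lemma \<psi>_greater: "p < \<psi> \<theta>" if "\<beta> < \<theta>"
proof -
  have "0 < p * (\<theta> - \<beta>) / \<beta>" using that \<beta> p by simp
  then show ?thesis using \<psi>_right[of \<theta>] that by linarith
qed

lemma \<psi>_less_r: "\<psi> \<theta> < r" if "0 \<le> \<theta>" "\<theta> < B"
proof -
  have "\<psi> \<theta> \<le> \<theta> / B * r"
    using star[of "\<theta> / B" B] that by (simp add: \<psi>B field_simps)
  also have "\<dots> < 1 * r"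
    using that p pr by (intro mult_strict_right_mono) auto
  finally show ?thesis by simp
qed

text \<open>The half-lines are separated because their transforms converge on different half-planes:
  the positive part to the left of \<beta>, the negative part to the right of 0. A possible atom at
  0 goes with the negative part.\<close>

definition "Vpos = density V (indicator {0<..})"
definition "Vneg = density V (indicator {..0})"
text \<open>Reflecting \<open>W\<close> onto the negative half-line lets it be tested with the same
  exponential \<open>exp (\<theta> * y)\<close> as the resolvent measure, with convergence to the
  right of \<beta>.\<close>

definition "Q = density lborel (\<lambda>u. ennreal (W (- u)))"

lemma sets_parts [simp, measurable_cong]: "sets Vpos = sets borel" "sets Vneg = sets borel" "sets Q =
    sets borel"
  by (simp_all add: Vpos_def Vneg_def Q_def)

lemma nn_integral_V_split:
  assumes [measurable]: "f \<in> borel_measurable borel"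
  shows "(\<integral>\<^sup>+y. f y \<partial>V) = (\<integral>\<^sup>+y. f y \<partial>Vpos) + (\<integral>\<^sup>+y. f y \<partial>Vneg)"
proof -
  have "(\<integral>\<^sup>+y. f y \<partial>V) = (\<integral>\<^sup>+y. indicator {0<..} y * f y + indicator {..0} y * f y \<partial>V)"
    by (intro nn_integral_cong) (auto simp: indicator_def)
  then show ?thesis
    by (simp add: nn_integral_add Vpos_def Vneg_def nn_integral_density)
qed

lemma U_int: "integrable U (\<lambda>y. exp (\<theta> * y))" "(\<integral>y. exp (\<theta> * y) \<partial>U) = 1 / (r - \<psi> \<theta>)"
  if "0 \<le> \<theta>" "\<theta> < B" for \<theta>
  using integral_exp_eq_nn_integral[OF sets_U nn_U[OF that]] \<psi>_less_r[OF that] by auto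

lemma nn_Q: "(\<integral>\<^sup>+y. ennreal (exp (\<theta> * y)) \<partial>Q) = ennreal (1 / (\<psi> \<theta> - p))" if "\<beta> < \<theta>"
proof -
  have "(\<integral>\<^sup>+y. ennreal (exp (\<theta> * y)) \<partial>Q) = (\<integral>\<^sup>+y. ennreal (W (- y)) * ennreal (exp (\<theta> * y)) \<partial>lborel)"
    by (simp add: Q_def nn_integral_density)
  also have "\<dots> = (\<integral>\<^sup>+x. ennreal (W x) * ennreal (exp (\<theta> * - x)) \<partial>lborel)"
    by (subst nn_integral_real_affine[where c="-1" and t=0]) auto
  also have "\<dots> = (\<integral>\<^sup>+x. ennreal (exp (- \<theta> * x) * W x) \<partial>lborel)"
    by (intro nn_integral_cong) (simp add: W_nonneg mult.commute flip: ennreal_mult)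
  finally show ?thesis using nn_W[OF that] by simp
qed

lemma Q_int: "integrable Q (\<lambda>y. exp (\<theta> * y))" "(\<integral>y. exp (\<theta> * y) \<partial>Q) = 1 / (\<psi> \<theta> - p)"
  if "\<beta> < \<theta>" for \<theta>
  using integral_exp_eq_nn_integral[OF _ nn_Q[OF that]] \<psi>_greater[OF that] by auto

text \<open>Since only positive \<open>y\<close> count, a negative exponent may be replaced by 0;
  hence the maximum, which makes the bound available on the whole half-plane.\<close>

lemma Vpos_le: "integrable Vpos (\<lambda>y. exp (\<theta> * y))" "(\<integral>y. exp (\<theta> * y) \<partial>Vpos) \<le> 1 / (p - \<psi> (max 0 \<theta>))"
  if "\<theta> < \<beta>" for \<theta>
proof -
  have "(\<integral>\<^sup>+y. ennreal (exp (\<theta> * y)) \<partial>Vpos) = (\<integral>\<^sup>+y. indicator {0<..} y * ennreal (exp (\<theta> * y)) \<partial>V)"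
    by (simp add: Vpos_def nn_integral_density)
  also have "\<dots> \<le> (\<integral>\<^sup>+y. ennreal (exp (max 0 \<theta> * y)) \<partial>V)"
    by (intro nn_integral_mono) (auto simp: indicator_def mult_right_mono)
  also have "\<dots> = ennreal (1 / (p - \<psi> (max 0 \<theta>)))"
    using \<beta> that by (intro nn_V) auto
  finally have le: "(\<integral>\<^sup>+y. ennreal (exp (\<theta> * y)) \<partial>Vpos) \<le> ennreal (1 / (p - \<psi> (max 0 \<theta>)))" .
  show "integrable Vpos (\<lambda>y. exp (\<theta> * y))"
    using le_less_trans[OF le] by (intro integrableI_bounded) auto
  show "(\<integral>y. exp (\<theta> * y) \<partial>Vpos) \<le> 1 / (p - \<psi> (max 0 \<theta>))"
    using \<psi>_less[of "max 0 \<theta>"] \<beta> that le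
    by (intro integral_real_bounded) auto
qed

lemma Vneg_le: "integrable Vneg (\<lambda>y. exp (\<theta> * y))" "(\<integral>y. exp (\<theta> * y) \<partial>Vneg) \<le> 1 / (p - \<psi> 0)"
  if "0 \<le> \<theta>" for \<theta>
proof -
  have "(\<integral>\<^sup>+y. ennreal (exp (\<theta> * y)) \<partial>Vneg) = (\<integral>\<^sup>+y. indicator {..0} y * ennreal (exp (\<theta> * y)) \<partial>V)"
    by (simp add: Vneg_def nn_integral_density)
  also have "\<dots> \<le> (\<integral>\<^sup>+y. ennreal (exp (0 * y)) \<partial>V)"
    using that by (intro nn_integral_mono) (auto simp: indicator_def mult_nonneg_nonpos)
  also have "\<dots> = ennreal (1 / (p - \<psi> 0))"
    using \<beta> that by (intro nn_V) auto
  finally have le: "(\<integral>\<^sup>+y. ennreal (exp (\<theta> * y)) \<partial>Vneg) \<le> ennreal (1 / (p - \<psi> 0))" .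
  show "integrable Vneg (\<lambda>y. exp (\<theta> * y))"
    using le_less_trans[OF le] by (intro integrableI_bounded) auto
  show "(\<integral>y. exp (\<theta> * y) \<partial>Vneg) \<le> 1 / (p - \<psi> 0)"
    using \<psi>_less[of 0] \<beta> le
    by (intro integral_real_bounded) auto
qed

lemma hol_Vpos: "laplace_tr Vpos holomorphic_on {z. Re z < \<beta>}"
  using holomorphic_laplace_tr[of Vpos "{..<\<beta>}"] Vpos_le(1) by simp

lemma hol_Vneg: "laplace_tr Vneg holomorphic_on {z. 0 < Re z}"
  using holomorphic_laplace_tr[of Vneg "{0<..}"] Vneg_le(1) by simp

lemma hol_Q: "laplace_tr Q holomorphic_on {z. \<beta> < Re z}"
  using holomorphic_laplace_tr[of Q "{\<beta><..}"] Q_int(1) by simp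

lemma hol_U: "laplace_tr U holomorphic_on {z. Re z \<in> {0<..<B}}"
  by (rule holomorphic_laplace_tr) (use U_int in auto)

text \<open>On the real axis this is \<open>(p - \<psi> \<theta>) / (r - \<psi> \<theta>)\<close>.
  It stands in for \<open>p - \<psi>\<close> at complex arguments, where \<psi> itself is not
  defined.\<close>

definition "D z = 1 - of_real (r - p) * laplace_tr U z"

lemma hol_D: "D holomorphic_on {z. Re z \<in> {0<..<B}}"
  unfolding D_def by (intro holomorphic_intros hol_U)

lemma U_real: "laplace_tr U (of_real \<theta>) = of_real (1 / (r - \<psi> \<theta>))" if "0 \<le> \<theta>" "\<theta> < B"
  by (simp only: laplace_tr_of_real U_int(2)[OF that])

lemma D_real: "D (of_real \<theta>) = of_real ((p - \<psi> \<theta>) / (r - \<psi> \<theta>))" if "0 \<le> \<theta>" "\<theta> < B"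
proof -
  have "1 - (r - p) * (1 / (r - \<psi> \<theta>)) = (p - \<psi> \<theta>) / (r - \<psi> \<theta>)"
    using \<psi>_less_r[OF that] by (simp add: field_simps)
  then show ?thesis
    unfolding D_def U_real[OF that] by (metis of_real_1 of_real_diff of_real_mult)
qed

lemma V_parts_real: "(\<integral>y. exp (\<theta> * y) \<partial>Vpos) + (\<integral>y. exp (\<theta> * y) \<partial>Vneg) = 1 / (p - \<psi> \<theta>)"
  if "0 \<le> \<theta>" "\<theta> < \<beta>"
proof -
  have "ennreal ((\<integral>y. exp (\<theta> * y) \<partial>Vpos) + (\<integral>y. exp (\<theta> * y) \<partial>Vneg)) =
      (\<integral>\<^sup>+y. ennreal (exp (\<theta> * y)) \<partial>Vpos) + (\<integral>\<^sup>+y. ennreal (exp (\<theta> * y)) \<partial>Vneg)"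
    using Vpos_le(1)[of \<theta>] Vneg_le(1)[of \<theta>] that
    by (subst ennreal_plus) (auto simp: nn_integral_eq_integral)
  also have "\<dots> = ennreal (1 / (p - \<psi> \<theta>))"
    using nn_V[OF that] by (subst nn_integral_V_split[symmetric]) auto
  finally show ?thesis
    using \<psi>_less[OF that] by (subst (asm) ennreal_inj) auto
qed

text \<open>Transform of the resolvent equation: \<open>V\<close> is \<open>U\<close> plus
  \<open>r - p\<close> times the convolution of \<open>U\<close> and \<open>V\<close>. It is checked
  for real exponents and continued.\<close>

lemma V_D:
  assumes "Re z \<in> {0<..<\<beta>}"
  shows "(laplace_tr Vpos z + laplace_tr Vneg z) * D z = laplace_tr U z"
proof (rule holomorphic_eq_on_strip[OF _ _ \<beta> _ assms])
  show "(\<lambda>z. (laplace_tr Vpos z + laplace_tr Vneg z) * D z) holomorphic_on {z. Re z \<in> {0<..<\<beta>}}"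
    using \<beta>B by (intro holomorphic_intros holomorphic_on_subset[OF hol_Vpos] holomorphic_on_subset[OF
        hol_Vneg]
        holomorphic_on_subset[OF hol_D]) auto
  show "laplace_tr U holomorphic_on {z. Re z \<in> {0<..<\<beta>}}"
    using \<beta>B by (intro holomorphic_on_subset[OF hol_U]) auto
  fix \<theta> assume t: "\<theta> \<in> {0<..<\<beta>}"
  then have t': "0 \<le> \<theta>" "\<theta> < \<beta>" "\<theta> < B" using \<beta>B by auto
  have "laplace_tr Vpos (of_real \<theta>) + laplace_tr Vneg (of_real \<theta>) = of_real (1 / (p - \<psi> \<theta>))"
    unfolding laplace_tr_of_real using V_parts_real[OF t'(1,2)] by (simp only: flip: of_real_add)
  moreover have "1 / (p - \<psi> \<theta>) * ((p - \<psi> \<theta>) / (r - \<psi> \<theta>)) = 1 / (r - \<psi> \<theta>)"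
    using \<psi>_less[OF t'(1,2)] by simp
  ultimately show "(laplace_tr Vpos (of_real \<theta>) + laplace_tr Vneg (of_real \<theta>)) * D (of_real \<theta>) =
      laplace_tr U (of_real \<theta>)"
    by (simp only: D_real[OF t'(1,3)] U_real[OF t'(1,3)] flip: of_real_mult)
qed

text \<open>To the right of \<beta> the scale function has transform
  \<open>1 / (\<psi> - p)\<close>, the negative of what continues the resolvent transform; hence the
  minus sign.\<close>

lemma Q_D:
  assumes "Re z \<in> {\<beta><..<B}"
  shows "- laplace_tr Q z * D z = laplace_tr U z"
proof (rule holomorphic_eq_on_strip[OF _ _ \<beta>B _ assms])
  show "(\<lambda>z. - laplace_tr Q z * D z) holomorphic_on {z. Re z \<in> {\<beta><..<B}}"
    using \<beta> by (intro holomorphic_intros holomorphic_on_subset[OF hol_Q] 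
        holomorphic_on_subset[OF hol_D]) auto
  show "laplace_tr U holomorphic_on {z. Re z \<in> {\<beta><..<B}}"
    using \<beta> by (intro holomorphic_on_subset[OF hol_U]) auto
  fix \<theta> assume t: "\<theta> \<in> {\<beta><..<B}"
  then have t': "0 \<le> \<theta>" "\<beta> < \<theta>" "\<theta> < B" using \<beta> by auto
  have "- laplace_tr Q (of_real \<theta>) = of_real (- (1 / (\<psi> \<theta> - p)))"
    unfolding laplace_tr_of_real Q_int(2)[OF t'(2)] by simp
  moreover have "- (1 / (\<psi> \<theta> - p)) * ((p - \<psi> \<theta>) / (r - \<psi> \<theta>)) = 1 / (r - \<psi> \<theta>)"
    using \<psi>_greater[OF t'(2)] by (simp add: divide_simps)
  ultimately show "- laplace_tr Q (of_real \<theta>) * D (of_real \<theta>) = laplace_tr U (of_real \<theta>)"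
    by (simp only: D_real[OF t'(1,3)] U_real[OF t'(1,3)] flip: of_real_mult)
qed

text \<open>
  A zero of \<open>D\<close> on the critical line makes \<open>U\<close> a lattice measure; then the scale function measure
  would be a lattice measure as well, although it has a density.
\<close>

lemma D_nonzero:
  assumes "Re z = \<beta>" "z \<noteq> of_real \<beta>"
  shows "D z \<noteq> 0"
proof
  assume D0: "D z = 0"
  define u where "u = Im z"
  have z: "z = Complex \<beta> u" and u: "u \<noteq> 0"
    using assms by (auto simp: u_def complex_eq_iff)
  \<comment> \<open>Both sides are \<open>1 / (r - p)\<close>: the left because
    \<open>D z = 0\<close>, the right because \<open>\<psi> \<beta> = p\<close>.\<close>
  have "laplace_tr U z = laplace_tr U (of_real \<beta>)"
  proof -
    have "of_real (r - p) * laplace_tr U z = 1" using D0 by (simp add: D_def)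
    moreover have "of_real (r - p) * laplace_tr U (of_real \<beta>) = 1"
      using U_real[of \<beta>] \<beta> \<beta>B pr by (simp add: \<psi>\<beta> flip: of_real_diff)
    ultimately show ?thesis using pr by (metis mult_cancel_left mult_zero_left zero_neq_one)
  qed
  then have cosU: "AE y in U. cos (u * y) = 1"
    unfolding z using \<beta> \<beta>B U_int(1) by (intro laplace_tr_periodic) auto
  \<comment> \<open>The lattice property is moved to a real part strictly between \<beta> and
    \<open>B\<close>, where the transform of \<open>Q\<close> exists and is tied to that of
    \<open>U\<close>.\<close>
  define \<theta> where "\<theta> = (\<beta> + B) / 2"
  have t: "\<beta> < \<theta>" "\<theta> < B" using \<beta>B by (auto simp: \<theta>_def)
  have U_eq: "laplace_tr U (Complex \<theta> u) = laplace_tr U (of_real \<theta>)"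
    by (rule laplace_tr_cos_eq_1[OF cosU]) simp
  then have D_eq: "D (Complex \<theta> u) = D (of_real \<theta>)" by (simp add: D_def)
  have "D (of_real \<theta>) \<noteq> 0"
    using \<psi>_greater[OF t(1)] \<psi>_less_r[of \<theta>] t \<beta> by (subst D_real) auto
  moreover have "- laplace_tr Q (Complex \<theta> u) * D (Complex \<theta> u) =
      - laplace_tr Q (of_real \<theta>) * D (of_real \<theta>)"
    using Q_D[of "Complex \<theta> u"] Q_D[of "of_real \<theta>"] t U_eq by simp
  ultimately have "laplace_tr Q (Complex \<theta> u) = laplace_tr Q (of_real \<theta>)"
    by (simp add: D_eq)
  then have cosQ: "AE y in Q. cos (u * y) = 1"
    using Q_int(1)[OF t(1)] by (intro laplace_tr_periodic) auto
  have "AE y in lborel. 0 < ennreal (W (- y)) \<longrightarrow> cos (u * y) = 1"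
    using cosQ unfolding Q_def by (subst (asm) AE_density) auto
  \<comment> \<open>The lattice is countable, hence a Lebesgue null set, so \<open>W\<close> would
    vanish almost everywhere.\<close>
  moreover have "AE y in lborel. cos (u * y) \<noteq> 1"
  proof -
    have "countable (range (\<lambda>n::int. of_int n * 2 * pi / u))" by simp
    then have "AE y in lborel. y \<notin> range (\<lambda>n::int. of_int n * 2 * pi / u)"
      by (intro AE_not_in countable_imp_null_set_lborel)
    then show ?thesis
    proof eventually_elim
      case (elim y)
      show ?case
      proof
        assume "cos (u * y) = 1"
        then obtain n :: int where "u * y = of_int n * 2 * pi"
          by (auto simp: cos_one_2pi_int)
        then have "y = of_int n * 2 * pi / u" using u by (simp add: field_simps)
        with elim show False by blast
      qed
    qed
  qed
  ultimately have "AE y in lborel. ennreal (W (- y)) = 0"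
    by eventually_elim (auto simp: ennreal_eq_0_iff not_less)
  then have "(\<integral>\<^sup>+y. ennreal (W (- y)) * ennreal (exp (\<theta> * y)) \<partial>lborel) =
      (\<integral>\<^sup>+y. 0 \<partial>(lborel :: real measure))"
    by (intro nn_integral_cong_AE) (auto elim!: eventually_mono)
  then have "(\<integral>\<^sup>+y. ennreal (exp (\<theta> * y)) \<partial>Q) = 0"
    by (simp add: Q_def nn_integral_density)
  then show False
    using nn_Q[OF t(1)] \<psi>_greater[OF t(1)] by simp
qed


text \<open>
  \<open>K\<close> continues the transform of the part of \<open>V\<close> on the positive half-line to the plane without \<open>\<beta>\<close>.
  It turns out to be \<open>c / (\<beta> - z)\<close>, so that this part has an exponential density.
\<close>

definition "K z = (if Re z < \<beta> then laplace_tr Vpos z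
    else if \<beta> < Re z then - (laplace_tr Q z + laplace_tr Vneg z)
    else laplace_tr U z / D z - laplace_tr Vneg z)"

text \<open>By \<open>V_D\<close> and \<open>Q_D\<close> the three branches are one and the same
  expression inside the strip, wherever \<open>D\<close> does not vanish. This is the
  gluing.\<close>

lemma K_eq:
  assumes "Re z \<in> {0<..<B}" "D z \<noteq> 0"
  shows "K z = laplace_tr U z / D z - laplace_tr Vneg z"
proof -
  consider "Re z < \<beta>" | "\<beta> < Re z" | "Re z = \<beta>" by linarith
  then show ?thesis
  proof cases
    case 1
    then show ?thesis using V_D[of z] assms by (simp add: K_def field_simps)
  next
    case 2
    then show ?thesis using Q_D[of z] assms by (simp add: K_def field_simps)
  qed (simp add: K_def)
qed

lemma open_strip: "open {z. Re z \<in> {0<..<B}}"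
proof -
  have "{z. Re z \<in> {0<..<B}} = {z. 0 < Re z} \<inter> {z. Re z < B}" by auto
  then show ?thesis by (simp only: open_Int open_halfspace_Re_gt open_halfspace_Re_lt)
qed

lemma holomorphic_K: "K holomorphic_on - {of_real \<beta>}"
proof -
  have "K field_differentiable (at z)" if z: "z \<noteq> of_real \<beta>" for z
  proof -
    consider "Re z < \<beta>" | "\<beta> < Re z" | "Re z = \<beta>" by linarith
    then show ?thesis
    proof cases
      case 1
      have "K holomorphic_on {z. Re z < \<beta>}"
        using hol_Vpos by (rule holomorphic_transform) (simp add: K_def)
      then show ?thesis
        using 1 by (intro holomorphic_on_imp_differentiable_at[OF _ open_halfspace_Re_lt]) auto
    next
      case 2
      have "(\<lambda>z. - (laplace_tr Q z + laplace_tr Vneg z)) holomorphic_on {z. \<beta> < Re z}"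
        using \<beta> by (intro holomorphic_intros hol_Q holomorphic_on_subset[OF hol_Vneg]) auto
      then have "K holomorphic_on {z. \<beta> < Re z}"
        by (rule holomorphic_transform) (simp add: K_def)
      then show ?thesis
        using 2 by (intro holomorphic_on_imp_differentiable_at[OF _ open_halfspace_Re_gt]) auto
    next
      case 3
      \<comment> \<open>An open set that meets all three branches; \<open>D_nonzero\<close> puts the
        critical point in it.\<close>
      let ?S = "{z. Re z \<in> {0<..<B}} \<inter> D -` (- {0})"
      have S: "open ?S"
        by (rule continuous_open_preimage[OF holomorphic_on_imp_continuous_on[OF hol_D] open_strip]) auto
      have "(\<lambda>z. laplace_tr U z / D z - laplace_tr Vneg z) holomorphic_on ?S"
        by (intro holomorphic_intros holomorphic_on_subset[OF hol_U] holomorphic_on_subset[OF hol_D]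
            holomorphic_on_subset[OF hol_Vneg]) auto
      then have "K holomorphic_on ?S"
        by (rule holomorphic_transform) (auto simp: K_eq)
      moreover have "z \<in> ?S" using 3 z D_nonzero[of z] \<beta> \<beta>B by simp
      ultimately show ?thesis by (intro holomorphic_on_imp_differentiable_at[OF _ S])
    qed
  qed
  then show ?thesis
    unfolding holomorphic_on_def by (auto intro: field_differentiable_at_within)
qed

lemma isCont_on_strip:
  "isCont (laplace_tr U) (of_real \<beta>)" "isCont (laplace_tr Vneg) (of_real \<beta>)"
proof -
  show "isCont (laplace_tr U) (of_real \<beta>)"
    using \<beta> \<beta>B
    by (intro field_differentiable_imp_continuous_at holomorphic_on_imp_differentiable_at[OF hol_U
        open_strip]) auto
  show "isCont (laplace_tr Vneg) (of_real \<beta>)"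
    using \<beta>
    by (intro field_differentiable_imp_continuous_at holomorphic_on_imp_differentiable_at[OF hol_Vneg])
      (auto intro!: open_halfspace_Re_gt)
qed

text \<open>The pole is simple because the zero of \<open>D\<close> at \<beta> is: the linear lower
  bound \<open>\<psi>_right\<close> keeps its derivative there away from 0.\<close>

lemma K_simple_pole: "\<exists>c. ((\<lambda>z. (z - of_real \<beta>) * K z) \<longlongrightarrow> c) (at (of_real \<beta>))"
proof -
  let ?b = "of_real \<beta> :: complex"
  have D0: "D ?b = 0" using \<beta> \<beta>B by (subst D_real) (auto simp: \<psi>\<beta>)
  have "D field_differentiable (at ?b)"
    by (rule holomorphic_on_imp_differentiable_at[OF hol_D open_strip]) (use \<beta> \<beta>B in simp)
  then obtain D' where "(D has_field_derivative D') (at ?b)"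
    by (auto simp: field_differentiable_def)
  then have D': "((\<lambda>z. D z / (z - ?b)) \<longlongrightarrow> D') (at ?b)"
    by (simp add: has_field_derivative_iff D0)
  \<comment> \<open>The derivative is tested along real \<open>t\<close> decreasing to \<beta>,
    where \<open>\<psi>_right\<close> and \<open>r - \<psi> t \<le> r - p\<close> bound the quotient
    below by \<open>p / (\<beta> * (r - p))\<close>.\<close>
  have "D' \<noteq> 0"
  proof -
    have lim: "filterlim (\<lambda>t. of_real t :: complex) (at ?b) (at_right \<beta>)"
      unfolding filterlim_at
      by (auto simp: eventually_at_filter intro!: tendsto_intros)
    have "((\<lambda>t. norm (D (of_real t) / (of_real t - ?b))) \<longlongrightarrow> norm D') (at_right \<beta>)"
      by (intro tendsto_norm filterlim_compose[OF D' lim])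
    moreover have "eventually (\<lambda>t. p / (\<beta> * (r - p)) \<le>
        norm (D (of_real t) / (of_real t - ?b))) (at_right \<beta>)"
      using eventually_at_right_real[OF \<beta>B]
    proof eventually_elim
      case (elim t)
      then have t: "\<beta> < t" "t < B" "0 \<le> t" using \<beta> by auto
      have "p * (t - \<beta>) / \<beta> / (r - p) \<le> (\<psi> t - p) / (r - \<psi> t)"
        using \<psi>_right[of t] \<psi>_greater[OF t(1)] \<psi>_less_r[OF t(3,2)] t p \<beta>
        by (intro frac_le) auto
      also have "\<dots> = norm (D (of_real t))"
        using \<psi>_greater[OF t(1)] \<psi>_less_r[OF t(3,2)]
          by (subst D_real[OF t(3,2)]) (simp only: norm_of_real, simp)
      finally have "p * (t - \<beta>) / \<beta> / (r - p) / (t - \<beta>) \<le> norm (D (of_real t)) / (t - \<beta>)"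
        using t by (intro divide_right_mono) auto
      moreover have "norm (of_real t - ?b) = t - \<beta>" using t by (simp flip: of_real_diff)
      ultimately show ?case using t by (simp add: norm_divide mult.commute)
    qed
    ultimately have "p / (\<beta> * (r - p)) \<le> norm D'"
      by (rule tendsto_lowerbound) simp
    moreover have "0 < p / (\<beta> * (r - p))" using p pr \<beta> by simp
    ultimately show ?thesis by auto
  qed
  have "((\<lambda>z. laplace_tr U z / (D z / (z - ?b)) - (z - ?b) * laplace_tr Vneg z) \<longlongrightarrow>
      laplace_tr U ?b / D' - (?b - ?b) * laplace_tr Vneg ?b) (at ?b)"
    using isCont_on_strip \<open>D' \<noteq> 0\<close> D'
    by (intro tendsto_intros) (auto simp: isCont_def)
  moreover have "eventually (\<lambda>z. laplace_tr U z / (D z / (z - ?b)) - (z - ?b) * laplace_tr Vneg z =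
      (z - ?b) * K z) (at ?b)"
  proof -
    have "eventually (\<lambda>z. D z / (z - ?b) \<noteq> 0) (at ?b)"
      using tendsto_imp_eventually_ne[OF D' \<open>D' \<noteq> 0\<close>] .
    moreover have "eventually (\<lambda>z. z \<in> {z. Re z \<in> {0<..<B}}) (at ?b)"
      using \<beta> \<beta>B by (intro eventually_at_in_open' open_strip) auto
    ultimately show ?thesis
    proof eventually_elim
      case (elim z)
      then show ?case using K_eq[of z] by (simp add: right_diff_distrib mult.commute)
    qed
  qed
  ultimately show ?thesis by (intro exI) (rule Lim_transform_eventually)
qed

lemma \<psi>_0: "\<psi> 0 \<le> 0"
  using star[of 0 0] by simp

lemma Vneg_le': "(\<integral>y. exp (\<theta> * y) \<partial>Vneg) \<le> 1 / p" if "0 \<le> \<theta>"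
proof -
  have "1 / (p - \<psi> 0) \<le> 1 / p" using \<psi>_0 p by (intro divide_left_mono mult_pos_pos) auto
  then show ?thesis using Vneg_le(2)[OF that] by linarith
qed

text \<open>The chord bounds give \<beta> / p times the reciprocal distance to the critical line;
  the negative part, and the region left of 0, contribute at most 1 / p. The constant covers
  both.\<close>

lemma norm_K_le:
  assumes "Re z \<noteq> \<beta>"
  shows "norm (K z) \<le> (1 + \<beta>) / p * (1 + 1 / \<bar>Re z - \<beta>\<bar>)"
proof (cases "Re z < \<beta>")
  case True
  define m where "m = max 0 (Re z)"
  have m: "0 \<le> m" "m < \<beta>" using True \<beta> by (auto simp: m_def)
  have "norm (K z) \<le> 1 / (p - \<psi> m)"
    using norm_laplace_tr_le[of Vpos z] Vpos_le[OF True] True by (simp add: K_def m_def)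
  also have "\<dots> \<le> 1 / (p * (\<beta> - m) / \<beta>)"
    using \<psi>_left[of m] \<psi>_less[OF m] m p \<beta> by (intro divide_left_mono mult_pos_pos) auto
  also have "\<dots> \<le> (1 + \<beta>) / p * (1 + 1 / \<bar>Re z - \<beta>\<bar>)"
  proof (cases "Re z \<le> 0")
    case True
    have "1 / p \<le> (1 + \<beta>) / p" using p \<beta> by (simp add: divide_right_mono)
    also have "\<dots> * 1 \<le> (1 + \<beta>) / p * (1 + 1 / \<bar>Re z - \<beta>\<bar>)"
      using p \<beta> by (intro mult_left_mono) auto
    finally show ?thesis using True \<beta> by (simp add: m_def)
  next
    case False
    then have "1 / (p * (\<beta> - m) / \<beta>) = \<beta> / p * (1 / \<bar>Re z - \<beta>\<bar>)"
      using True by (simp add: m_def max_def)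
    also have "\<dots> \<le> (1 + \<beta>) / p * (1 + 1 / \<bar>Re z - \<beta>\<bar>)"
      using p \<beta> by (intro mult_mono divide_right_mono) auto
    finally show ?thesis .
  qed
  finally show ?thesis .
next
  case False
  then have z: "\<beta> < Re z" using assms by simp
  have "norm (K z) \<le> norm (laplace_tr Q z) + norm (laplace_tr Vneg z)"
  proof -
    have "norm (K z) = norm (laplace_tr Q z + laplace_tr Vneg z)"
      using z by (subst norm_minus_cancel[symmetric]) (simp add: K_def)
    then show ?thesis by (simp add: norm_triangle_ineq)
  qed
  also have "\<dots> \<le> 1 / (\<psi> (Re z) - p) + 1 / p"
    using norm_laplace_tr_le[of Q z] norm_laplace_tr_le[of Vneg z] Q_int[OF z] Vneg_le(1)[of "Re z"]
        Vneg_le'[of "Re z"] z \<beta>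
    by auto
  also have "1 / (\<psi> (Re z) - p) \<le> 1 / (p * (Re z - \<beta>) / \<beta>)"
    using \<psi>_right[of "Re z"] \<psi>_greater[OF z] z p \<beta> by (intro divide_left_mono mult_pos_pos) auto
  also have "1 / (p * (Re z - \<beta>) / \<beta>) + 1 / p = (\<beta> / p) * (1 / \<bar>Re z - \<beta>\<bar>) + 1 / p"
    using z by simp
  also have "\<dots> \<le> ((1 + \<beta>) / p) * (1 / \<bar>Re z - \<beta>\<bar>) + (1 + \<beta>) / p"
    using p \<beta> by (intro add_mono mult_right_mono divide_right_mono) auto
  also have "\<dots> = (1 + \<beta>) / p * (1 + 1 / \<bar>Re z - \<beta>\<bar>)"
    by (simp add: ring_distribs)
  finally show ?thesis by simp
qed

text \<open>
  The bound on \<open>K\<close> blows up along the critical line.  On the circle \<open>\<bar>w - \<beta>\<bar> = \<rho>\<close> the factor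
  \<open>(w - \<beta>)\<^sup>2 + \<rho>\<^sup>2\<close> equals \<open>2 Re (w - \<beta>) (w - \<beta>)\<close>, which compensates for this.
\<close>

lemma K_eq_affine: "\<exists>a b. \<forall>z. z \<noteq> of_real \<beta> \<longrightarrow> K z = a / (z - of_real \<beta>) + b"
proof -
  let ?b = "of_real \<beta> :: complex"
  define C where "C = (1 + \<beta>) / p"
  have C: "C \<ge> 0" using p \<beta> by (simp add: C_def)
  obtain c0 where c0: "((\<lambda>z. (z - ?b) * K z) \<longlongrightarrow> c0) (at ?b)"
    using K_simple_pole by blast
  \<comment> \<open>Multiplying by \<open>z - \<beta>\<close> and filling in the limit removes the
    pole; the entire function \<open>L\<close> will be shown to grow at most linearly.\<close>
  define L where "L z = (if z = ?b then c0 else (z - ?b) * K z)" for z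
  have L: "L holomorphic_on UNIV"
    unfolding L_def[abs_def]
    by (rule removable_singularity[OF _ _ c0])
      (auto intro!: holomorphic_intros holomorphic_on_subset[OF holomorphic_K])
  have L_bound: "norm (L z) \<le> 8 * C * (norm (z - ?b) + 1)" if "z \<noteq> ?b" for z
  proof -
    \<comment> \<open>Doubling the distance puts \<open>z\<close> well inside the circle: there the
      compensating factor has modulus at least \<rho>^2 - (\<rho> / 2)^2, three quarters of
      \<rho>^2.\<close>
    define \<rho> where "\<rho> = 2 * norm (z - ?b)"
    have \<rho>: "\<rho> > 0" using that by (simp add: \<rho>_def)
    let ?f = "\<lambda>w. L w * ((w - ?b)\<^sup>2 + (of_real \<rho>)\<^sup>2)"
    have holf: "?f holomorphic_on UNIV" by (intro holomorphic_intros L)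
    have "norm (?f z) \<le> 2 * C * \<rho>\<^sup>2 * (\<rho> + 1)"
    proof (rule maximum_modulus_frontier[where f="?f" and S="cball ?b \<rho>" and \<xi>=z])
      show "?f holomorphic_on interior (cball ?b \<rho>)"
        by (rule holomorphic_on_subset[OF holf]) simp
      show "continuous_on (closure (cball ?b \<rho>)) ?f"
        by (rule holomorphic_on_imp_continuous_on[OF holomorphic_on_subset[OF holf]]) simp
      show "z \<in> cball ?b \<rho>" by (simp add: \<rho>_def dist_norm norm_minus_commute)
      fix w assume "w \<in> frontier (cball ?b \<rho>)"
      then have w: "norm (w - ?b) = \<rho>" using \<rho> by (simp add: frontier_cball dist_norm norm_minus_commute)
      then have wb: "w \<noteq> ?b" using \<rho> by auto
      define x where "x = Re w - \<beta>"
      have "(w - ?b)\<^sup>2 + (of_real \<rho>)\<^sup>2 = of_real (2 * x) * (w - ?b)"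
      proof -
        have "of_real \<rho> ^ 2 = (w - ?b) * cnj (w - ?b)"
          unfolding w[symmetric] by (simp only: complex_norm_square flip: of_real_power)
        then have "(w - ?b)\<^sup>2 + (of_real \<rho>)\<^sup>2 = ((w - ?b) + cnj (w - ?b)) * (w - ?b)"
          by (simp add: power2_eq_square algebra_simps)
        then show ?thesis by (simp only: complex_add_cnj x_def) simp
      qed
      then have "norm (?f w) = \<rho> * norm (K w) * (2 * \<bar>x\<bar> * \<rho>)"
        using w wb by (simp add: L_def norm_mult)
      \<comment> \<open>On the critical line itself the factor is zero, so the bound on
        \<open>K\<close> is invoked only off it.\<close>
      also have "\<dots> \<le> 2 * C * \<rho>\<^sup>2 * (\<rho> + 1)"
      proof (cases "x = 0")
        case False
        have "\<bar>x\<bar> \<le> \<rho>" using abs_Re_le_cmod[of "w - ?b"] w by (simp add: x_def)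
        have "norm (K w) \<le> C * (1 + 1 / \<bar>x\<bar>)"
          using norm_K_le[of w] False by (simp add: C_def x_def)
        then have "\<rho> * norm (K w) * (2 * \<bar>x\<bar> * \<rho>) \<le> \<rho> * (C * (1 + 1 / \<bar>x\<bar>)) * (2 * \<bar>x\<bar> * \<rho>)"
          using \<rho> by (intro mult_right_mono mult_left_mono) auto
        also have "\<dots> = 2 * C * \<rho>\<^sup>2 * (\<bar>x\<bar> + 1)"
          using False by (simp add: power2_eq_square field_simps)
        also have "\<dots> \<le> 2 * C * \<rho>\<^sup>2 * (\<rho> + 1)"
          using C \<open>\<bar>x\<bar> \<le> \<rho>\<close> by (intro mult_left_mono) auto
        finally show ?thesis .
      qed (use C \<rho> in auto)
      finally show "norm (?f w) \<le> 2 * C * \<rho>\<^sup>2 * (\<rho> + 1)" .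
    qed auto
    moreover have "norm (?f z) \<ge> norm (L z) * (3 / 4 * \<rho>\<^sup>2)"
    proof -
      have "norm ((of_real \<rho>)\<^sup>2 + (z - ?b)\<^sup>2) \<ge> norm ((of_real \<rho> :: complex)\<^sup>2) - norm ((z - ?b)\<^sup>2)"
        by (metis norm_diff_ineq)
      also have "norm ((of_real \<rho> :: complex)\<^sup>2) - norm ((z - ?b)\<^sup>2) = 3 / 4 * \<rho>\<^sup>2"
        by (simp add: norm_power \<rho>_def power_mult_distrib)
      finally show ?thesis unfolding norm_mult add.commute[of "(z - ?b)\<^sup>2"]
        by (intro mult_left_mono) auto
    qed
    ultimately have "norm (L z) * (3 / 4 * \<rho>\<^sup>2) \<le> 2 * C * \<rho>\<^sup>2 * (\<rho> + 1)"
      by linarith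
    then have "(norm (L z) * (3 / 4)) * \<rho>\<^sup>2 \<le> (2 * C * (\<rho> + 1)) * \<rho>\<^sup>2"
      by (simp only: mult_ac)
    then have "norm (L z) * (3 / 4) \<le> 2 * C * (\<rho> + 1)"
      by (rule mult_right_le_imp_le) (use \<rho> in simp)
    then have "norm (L z) \<le> 8 / 3 * C * (2 * norm (z - ?b) + 1)"
      by (simp add: \<rho>_def field_simps)
    also have "\<dots> \<le> 8 / 3 * C * (3 * (norm (z - ?b) + 1))"
      using C by (intro mult_left_mono) auto
    also have "\<dots> = 8 * C * (norm (z - ?b) + 1)" by simp
    finally show ?thesis .
  qed
  define f where "f = (\<lambda>z. L (z + ?b))"
  \<comment> \<open>By Liouville's theorem an entire function of linear growth is affine, hence just
    two Taylor terms.\<close>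
  have f_eq: "f \<xi> = (\<Sum>k\<le>1. (deriv ^^ k) f 0 / fact k * \<xi> ^ k)" for \<xi>
  proof (rule Liouville_polynomial)
    show "f holomorphic_on UNIV"
      unfolding f_def by (intro holomorphic_on_compose[of _ UNIV L, unfolded o_def] holomorphic_intros
          holomorphic_on_subset[OF L]) auto
    show "norm (f z) \<le> 16 * C * norm z ^ 1" if "1 \<le> norm z" for z
    proof -
      have "norm (f z) \<le> 8 * C * (norm z + 1)"
        unfolding f_def using L_bound[of "z + ?b"] that by (simp, force)
      also have "\<dots> \<le> 8 * C * (norm z + norm z)"
        using C that by (intro mult_left_mono) auto
      finally show ?thesis by simp
    qed
  qed
  have "K z = f 0 / (z - ?b) + deriv f 0" if "z \<noteq> ?b" for z
  proof -
    have "(z - ?b) * K z = f (z - ?b)" using that by (simp add: f_def L_def)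
    also have "\<dots> = f 0 + deriv f 0 * (z - ?b)"
      using f_eq[of "z - ?b"] by simp
    finally show ?thesis using that by (simp add: field_simps)
  qed
  then show ?thesis by blast
qed

section \<open>The exponential part and the density of the resolvent measure\<close>

lemma K_real_left: "K (of_real \<theta>) = of_real (\<integral>y. exp (\<theta> * y) \<partial>Vpos)" if "\<theta> < \<beta>"
  using that by (simp add: K_def laplace_tr_of_real)

lemma K_real_right: "K (of_real \<theta>) = - of_real ((\<integral>y. exp (\<theta> * y) \<partial>Q) + (\<integral>y. exp (\<theta> * y) \<partial>Vneg))"
    if "\<beta> < \<theta>"
  using that by (simp add: K_def laplace_tr_of_real)

lemma AE_Vpos: "AE y in Vpos. 0 < y"
  unfolding Vpos_def by (subst AE_density) (auto simp: indicator_def)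

text \<open>All mass sits at positive points, so the transform dies out along the negative real
  axis. This rules out a constant term in \<open>K\<close>.\<close>

lemma Vpos_tendsto_0: "(\<lambda>n. \<integral>y. exp (- real n * y) \<partial>Vpos) \<longlonglongrightarrow> 0"
proof -
  have "(\<lambda>n. \<integral>y. exp (- real n * y) \<partial>Vpos) \<longlonglongrightarrow> (\<integral>y. 0 \<partial>Vpos)"
  proof (rule integral_dominated_convergence[where w="\<lambda>_. 1"])
    show "integrable Vpos (\<lambda>_. 1 :: real)" using Vpos_le(1)[OF \<beta>] by simp
    show "AE y in Vpos. (\<lambda>n. exp (- real n * y)) \<longlonglongrightarrow> 0"
      using AE_Vpos
    proof eventually_elim
      case (elim y)
      have "(\<lambda>n. exp (- y) ^ n) \<longlonglongrightarrow> 0" using elim by (intro LIMSEQ_power_zero) auto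
      then show ?case by (simp add: exp_of_nat_mult[symmetric] mult.commute)
    qed
    show "AE y in Vpos. norm (exp (- real n * y)) \<le> 1" for n
      using AE_Vpos by eventually_elim simp
  qed auto
  then show ?thesis by simp
qed

text \<open>The residue constant, read off at 0: a transform \<open>c / (\<beta> - z)\<close> takes
  the value \<open>c / \<beta>\<close> there. It turns out to be the reciprocal of the derivative of
  \<psi> at \<beta>.\<close>

definition "c = \<beta> * (\<integral>y. exp (0 * y) \<partial>Vpos)"

lemma c_nonneg: "0 \<le> c"
  using \<beta> by (simp add: c_def)

text \<open>Two constants are left open. Letting the argument tend to minus infinity along the
  integers gives \<open>b = 0\<close>, and the value at 0 determines \<open>a\<close>.\<close>

lemma K_eq_pole: "K z = of_real c / (of_real \<beta> - z)" if "z \<noteq> of_real \<beta>"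
proof -
  obtain a b where ab: "\<And>z. z \<noteq> of_real \<beta> \<Longrightarrow> K z = a / (z - of_real \<beta>) + b"
    using K_eq_affine by blast
  have "(\<lambda>n. K (of_real (- real n))) \<longlonglongrightarrow> 0"
  proof -
    have "(\<lambda>n. of_real (\<integral>y. exp (- real n * y) \<partial>Vpos) :: complex) \<longlonglongrightarrow> of_real 0"
      by (intro tendsto_of_real Vpos_tendsto_0)
    moreover have "K (of_real (- real n)) = of_real (\<integral>y. exp (- real n * y) \<partial>Vpos)" for n
      using \<beta> by (intro K_real_left) linarith
    ultimately show ?thesis by (simp only: of_real_0)
  qed
  moreover have "(\<lambda>n. K (of_real (- real n))) \<longlonglongrightarrow> b"
  proof -
    have "(\<lambda>n. norm (a / (of_real (- real n) - of_real \<beta>))) \<longlonglongrightarrow> 0"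
    proof (rule Lim_transform_eventually)
      have "filterlim (\<lambda>n. \<beta> + real n) at_top sequentially"
        by (intro filterlim_tendsto_add_at_top[OF tendsto_const] filterlim_real_sequentially)
      then show "(\<lambda>n. norm a / (\<beta> + real n)) \<longlonglongrightarrow> 0"
        by (rule real_tendsto_divide_at_top[OF tendsto_const])
      have "norm (of_real (- real n) - of_real \<beta> :: complex) = \<beta> + real n" for n
        using \<beta> by (simp only: norm_of_real flip: of_real_diff)
      then show "eventually (\<lambda>n. norm a / (\<beta> + real n) =
          norm (a / (of_real (- real n) - of_real \<beta>))) sequentially"
        by (simp only: norm_divide) simp
    qed
    then have "(\<lambda>n. a / (of_real (- real n) - of_real \<beta>) + b) \<longlonglongrightarrow> 0 + b"
      by (intro tendsto_add tendsto_const) (simp only: tendsto_norm_zero_iff)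
    moreover have "K (of_real (- real n)) = a / (of_real (- real n) - of_real \<beta>) + b" for n
      using \<beta> by (intro ab) (metis less_eq_real_def neg_le_0_iff_le not_less of_nat_0_le_iff
          of_real_eq_iff order.trans)
    ultimately show ?thesis by simp
  qed
  ultimately have b: "b = 0" by (rule LIMSEQ_unique[symmetric])
  have "of_real (\<integral>y. exp (0 * y) \<partial>Vpos) = a / (- of_real \<beta>)"
    using ab[of 0] K_real_left[of 0] \<beta> b by simp
  then have "a = - of_real c"
    using \<beta> by (simp add: c_def field_simps)
  then show ?thesis
    using ab[OF that] b that by (simp add: field_simps)
qed

lemma Vpos_laplace: "(\<integral>y. exp (\<theta> * y) \<partial>Vpos) = c / (\<beta> - \<theta>)" if "\<theta> < \<beta>"
proof -
  have "(of_real (\<integral>y. exp (\<theta> * y) \<partial>Vpos) :: complex) = of_real (c / (\<beta> - \<theta>))"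
    using K_eq_pole[of "of_real \<theta>"] K_real_left[OF that] that by simp
  then show ?thesis by (simp only: of_real_eq_iff)
qed

lemma QVneg_laplace: "(\<integral>y. exp (\<theta> * y) \<partial>Q) + (\<integral>y. exp (\<theta> * y) \<partial>Vneg) = c / (\<theta> - \<beta>)" if "\<beta> < \<theta>"
proof -
  have "(of_real ((\<integral>y. exp (\<theta> * y) \<partial>Q) + (\<integral>y. exp (\<theta> * y) \<partial>Vneg)) :: complex) = - of_real (c / (\<beta> - \<theta>))"
    using K_eq_pole[of "of_real \<theta>"] K_real_right[OF that] that
      by (metis add.inverse_inverse minus_equation_iff of_real_diff of_real_divide of_real_eq_iff
        order_less_irrefl)
  also have "\<dots> = of_real (- (c / (\<beta> - \<theta>)))" by simp
  also have "- (c / (\<beta> - \<theta>)) = c / (\<theta> - \<beta>)" by (simp add: minus_divide_right)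
  finally show ?thesis by (simp only: of_real_eq_iff)
qed

text \<open>From the right of \<beta>: there \<open>c / (\<theta> - \<beta>)\<close> is a sum of two
  transforms, of which that of the scale function is strictly positive.\<close>

lemma c_pos: "0 < c"
proof -
  have "0 < 1 / (\<psi> (\<beta> + 1) - p)" using \<psi>_greater[of "\<beta> + 1"] by simp
  moreover have "(\<integral>y. exp ((\<beta> + 1) * y) \<partial>Vneg) \<ge> 0" by simp
  moreover have "1 / (\<psi> (\<beta> + 1) - p) + (\<integral>y. exp ((\<beta> + 1) * y) \<partial>Vneg) = c"
    using QVneg_laplace[of "\<beta> + 1"] Q_int(2)[of "\<beta> + 1"] by simp
  ultimately show ?thesis by linarith
qed

text \<open>The density shared out between the reflected scale function and the negative part of the
  resolvent measure. Its transform converges to the right of \<beta>, with value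
  \<open>c / (\<theta> - \<beta>)\<close>.\<close>

definition "exp_neg u = indicator {..0} u * (c * exp (- \<beta> * u))"
definition "W_refl u = W (- u)"
definition "dens u = c * exp (- \<beta> * u) - W (- u)"

lemma exp_neg_meas [measurable]: "exp_neg \<in> borel_measurable borel" 
  and W_refl_meas [measurable]: "W_refl \<in> borel_measurable borel"
  and dens_meas [measurable]: "dens \<in> borel_measurable borel"
  unfolding exp_neg_def[abs_def] W_refl_def[abs_def] dens_def[abs_def] by measurable

lemma exp_neg_nonneg: "0 \<le> exp_neg u" and W_refl_nonneg: "0 \<le> W_refl u"
  using c_nonneg by (simp_all add: exp_neg_def W_refl_def W_nonneg)

lemma Vpos_eq: "Vpos = density lborel (\<lambda>u. ennreal (indicator {0<..} u * (c * exp (- \<beta> * u))))"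
proof (rule laplace_uniqueness[OF _ _ \<beta>])
  fix \<theta> assume t: "\<theta> \<in> {0<..<\<beta>}"
  show "integrable Vpos (\<lambda>y. exp (\<theta> * y))" using t by (intro Vpos_le) auto
  let ?\<nu> = "density lborel (\<lambda>u. ennreal (indicator {0<..} u * (c * exp (- \<beta> * u))))"
  have "(\<integral>\<^sup>+y. ennreal (exp (\<theta> * y)) \<partial>?\<nu>) =
      (\<integral>\<^sup>+u. ennreal (indicator {0<..} u * (c * exp (- \<beta> * u))) * ennreal (exp (\<theta> * u)) \<partial>lborel)"
    by (subst nn_integral_density) auto
  also have "\<dots> = (\<integral>\<^sup>+u. ennreal c * (indicator {0..} u * ennreal (exp (- (\<beta> - \<theta>) * u))) \<partial>lborel)"
  proof (intro nn_integral_cong_AE)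
    have "AE u in lborel. u \<noteq> (0 :: real)" by (rule AE_lborel_singleton)
    then show "AE u in lborel. ennreal (indicator {0<..} u * (c * exp (- \<beta> * u))) *
        ennreal (exp (\<theta> * u)) =
        ennreal c * (indicator {0..} u * ennreal (exp (- (\<beta> - \<theta>) * u)))"
      by eventually_elim
        (use c_nonneg in \<open>auto simp: indicator_def ring_distribs mult.assoc simp flip: ennreal_mult
            exp_add\<close>)
  qed
  also have "\<dots> = ennreal c * (\<integral>\<^sup>+u. indicator {0..} u * ennreal (exp (- (\<beta> - \<theta>) * u)) \<partial>lborel)"
    by (rule nn_integral_cmult) measurable
  also have "\<dots> = ennreal c * ennreal (1 / (\<beta> - \<theta>))"
    using t by (subst nn_integral_exp_decay) auto
  also have "\<dots> = ennreal (c / (\<beta> - \<theta>))"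
    using t c_nonneg by (simp flip: ennreal_mult)
  finally have nn: "(\<integral>\<^sup>+y. ennreal (exp (\<theta> * y)) \<partial>?\<nu>) = ennreal (c / (\<beta> - \<theta>))" .
  show "integrable ?\<nu> (\<lambda>y. exp (\<theta> * y))"
    by (rule integral_exp_eq_nn_integral[OF _ nn]) (use t c_nonneg in auto)
  have "(\<integral>y. exp (\<theta> * y) \<partial>?\<nu>) = c / (\<beta> - \<theta>)"
    by (rule integral_exp_eq_nn_integral[OF _ nn]) (use t c_nonneg in auto)
  then show "(\<integral>y. exp (\<theta> * y) \<partial>Vpos) = (\<integral>y. exp (\<theta> * y) \<partial>?\<nu>)"
    using Vpos_laplace[of \<theta>] t by simp
qed auto

lemma nn_exp_neg: "(\<integral>\<^sup>+u. ennreal (exp_neg u) * ennreal (exp (\<theta> * u)) \<partial>lborel) = ennreal (c / (\<theta> - \<beta>))"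
  if "\<beta> < \<theta>" for \<theta>
proof -
  have "(\<integral>\<^sup>+u. ennreal (exp_neg u) * ennreal (exp (\<theta> * u)) \<partial>lborel) =
      (\<integral>\<^sup>+u. ennreal (exp_neg (- u)) * ennreal (exp (\<theta> * - u)) \<partial>lborel)"
    by (rule nn_integral_lborel_reflect[symmetric]) measurable
  also have "\<dots> = (\<integral>\<^sup>+u. ennreal c * (indicator {0..} u * ennreal (exp (- (\<theta> - \<beta>) * u))) \<partial>lborel)"
    using c_nonneg by (intro nn_integral_cong)
      (auto simp: exp_neg_def indicator_def ring_distribs mult.assoc simp flip: ennreal_mult exp_add)
  also have "\<dots> = ennreal c * (\<integral>\<^sup>+u. indicator {0..} u * ennreal (exp (- (\<theta> - \<beta>) * u)) \<partial>lborel)"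
    by (rule nn_integral_cmult) measurable
  also have "\<dots> = ennreal c * ennreal (1 / (\<theta> - \<beta>))"
    using that by (subst nn_integral_exp_decay) auto
  also have "\<dots> = ennreal (c / (\<theta> - \<beta>))"
    using that c_nonneg by (simp flip: ennreal_mult)
  finally show ?thesis .
qed

lemma nn_W_refl: "(\<integral>\<^sup>+u. ennreal (W_refl u) * ennreal (exp (\<theta> * u)) \<partial>lborel) = ennreal (1 / (\<psi> \<theta> - p))"
  if "\<beta> < \<theta>"
  using nn_Q[OF that] by (simp add: Q_def W_refl_def nn_integral_density)

lemma nn_Vneg: "(\<integral>\<^sup>+y. ennreal (exp (\<theta> * y)) \<partial>Vneg) = ennreal (c / (\<theta> - \<beta>) - 1 / (\<psi> \<theta> - p))"
  if "\<beta> < \<theta>"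
proof -
  have "(\<integral>y. exp (\<theta> * y) \<partial>Vneg) = c / (\<theta> - \<beta>) - 1 / (\<psi> \<theta> - p)"
    using QVneg_laplace[OF that] Q_int(2)[OF that] by linarith
  then show ?thesis
    using Vneg_le(1)[of \<theta>] that \<beta> by (simp add: nn_integral_eq_integral)
qed

lemma Vneg_laplace_nonneg: "0 \<le> c / (\<theta> - \<beta>) - 1 / (\<psi> \<theta> - p)" if "\<beta> < \<theta>"
proof -
  have "0 \<le> (\<integral>y. exp (\<theta> * y) \<partial>Vneg)" by simp
  then show ?thesis
    using QVneg_laplace[OF that] Q_int(2)[OF that] by linarith
qed

text \<open>Stated as an addition because the negative part is not yet known to have a density, and
  a difference of measures would require the domination proved next.\<close>

lemma Q_Vneg: "add_measure Q Vneg = density lborel (\<lambda>u. ennreal (exp_neg u))"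
proof (rule laplace_uniqueness[of _ _ \<beta> "\<beta> + 1"])
  fix \<theta> assume "\<theta> \<in> {\<beta><..<\<beta> + 1}"
  then have t: "\<beta> < \<theta>" by simp
  let ?\<nu> = "density lborel (\<lambda>u. ennreal (exp_neg u))"
  have pos: "0 \<le> 1 / (\<psi> \<theta> - p)" "0 \<le> c / (\<theta> - \<beta>) - 1 / (\<psi> \<theta> - p)"
    using \<psi>_greater[OF t] Vneg_laplace_nonneg[OF t] by auto
  have nn1: "(\<integral>\<^sup>+y. ennreal (exp (\<theta> * y)) \<partial>?\<nu>) = ennreal (c / (\<theta> - \<beta>))"
    using nn_exp_neg[OF t] by (simp add: nn_integral_density)
  have nn2: "(\<integral>\<^sup>+y. ennreal (exp (\<theta> * y)) \<partial>add_measure Q Vneg) = ennreal (c / (\<theta> - \<beta>))"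
    by (subst nn_integral_add_measure) (use pos in \<open>auto simp: nn_Q[OF t] nn_Vneg[OF t] simp flip:
        ennreal_plus\<close>)
  have c: "0 \<le> c / (\<theta> - \<beta>)" using c_nonneg t by simp
  show "integrable ?\<nu> (\<lambda>y. exp (\<theta> * y))" "integrable (add_measure Q Vneg) (\<lambda>y. exp (\<theta> * y))"
    "(\<integral>y. exp (\<theta> * y) \<partial>add_measure Q Vneg) = (\<integral>y. exp (\<theta> * y) \<partial>?\<nu>)"
    using integral_exp_eq_nn_integral[OF _ nn1 c] integral_exp_eq_nn_integral[OF _ nn2 c] by auto
qed auto

text \<open>\<open>Q\<close> is dominated by the sum of \<open>Q\<close> and \<open>Vneg\<close>.
  Testing this on the set where the claim fails leaves an excess that must vanish. The weight
  \<open>exp ((\<beta> + 1) * u)\<close> makes the integrals finite, as cancellation requires;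
  \<open>exp_neg\<close> alone is not integrable.\<close>

lemma AE_W_refl_le_exp_neg: "AE u in lborel. W_refl u \<le> exp_neg u"
proof -
  let ?A = "{u. exp_neg u < W_refl u}" and ?e = "\<lambda>u. ennreal (exp ((\<beta> + 1) * u))"
  have A [measurable]: "?A \<in> sets borel" by measurable
  have "(\<integral>\<^sup>+u. indicator ?A u * ?e u \<partial>Q) \<le> (\<integral>\<^sup>+u. indicator ?A u * ?e u \<partial>add_measure Q Vneg)"
    by (subst nn_integral_add_measure) (auto)
  then have le: "(\<integral>\<^sup>+u. ennreal (W_refl u) * (indicator ?A u * ?e u) \<partial>lborel) \<le>
      (\<integral>\<^sup>+u. ennreal (exp_neg u) * (indicator ?A u * ?e u) \<partial>lborel)"
    unfolding Q_Vneg by (simp add: Q_def nn_integral_density flip: W_refl_def)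
  have fin: "(\<integral>\<^sup>+u. ennreal (exp_neg u) * (indicator ?A u * ?e u) \<partial>lborel) \<noteq> \<infinity>"
  proof -
    have "(\<integral>\<^sup>+u. ennreal (exp_neg u) * (indicator ?A u * ?e u) \<partial>lborel) \<le>
        (\<integral>\<^sup>+u. ennreal (exp_neg u) * ?e u \<partial>lborel)"
      by (intro nn_integral_mono) (auto simp: indicator_def)
    then show ?thesis using nn_exp_neg[of "\<beta> + 1"] by (auto simp: top_unique)
  qed
  have "(\<integral>\<^sup>+u. ennreal (W_refl u) * (indicator ?A u * ?e u) \<partial>lborel) =
      (\<integral>\<^sup>+u. ennreal (exp_neg u) * (indicator ?A u * ?e u) + ennreal (W_refl u - exp_neg u) *
          (indicator ?A u * ?e u) \<partial>lborel)"
    using exp_neg_nonneg by (intro nn_integral_cong) (auto simp: indicator_def simp flip: distrib_right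
        ennreal_plus)
  also have "\<dots> = (\<integral>\<^sup>+u. ennreal (exp_neg u) * (indicator ?A u * ?e u) \<partial>lborel) +
      (\<integral>\<^sup>+u. ennreal (W_refl u - exp_neg u) * (indicator ?A u * ?e u) \<partial>lborel)"
    by (rule nn_integral_add) measurable
  finally have "(\<integral>\<^sup>+u. ennreal (exp_neg u) * (indicator ?A u * ?e u) \<partial>lborel) +
      (\<integral>\<^sup>+u. ennreal (W_refl u - exp_neg u) * (indicator ?A u * ?e u) \<partial>lborel)
      \<le> (\<integral>\<^sup>+u. ennreal (exp_neg u) * (indicator ?A u * ?e u) \<partial>lborel) + 0"
    using le by (simp only: add_0_right)
  then have "(\<integral>\<^sup>+u. ennreal (W_refl u - exp_neg u) * (indicator ?A u * ?e u) \<partial>lborel) = 0"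
    using fin unfolding ennreal_add_left_cancel_le by simp
  then have "AE u in lborel. ennreal (W_refl u - exp_neg u) * (indicator ?A u * ?e u) = 0"
    by (subst (asm) nn_integral_0_iff_AE) auto
  then show ?thesis
    by eventually_elim (auto simp: indicator_def ennreal_eq_0_iff not_less split: if_splits)
qed

lemma AE_dens_nonneg: "AE u in lborel. 0 \<le> dens u"
  using AE_W_refl_le_exp_neg
proof eventually_elim
  case (elim u)
  then show ?case using c_nonneg by (cases "u \<le> 0") (auto simp: exp_neg_def W_refl_def dens_def W_neg)
qed

text \<open>With the domination in hand the transforms may be subtracted, and uniqueness to the
  right of \<beta> applies.\<close>

lemma Vneg_eq: "Vneg = density lborel (\<lambda>u. ennreal (exp_neg u - W_refl u))"
proof (rule laplace_uniqueness[of _ _ \<beta> "\<beta> + 1"])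
  fix \<theta> assume "\<theta> \<in> {\<beta><..<\<beta> + 1}"
  then have t: "\<beta> < \<theta>" by simp
  let ?\<nu> = "density lborel (\<lambda>u. ennreal (exp_neg u - W_refl u))" and ?e = "\<lambda>u. ennreal (exp (\<theta> * u))"
  have pos: "0 \<le> 1 / (\<psi> \<theta> - p)" "0 \<le> c / (\<theta> - \<beta>) - 1 / (\<psi> \<theta> - p)"
    using \<psi>_greater[OF t] Vneg_laplace_nonneg[OF t] by auto
  have "(\<integral>\<^sup>+u. ennreal (exp_neg u) * ?e u \<partial>lborel) =
      (\<integral>\<^sup>+u. ennreal (exp_neg u - W_refl u) * ?e u + ennreal (W_refl u) * ?e u \<partial>lborel)"
    using AE_W_refl_le_exp_neg by (intro nn_integral_cong_AE)
      (auto elim!: eventually_mono simp: W_refl_nonneg simp flip: distrib_right ennreal_plus)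
  also have "\<dots> = (\<integral>\<^sup>+u. ennreal (exp_neg u - W_refl u) * ?e u \<partial>lborel) + (\<integral>\<^sup>+u. ennreal (W_refl u) *
      ?e u \<partial>lborel)"
    by (rule nn_integral_add) measurable
  finally have "ennreal (c / (\<theta> - \<beta>)) = (\<integral>\<^sup>+y. ?e y \<partial>?\<nu>) + ennreal (1 / (\<psi> \<theta> - p))"
    by (simp only: nn_exp_neg[OF t] nn_W_refl[OF t]) (simp add: nn_integral_density)
  then have "(\<integral>\<^sup>+y. ?e y \<partial>?\<nu>) = ennreal (c / (\<theta> - \<beta>)) - ennreal (1 / (\<psi> \<theta> - p))"
    by (simp add: ennreal_add_diff_cancel_right)
  then have nn: "(\<integral>\<^sup>+y. ?e y \<partial>?\<nu>) = ennreal (c / (\<theta> - \<beta>) - 1 / (\<psi> \<theta> - p))"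
    using pos by (simp add: ennreal_minus)
  show "integrable ?\<nu> (\<lambda>y. exp (\<theta> * y))" "integrable Vneg (\<lambda>y. exp (\<theta> * y))"
    "(\<integral>y. exp (\<theta> * y) \<partial>Vneg) = (\<integral>y. exp (\<theta> * y) \<partial>?\<nu>)"
    using integral_exp_eq_nn_integral[OF _ nn pos(2)] integral_exp_eq_nn_integral[OF _ nn_Vneg[OF t]
        pos(2)] by auto
qed auto

lemma nn_integral_V_pos:
  assumes [measurable]: "f \<in> borel_measurable borel"
  shows "(\<integral>\<^sup>+y. indicator {0<..} y * f y \<partial>V) =
      (\<integral>\<^sup>+y. indicator {0<..} y * (ennreal (c * exp (- \<beta> * y)) * f y) \<partial>lborel)"
proof -
  have "(\<integral>\<^sup>+y. indicator {0<..} y * f y \<partial>V) = (\<integral>\<^sup>+y. f y \<partial>Vpos)"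
    by (simp add: Vpos_def nn_integral_density)
  also have "\<dots> = (\<integral>\<^sup>+y. ennreal (indicator {0<..} y * (c * exp (- \<beta> * y))) * f y \<partial>lborel)"
    unfolding Vpos_eq by (simp add: nn_integral_density)
  also have "\<dots> = (\<integral>\<^sup>+y. indicator {0<..} y * (ennreal (c * exp (- \<beta> * y)) * f y) \<partial>lborel)"
    by (intro nn_integral_cong) (auto simp: indicator_def)
  finally show ?thesis .
qed

lemma V_eq: "V = density lborel (\<lambda>u. ennreal (dens u))"
proof (rule measure_eqI)
  fix A assume "A \<in> sets V"
  then have [measurable]: "A \<in> sets borel" by simp
  have "emeasure V A = (\<integral>\<^sup>+y. indicator A y \<partial>V)" by simp
  also have "\<dots> = (\<integral>\<^sup>+y. indicator A y \<partial>Vpos) + (\<integral>\<^sup>+y. indicator A y \<partial>Vneg)"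
    by (rule nn_integral_V_split) measurable
  also have "\<dots> = (\<integral>\<^sup>+u. ennreal (indicator {0<..} u * (c * exp (- \<beta> * u))) * indicator A u +
      ennreal (exp_neg u - W_refl u) * indicator A u \<partial>lborel)"
    by (subst nn_integral_add) (simp_all add: Vpos_eq Vneg_eq emeasure_density)
  also have "\<dots> = (\<integral>\<^sup>+u. ennreal (dens u) * indicator A u \<partial>lborel)"
    by (intro nn_integral_cong) (auto simp: indicator_def exp_neg_def W_refl_def dens_def W_neg)
  also have "\<dots> = emeasure (density lborel (\<lambda>u. ennreal (dens u))) A"
    by (simp add: emeasure_density)
  finally show "emeasure V A = emeasure (density lborel (\<lambda>u. ennreal (dens u))) A" .
qed simp

text \<open>On both sides of \<beta>, \<open>1 / (p - \<psi> \<theta>)\<close> is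
  \<open>c / (\<beta> - \<theta>)\<close> plus the transform of the negative part, which is at most
  \<open>1 / p\<close>. Multiplying by \<open>\<beta> - \<theta>\<close> and taking reciprocals
  yields the difference quotient, so differentiability comes out together with the value.\<close>

lemma \<psi>_has_derivative: "(\<psi> has_real_derivative 1 / c) (at \<beta>)"
  unfolding has_field_derivative_iff
proof (rule Lim_transform_eventually)
  define v where "v \<theta> = (\<integral>y. exp (\<theta> * y) \<partial>Vneg)" for \<theta>
  have "((\<lambda>\<theta>. (\<beta> - \<theta>) * v \<theta>) \<longlongrightarrow> 0) (at \<beta>)"
  proof (rule Lim_null_comparison)
    have "eventually (\<lambda>\<theta>. \<theta> \<in> {0<..}) (at \<beta>)"
      using \<beta> by (intro eventually_at_in_open') auto
    then show "eventually (\<lambda>\<theta>. norm ((\<beta> - \<theta>) * v \<theta>) \<le> \<bar>\<beta> - \<theta>\<bar> * (1 / p)) (at \<beta>)"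
    proof eventually_elim
      case (elim \<theta>)
      have "\<bar>v \<theta>\<bar> \<le> 1 / p" using Vneg_le'[of \<theta>] elim by (simp add: v_def)
      then show ?case unfolding real_norm_def abs_mult by (rule mult_left_mono) simp
    qed
    have "((\<lambda>\<theta>. \<bar>\<beta> - \<theta>\<bar> * (1 / p)) \<longlongrightarrow> \<bar>\<beta> - \<beta>\<bar> * (1 / p)) (at \<beta>)" by (intro tendsto_intros)
    then show "((\<lambda>\<theta>. \<bar>\<beta> - \<theta>\<bar> * (1 / p)) \<longlongrightarrow> 0) (at \<beta>)" by simp
  qed
  then have "((\<lambda>\<theta>. 1 / (c + (\<beta> - \<theta>) * v \<theta>)) \<longlongrightarrow> 1 / (c + 0)) (at \<beta>)"
    using c_pos by (intro tendsto_intros) auto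
  then show "((\<lambda>\<theta>. 1 / (c + (\<beta> - \<theta>) * v \<theta>)) \<longlongrightarrow> 1 / c) (at \<beta>)" by simp
  have "eventually (\<lambda>\<theta>. \<theta> \<noteq> \<beta> \<and> \<theta> \<in> {0<..}) (at \<beta>)"
    using \<beta> by (intro eventually_conj eventually_at_in_open') (auto simp: eventually_at_filter)
  then show "eventually (\<lambda>\<theta>. 1 / (c + (\<beta> - \<theta>) * v \<theta>) = (\<psi> \<theta> - \<psi> \<beta>) / (\<theta> - \<beta>)) (at \<beta>)"
  proof eventually_elim
    case (elim \<theta>)
    have "1 / (p - \<psi> \<theta>) = c / (\<beta> - \<theta>) + v \<theta>"
    proof (cases "\<theta> < \<beta>")
      case True
      then show ?thesis
        using V_parts_real[of \<theta>] Vpos_laplace[of \<theta>] elim by (simp add: v_def)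
    next
      case False
      then have t: "\<beta> < \<theta>" using elim by simp
      have "- (1 / (\<psi> \<theta> - p)) = - (c / (\<theta> - \<beta>)) + v \<theta>"
        using QVneg_laplace[OF t] Q_int(2)[OF t] by (simp add: v_def)
      then show ?thesis by (simp only: minus_divide_right minus_diff_eq)
    qed
    then have "(\<beta> - \<theta>) / (p - \<psi> \<theta>) = c + (\<beta> - \<theta>) * v \<theta>"
      using elim by (simp add: field_simps)
    then have "1 / (c + (\<beta> - \<theta>) * v \<theta>) = (p - \<psi> \<theta>) / (\<beta> - \<theta>)" by (metis inverse_divide inverse_eq_divide)
    also have "\<dots> = (\<psi> \<theta> - \<psi> \<beta>) / (\<theta> - \<beta>)"
      by (simp add: \<psi>\<beta>) (metis minus_diff_eq minus_divide_divide)
    finally show ?case .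
  qed
qed

end

section \<open>Transition operators and resolvent measures of a Levy process\<close>

text \<open>Cauchy's functional equation with a lower bound only. After subtraction of the linear
  part, \<open>b\<close> is additive and unchanged by adding multiples of 1 / n, hence bounded below
  everywhere; homogeneity upgrades this to \<open>b \<ge> 0\<close>, and
  \<open>b t + b (m - t) = 0\<close> forces equality.\<close>

lemma additive_bounded_below_imp_linear:
  fixes a :: "real \<Rightarrow> real"
  assumes add: "\<And>s t. 0 \<le> s \<Longrightarrow> 0 \<le> t \<Longrightarrow> a (s + t) = a s + a t"
    and \<delta>: "0 < \<delta>" and bd: "\<And>t. 0 \<le> t \<Longrightarrow> t \<le> \<delta> \<Longrightarrow> C \<le> a t"
    and t: "0 \<le> t"
  shows "a t = t * a 1"
proof -
  define b where "b t = a t - t * a 1" for t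
  have b_add: "b (s + t) = b s + b t" if "0 \<le> s" "0 \<le> t" for s t
    using add[OF that] by (simp add: b_def algebra_simps)
  have b_mult: "b (real n * t) = real n * b t" if "0 \<le> t" for n t
  proof (induction n)
    case 0
    then show ?case using b_add[of 0 0] by simp
  next
    case (Suc n)
    have "b (real (Suc n) * t) = b (real n * t + t)" by (simp add: algebra_simps)
    then show ?case using Suc that by (simp add: b_add algebra_simps)
  qed
  have b1: "b 1 = 0" by (simp add: b_def)
  obtain n where n: "0 < n" "1 / real n < \<delta>"
    using reals_Archimedean2[of "1 / \<delta>"] \<delta>
      by (metis divide_less_eq divide_pos_pos less_trans mult.commute of_nat_0_less_iff zero_less_one)
  have bn: "b (1 / real n) = 0"
    using b_mult[of "1 / real n" n] n b1 by simp
  have lower: "C - \<delta> * \<bar>a 1\<bar> \<le> b s" if s: "0 \<le> s" for s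
  proof -
    define k where "k = nat \<lfloor>s * real n\<rfloor>"
    have k: "real k \<le> s * real n" "s * real n < real k + 1"
      using s n by (simp_all add: k_def)
    define u where "u = s - real k * (1 / real n)"
    have u: "0 \<le> u" "u \<le> \<delta>"
    proof -
      show "0 \<le> u" using k n by (simp add: u_def field_simps)
      have "s \<le> (real k + 1) / real n" using k n by (simp add: pos_le_divide_eq)
      then have "u \<le> 1 / real n" by (simp add: u_def add_divide_distrib)
      then show "u \<le> \<delta>" using n by simp
    qed
    have "b s = b (u + real k * (1 / real n))" by (simp add: u_def)
    also have "\<dots> = b u" using u n b_mult[of "1 / real n" k] bn by (subst b_add) auto
    also have "\<dots> \<ge> C - \<delta> * \<bar>a 1\<bar>"
    proof -
      have "u * a 1 \<le> u * \<bar>a 1\<bar>" using u by (intro mult_left_mono) auto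
      also have "\<dots> \<le> \<delta> * \<bar>a 1\<bar>" using u by (intro mult_right_mono) auto
      finally show ?thesis using bd[OF u] by (simp add: b_def)
    qed
    finally show ?thesis .
  qed
  have nonneg: "0 \<le> b s" if s: "0 \<le> s" for s
  proof (rule ccontr)
    assume "\<not> 0 \<le> b s"
    then have neg: "b s < 0" by simp
    obtain m where "(C - \<delta> * \<bar>a 1\<bar>) / b s < real m" using reals_Archimedean2 by blast
    then have "real m * b s < C - \<delta> * \<bar>a 1\<bar>"
      using neg by (simp add: divide_less_eq)
    then show False using lower[of "real m * s"] b_mult[OF s, of m] s by simp
  qed
  obtain m where m: "t \<le> real m" using real_arch_simple by blast
  have "b t + b (real m - t) = 0"
    using b_add[of t "real m - t"] b_mult[of 1 m] b1 t m by simp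
  then have "b t = 0" using nonneg[of t] nonneg[of "real m - t"] t m by simp
  then show ?thesis by (simp add: b_def)
qed

section \<open>Joint measurability of the paths\<close>

locale levy = prob_space M for M :: "'a measure" +
  fixes X :: "real \<Rightarrow> 'a \<Rightarrow> real"
  assumes levy: "levy_process M X"
begin

lemma X_meas [measurable]: "0 \<le> t \<Longrightarrow> X t \<in> borel_measurable M"
  using levy by (simp add: levy_process_def)

lemma X_0: "AE \<omega> in M. X 0 \<omega> = 0"
  using levy by (simp add: levy_process_def)

lemma X_right: "\<omega> \<in> space M \<Longrightarrow> 0 \<le> t \<Longrightarrow> ((\<lambda>s. X s \<omega>) \<longlongrightarrow> X t \<omega>) (at_right t)"
  using levy by (simp add: levy_process_def cadlag_def)

text \<open>Independence from the arrivals is given for the sigma-algebra generated by the path, so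
  path functionals have to be measurable with respect to it and not just with respect to
  \<open>M\<close>.\<close>

definition "path_algebra = vimage_algebra (space M) (\<lambda>\<omega>. \<lambda>t\<in>{0..}. X t \<omega>) (PiM {0..} (\<lambda>_.
    borel :: real measure))"

lemma space_path_algebra [simp]: "space path_algebra = space M"
  by (simp add: path_algebra_def)

lemma X_meas_path_algebra: "0 \<le> t \<Longrightarrow> X t \<in> borel_measurable path_algebra"
proof -
  assume t: "0 \<le> t"
  have "(\<lambda>\<omega>. \<lambda>t\<in>{0..}. X t \<omega>) \<in> measurable path_algebra (PiM {0..} (\<lambda>_. borel))"
    unfolding path_algebra_def by (rule measurable_vimage_algebra1) (auto simp: space_PiM)
  then have "(\<lambda>\<omega>. (\<lambda>t\<in>{0..}. X t \<omega>) t) \<in> borel_measurable path_algebra"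
    by (rule measurable_compose) (use t in \<open>auto intro!: measurable_component_singleton\<close>)
  then show ?thesis using t by simp
qed

lemma sets_path_algebra_subset: "sets path_algebra \<subseteq> sets M"
  unfolding path_algebra_def
proof (rule sets_image_in_sets)
  show "(\<lambda>\<omega>. \<lambda>t\<in>{0..}. X t \<omega>) \<in> measurable M (PiM {0..} (\<lambda>_. borel))"
    by (rule measurable_restrict) auto
qed simp

lemma measurable_id_path_algebra [measurable]: "(\<lambda>\<omega>. \<omega>) \<in> measurable M path_algebra"
  using sets_path_algebra_subset by (auto simp: measurable_def dest: sets.sets_into_space)

text \<open>Right-continuity: time is rounded up to a grid, which leaves countably many coordinates,
  and the mesh tends to 0. The \<open>max 0\<close> makes the map total without touching negative
  times.\<close>

lemma X_joint_path_algebra [measurable]: "(\<lambda>(\<omega>, t). X (max 0 t) \<omega>) \<in> borel_measurable (path_algebra \<Otimes>\<^sub>M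
    borel)"
proof -
  \<comment> \<open>The added 1 makes the grid point strictly later than the given time, so that the
    limit is a right limit.\<close>
  define s where "s n t = (real (nat \<lfloor>max 0 t * real (Suc n)\<rfloor>) + 1) / real (Suc n)" for n and t :: real
  have s: "max 0 t < s n t" "s n t \<le> max 0 t + 1 / real (Suc n)" for n t
  proof -
    define y where "y = max 0 t * real (Suc n)"
    have c: "0 < real (Suc n)" by simp
    have "0 \<le> y" by (simp add: y_def)
    then have "real (nat \<lfloor>y\<rfloor>) = of_int \<lfloor>y\<rfloor>" by simp
    then have y: "y < real (nat \<lfloor>y\<rfloor>) + 1" "real (nat \<lfloor>y\<rfloor>) \<le> y" by linarith+
    show "max 0 t < s n t"
      unfolding s_def pos_less_divide_eq[OF c] using y(1) by (simp only: y_def)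
    have "(max 0 t + 1 / real (Suc n)) * real (Suc n) = y + 1"
      using c by (simp add: distrib_right y_def del: of_nat_Suc)
    then show "s n t \<le> max 0 t + 1 / real (Suc n)"
      unfolding s_def pos_divide_le_eq[OF c] using y(2) by (simp only: y_def)
  qed
  have "(\<lambda>x. X (s n (snd x)) (fst x)) \<in> borel_measurable (path_algebra \<Otimes>\<^sub>M borel)" for n
    unfolding s_def
  proof (rule measurable_compose_countable[where f="\<lambda>i x. X ((real i + 1) / real (Suc n)) (fst x)" and
      g="\<lambda>x. nat \<lfloor>max 0 (snd x) * real (Suc n)\<rfloor>"])
    show "(\<lambda>x. X ((real i + 1) / real (Suc n)) (fst x)) \<in> borel_measurable (path_algebra \<Otimes>\<^sub>M borel)"
        for i
      by (rule measurable_compose[OF measurable_fst X_meas_path_algebra]) auto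
  qed measurable
  moreover have "(\<lambda>n. X (s n (snd x)) (fst x)) \<longlonglongrightarrow> X (max 0 (snd x)) (fst x)"
      if "x \<in> space (path_algebra \<Otimes>\<^sub>M borel)" for x
  proof -
    have "filterlim (\<lambda>n. s n (snd x)) (at_right (max 0 (snd x))) sequentially"
      unfolding filterlim_at
    proof
      show "(\<lambda>n. s n (snd x)) \<longlonglongrightarrow> max 0 (snd x)"
      proof (rule tendsto_sandwich[where f="\<lambda>_. max 0 (snd x)"])
        show "(\<lambda>n. max 0 (snd x) + 1 / real (Suc n)) \<longlonglongrightarrow> max 0 (snd x)"
          using tendsto_add[OF tendsto_const LIMSEQ_Suc[OF lim_1_over_n], of "max 0 (snd x)"] by simp
        show "eventually (\<lambda>n. s n (snd x) \<le> max 0 (snd x) + 1 / real (Suc n)) sequentially"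
          by (intro always_eventually allI s)
        show "eventually (\<lambda>n. max 0 (snd x) \<le> s n (snd x)) sequentially"
          by (intro always_eventually allI less_imp_le s)
      qed simp
    qed (use s in \<open>auto intro!: always_eventually simp: less_imp_neq[symmetric]\<close>)
    moreover have "fst x \<in> space M" using that by (auto simp: space_pair_measure)
    ultimately show ?thesis
      by (intro filterlim_compose[OF X_right]) auto
  qed
  ultimately have "(\<lambda>x. X (max 0 (snd x)) (fst x)) \<in> borel_measurable (path_algebra \<Otimes>\<^sub>M borel)"
    by (rule borel_measurable_LIMSEQ_real[rotated])
  then show ?thesis by (simp add: case_prod_beta')
qed

lemma X_joint [measurable]: "(\<lambda>(\<omega>, t). X (max 0 t) \<omega>) \<in> borel_measurable (M \<Otimes>\<^sub>M borel)"
proof -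
  have "(\<lambda>(\<omega>, t). (\<omega>, t)) \<in> measurable (M \<Otimes>\<^sub>M borel) (path_algebra \<Otimes>\<^sub>M (borel :: real measure))"
    by measurable
  from measurable_compose[OF this X_joint_path_algebra] show ?thesis by (simp add: case_prod_beta')
qed

lemma measurable_X_path_algebra:
  assumes "f \<in> measurable N path_algebra" "g \<in> borel_measurable N"
  shows "(\<lambda>x. X (max 0 (g x)) (f x)) \<in> borel_measurable N"
  using measurable_compose[OF measurable_Pair[OF assms] X_joint_path_algebra] by simp

lemma measurable_X_M [measurable (raw)]:
  assumes "f \<in> measurable N M" "g \<in> borel_measurable N"
  shows "(\<lambda>x. X (max 0 (g x)) (f x)) \<in> borel_measurable N"
  using measurable_compose[OF measurable_Pair[OF assms] X_joint] by simp

section \<open>Transition operators and the Markov property\<close>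

definition transition :: "real \<Rightarrow> (real \<Rightarrow> ennreal) \<Rightarrow> real \<Rightarrow> ennreal" where
  "transition s f x = (\<integral>\<^sup>+\<omega>. f (x + X (max 0 s) \<omega>) \<partial>M)"

lemma transition_meas [measurable (raw)]:
  assumes [measurable]: "f \<in> borel_measurable borel" "g \<in> borel_measurable N" "h \<in> borel_measurable N"
  shows "(\<lambda>x. transition (g x) f (h x)) \<in> borel_measurable N"
  unfolding transition_def by measurable

text \<open>The last increment is independent of the earlier ones, which splits the integral; by
  stationarity an independent copy of \<open>X (t (Suc n) - t n)\<close> stands for it.\<close>

lemma nn_integral_increment:
  fixes t :: "nat \<Rightarrow> real"
  assumes t: "incseq t" "0 \<le> t 0"
    and [measurable]: "F \<in> borel_measurable (PiM {..<n} (\<lambda>_. borel) \<Otimes>\<^sub>M borel)"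
  defines "\<Delta> \<equiv> \<lambda>i \<omega>. X (t (Suc i)) \<omega> - X (t i) \<omega>"
  shows "(\<integral>\<^sup>+\<omega>. F (\<lambda>i\<in>{..<n}. \<Delta> i \<omega>, \<Delta> n \<omega>) \<partial>M) =
    (\<integral>\<^sup>+\<omega>. \<integral>\<^sup>+\<omega>'. F (\<lambda>i\<in>{..<n}. \<Delta> i \<omega>, X (t (Suc n) - t n) \<omega>') \<partial>M \<partial>M)"
proof -
  have t0: "0 \<le> t i" for i using t incseqD[OF t(1), of 0 i] by simp
  have tS: "t i \<le> t (Suc i)" for i using incseqD[OF t(1), of i "Suc i"] by simp
  have \<Delta>_meas [measurable]: "\<Delta> i \<in> borel_measurable M" for i
    unfolding \<Delta>_def using t0 by measurable
  have ind: "indep_vars (\<lambda>_. borel) \<Delta> UNIV"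
    using levy t unfolding levy_process_def \<Delta>_def by blast
  have "indep_var (PiM {..<n} (\<lambda>_. borel)) (\<lambda>\<omega>. \<lambda>i\<in>{..<n}. \<Delta> i \<omega>) (PiM {n} (\<lambda>_. borel)) (\<lambda>\<omega>. \<lambda>i\<in>{n}.
      \<Delta> i \<omega>)"
    by (rule indep_var_restrict[OF ind]) auto
  then have joint: "distr M (PiM {..<n} (\<lambda>_. borel) \<Otimes>\<^sub>M PiM {n} (\<lambda>_. borel)) (\<lambda>\<omega>. (\<lambda>i\<in>{..<n}. \<Delta> i \<omega>,
      \<lambda>i\<in>{n}. \<Delta> i \<omega>)) =
      distr M (PiM {..<n} (\<lambda>_. borel)) (\<lambda>\<omega>. \<lambda>i\<in>{..<n}. \<Delta> i \<omega>) \<Otimes>\<^sub>M distr M (PiM {n} (\<lambda>_. borel)) (\<lambda>\<omega>.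
          \<lambda>i\<in>{n}. \<Delta> i \<omega>)"
    by (simp add: indep_var_distribution_eq)
  have stat: "distr M borel (\<Delta> n) = distr M borel (X (t (Suc n) - t n))"
  proof -
    have "distr M borel (\<lambda>\<omega>. X (t n + (t (Suc n) - t n)) \<omega> - X (t n) \<omega>) =
        distr M borel (X (t (Suc n) - t n))"
      using levy t0 tS[of n] unfolding levy_process_def by (metis diff_ge_0_iff_ge)
    then show ?thesis by (simp add: \<Delta>_def)
  qed
  have [measurable]: "(\<lambda>\<omega>. \<lambda>i\<in>I. \<Delta> i \<omega>) \<in> measurable M (PiM I (\<lambda>_. borel))" for I
    by (rule measurable_restrict) simp
  interpret D2: prob_space "distr M (PiM {n} (\<lambda>_. borel)) (\<lambda>\<omega>. \<lambda>i\<in>{n}. \<Delta> i \<omega>)"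
    by (intro prob_space_distr) measurable
  have [measurable]: "X (t (Suc n) - t n) \<in> borel_measurable M" using tS[of n] by simp
  have [measurable]: "(\<lambda>g. g n) \<in> borel_measurable (PiM {n} (\<lambda>_. borel :: real measure))"
    by (rule measurable_component_singleton) simp
  let ?F = "\<lambda>z. F (fst z, snd z n)"
  have [measurable]: "?F \<in> borel_measurable (PiM {..<n} (\<lambda>_. borel) \<Otimes>\<^sub>M PiM {n} (\<lambda>_. borel))"
    by measurable
  have "(\<integral>\<^sup>+\<omega>. F (\<lambda>i\<in>{..<n}. \<Delta> i \<omega>, \<Delta> n \<omega>) \<partial>M) =
      (\<integral>\<^sup>+z. ?F z \<partial>distr M (PiM {..<n} (\<lambda>_. borel) \<Otimes>\<^sub>M PiM {n} (\<lambda>_. borel)) (\<lambda>\<omega>. (\<lambda>i\<in>{..<n}. \<Delta> i \<omega>,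
          \<lambda>i\<in>{n}. \<Delta> i \<omega>)))"
    by (subst nn_integral_distr) auto
  also have "\<dots> = (\<integral>\<^sup>+x. \<integral>\<^sup>+y. ?F (x, y) \<partial>distr M (PiM {n} (\<lambda>_. borel)) (\<lambda>\<omega>. \<lambda>i\<in>{n}. \<Delta> i \<omega>) \<partial>distr M
      (PiM {..<n} (\<lambda>_. borel)) (\<lambda>\<omega>. \<lambda>i\<in>{..<n}. \<Delta> i \<omega>))"
    unfolding joint by (rule D2.nn_integral_fst[symmetric]) measurable
  also have "\<dots> = (\<integral>\<^sup>+\<omega>. \<integral>\<^sup>+y. ?F (\<lambda>i\<in>{..<n}. \<Delta> i \<omega>, y) \<partial>distr M (PiM {n} (\<lambda>_. borel)) (\<lambda>\<omega>. \<lambda>i\<in>{n}.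
      \<Delta> i \<omega>) \<partial>M)"
    by (subst nn_integral_distr) auto
  also have "\<dots> = (\<integral>\<^sup>+\<omega>. \<integral>\<^sup>+\<omega>'. F (\<lambda>i\<in>{..<n}. \<Delta> i \<omega>, X (t (Suc n) - t n) \<omega>') \<partial>M \<partial>M)"
  proof (intro nn_integral_cong)
    fix \<omega> assume "\<omega> \<in> space M"
    then have g: "(\<lambda>i\<in>{..<n}. \<Delta> i \<omega>) \<in> space (PiM {..<n} (\<lambda>_. borel))" by (auto simp: space_PiM)
    define g where "g = (\<lambda>i\<in>{..<n}. \<Delta> i \<omega>)"
    have [measurable]: "(\<lambda>y. F (g, y)) \<in> borel_measurable borel"
      using g unfolding g_def by measurable
    have "(\<integral>\<^sup>+y. ?F (g, y) \<partial>distr M (PiM {n} (\<lambda>_. borel)) (\<lambda>\<omega>. \<lambda>i\<in>{n}. \<Delta> i \<omega>)) =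
        (\<integral>\<^sup>+\<omega>'. F (g, \<Delta> n \<omega>') \<partial>M)"
      by (subst nn_integral_distr) auto
    also have "\<dots> = (\<integral>\<^sup>+y. F (g, y) \<partial>distr M borel (\<Delta> n))"
      by (subst nn_integral_distr) auto
    also have "\<dots> = (\<integral>\<^sup>+\<omega>'. F (g, X (t (Suc n) - t n) \<omega>') \<partial>M)"
      unfolding stat by (subst nn_integral_distr) auto
    finally show "(\<integral>\<^sup>+y. ?F (\<lambda>i\<in>{..<n}. \<Delta> i \<omega>, y) \<partial>distr M (PiM {n} (\<lambda>_. borel)) (\<lambda>\<omega>. \<lambda>i\<in>{n}. \<Delta> i \<omega>)) =
        (\<integral>\<^sup>+\<omega>'. F (\<lambda>i\<in>{..<n}. \<Delta> i \<omega>, X (t (Suc n) - t n) \<omega>') \<partial>M)"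
      unfolding g_def .
  qed
  finally show ?thesis .
qed

text \<open>
  The absolute values make the arrival times monotone for every sequence of gaps, so that no almost
  sure positivity has to be carried along.
\<close>

definition arrival :: "(nat \<Rightarrow> real) \<Rightarrow> nat \<Rightarrow> real" where
  "arrival d j = (\<Sum>i<j. \<bar>d i\<bar>)"

text \<open>The product starts at index 1 because the starting time is not an arrival and is never
  tested, as in the passage time.\<close>

definition survive :: "real set \<Rightarrow> nat \<Rightarrow> (nat \<Rightarrow> real) \<Rightarrow> 'a \<Rightarrow> ennreal" where
  "survive A k d \<omega> = (\<Prod>j\<in>{1..k}. indicator A (X (max 0 (arrival d j)) \<omega>))"

lemma arrival_nonneg [simp]: "0 \<le> arrival d j"
  by (simp add: arrival_def sum_nonneg)

lemma arrival_0 [simp]: "arrival d 0 = 0" and arrival_Suc: "arrival d (Suc j) = arrival d j + \<bar>d j\<bar>"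
  by (simp_all add: arrival_def)

text \<open>The gaps \<open>d\<close> are frozen, so the arrivals are deterministic times and
  survival is a function of the increments up to the last of them. This is the Markov property at a
  fixed time.\<close>

lemma nn_integral_markov:
  assumes [measurable]: "A \<in> sets borel" "f \<in> borel_measurable borel" and s: "0 \<le> s"
  shows "(\<integral>\<^sup>+\<omega>. survive A k d \<omega> * f (X (max 0 (arrival d k + s)) \<omega>) \<partial>M) =
    (\<integral>\<^sup>+\<omega>. survive A k d \<omega> * transition s f (X (max 0 (arrival d k)) \<omega>) \<partial>M)"
proof -
  \<comment> \<open>The arrivals up to \<open>k\<close> followed by one later time repeated for
    ever: independence of increments is stated for infinite sequences of times.\<close>
  define t where "t i = (if i \<le> k then arrival d i else arrival d k + s)" for i
  have "t i \<le> t (Suc i)" for i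
  proof -
    consider "Suc i \<le> k" | "i = k" | "k < i" by linarith
    then show ?thesis using s by cases (auto simp: t_def arrival_Suc)
  qed
  then have t: "incseq t" "0 \<le> t 0" by (simp_all add: incseq_Suc_iff t_def)
  define \<Delta> where "\<Delta> = (\<lambda>i \<omega>. X (t (Suc i)) \<omega> - X (t i) \<omega>)"
  \<comment> \<open>Survival expressed through partial sums of increments; it agrees with
    \<open>survive\<close> almost surely, since \<open>X 0\<close> vanishes only almost
    surely.\<close>
  define G :: "(nat \<Rightarrow> real) \<Rightarrow> ennreal" where "G g = (\<Prod>j\<in>{1..k}. indicator A (\<Sum>i<j. g i))" for g
  have [measurable]: "(\<lambda>g. \<Sum>i<j. g i) \<in> borel_measurable (PiM {..<k} (\<lambda>_. borel :: real measure))"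
      if "j \<le> k" for j
    using that by (intro borel_measurable_sum measurable_component_singleton) auto
  have [measurable]: "G \<in> borel_measurable (PiM {..<k} (\<lambda>_. borel))"
    unfolding G_def[abs_def]
  proof (rule borel_measurable_prod_ennreal)
    fix j assume "j \<in> {1..k}"
    then have "(\<lambda>g. \<Sum>i<j. g i) \<in> borel_measurable (PiM {..<k} (\<lambda>_. borel :: real measure))"
      by simp
    then show "(\<lambda>g. indicator A (\<Sum>i<j. g i) :: ennreal) \<in> borel_measurable (PiM {..<k} (\<lambda>_. borel))"
      by (rule measurable_compose) simp
  qed
  have X_sum: "AE \<omega> in M. \<forall>j\<le>k. X (arrival d j) \<omega> = (\<Sum>i<j. (\<lambda>i\<in>{..<k}. \<Delta> i \<omega>) i)"
    using X_0
  proof eventually_elim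
    case (elim \<omega>)
    have "(\<Sum>i<j. (\<lambda>i\<in>{..<k}. \<Delta> i \<omega>) i) = X (t j) \<omega> - X (t 0) \<omega>" if "j \<le> k" for j
      using that sum_lessThan_telescope[of "\<lambda>i. X (t i) \<omega>" j] by (simp add: \<Delta>_def)
    then show ?case using elim by (simp add: t_def)
  qed
  have surv: "AE \<omega> in M. survive A k d \<omega> = G (\<lambda>i\<in>{..<k}. \<Delta> i \<omega>) \<and> X (arrival d k) \<omega> =
      (\<Sum>i<k. (\<lambda>i\<in>{..<k}. \<Delta> i \<omega>) i)"
    using X_sum
  proof eventually_elim
    case (elim \<omega>)
    have "survive A k d \<omega> = G (\<lambda>i\<in>{..<k}. \<Delta> i \<omega>)"
      unfolding survive_def G_def
      by (rule prod.cong) (use elim in \<open>auto simp del: restrict_apply' restrict_apply\<close>)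
    then show ?case using elim by blast
  qed
  define F where "F = (\<lambda>(g :: nat \<Rightarrow> real, y). G g * f ((\<Sum>i<k. g i) + y))"
  have F: "F \<in> borel_measurable (PiM {..<k} (\<lambda>_. borel) \<Otimes>\<^sub>M borel)"
    unfolding F_def by measurable
  have tk: "t (Suc k) = arrival d k + s" "t k = arrival d k" by (simp_all add: t_def)
  have "(\<integral>\<^sup>+\<omega>. survive A k d \<omega> * f (X (max 0 (arrival d k + s)) \<omega>) \<partial>M) =
      (\<integral>\<^sup>+\<omega>. F (\<lambda>i\<in>{..<k}. \<Delta> i \<omega>, \<Delta> k \<omega>) \<partial>M)"
  proof (rule nn_integral_cong_AE)
    show "AE \<omega> in M. survive A k d \<omega> * f (X (max 0 (arrival d k + s)) \<omega>) = F (\<lambda>i\<in>{..<k}. \<Delta> i \<omega>, \<Delta> k \<omega>)"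
      using surv
    proof eventually_elim
      case (elim \<omega>)
      have "X (arrival d k + s) \<omega> = X (arrival d k) \<omega> + \<Delta> k \<omega>" by (simp add: \<Delta>_def tk)
      then show ?case unfolding F_def prod.case using s elim
        by (simp only: max_absorb2 add_nonneg_nonneg arrival_nonneg)
    qed
  qed
  also have "\<dots> = (\<integral>\<^sup>+\<omega>. \<integral>\<^sup>+\<omega>'. F (\<lambda>i\<in>{..<k}. \<Delta> i \<omega>, X s \<omega>') \<partial>M \<partial>M)"
    using nn_integral_increment[OF t F] by (simp add: \<Delta>_def tk)
  also have "\<dots> = (\<integral>\<^sup>+\<omega>. survive A k d \<omega> * transition s f (X (max 0 (arrival d k)) \<omega>) \<partial>M)"
  proof (rule nn_integral_cong_AE)
    show "AE \<omega> in M. (\<integral>\<^sup>+\<omega>'. F (\<lambda>i\<in>{..<k}. \<Delta> i \<omega>, X s \<omega>') \<partial>M) =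
        survive A k d \<omega> * transition s f (X (max 0 (arrival d k)) \<omega>)"
      using surv
    proof eventually_elim
      case (elim \<omega>)
      have [measurable]: "X s \<in> borel_measurable M" using s by simp
      have "(\<integral>\<^sup>+\<omega>'. F (\<lambda>i\<in>{..<k}. \<Delta> i \<omega>, X s \<omega>') \<partial>M) =
          (\<integral>\<^sup>+\<omega>'. survive A k d \<omega> * f (X (arrival d k) \<omega> + X s \<omega>') \<partial>M)"
        unfolding F_def prod.case using elim by (simp only:)
      also have "\<dots> = survive A k d \<omega> * (\<integral>\<^sup>+\<omega>'. f (X (arrival d k) \<omega> + X s \<omega>') \<partial>M)"
        by (rule nn_integral_cmult) measurable
      finally show ?case using s by (simp add: transition_def max_absorb2)
    qed
  qed
  finally show ?thesis .
qed

text \<open>The Markov property with a single gap of length \<open>u\<close> and no killing.\<close>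

lemma nn_integral_semigroup:
  assumes [measurable]: "f \<in> borel_measurable borel" and s: "0 \<le> s" "0 \<le> u"
  shows "(\<integral>\<^sup>+\<omega>. f (X (u + s) \<omega>) \<partial>M) = (\<integral>\<^sup>+\<omega>. transition s f (X u \<omega>) \<partial>M)"
  using nn_integral_markov[of UNIV f s "1" "\<lambda>_. u"] s
  by (simp add: survive_def arrival_Suc max_absorb2)

lemma transition_semigroup:
  assumes [measurable]: "f \<in> borel_measurable borel" and s: "0 \<le> s" "0 \<le> u"
  shows "transition (u + s) f x = transition u (transition s f) x"
  using nn_integral_semigroup[of "\<lambda>y. f (x + y)" s u] s
  by (simp add: transition_def max_absorb2 add.assoc)

section \<open>Exponential moments\<close>

definition mgf :: "real \<Rightarrow> real \<Rightarrow> ennreal" where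
  "mgf \<theta> t = (\<integral>\<^sup>+\<omega>. ennreal (exp (\<theta> * X t \<omega>)) \<partial>M)"

lemma mgf_add: "mgf \<theta> (s + t) = mgf \<theta> s * mgf \<theta> t" if "0 \<le> s" "0 \<le> t"
proof -
  have [measurable]: "X t \<in> borel_measurable M" "X s \<in> borel_measurable M" using that by auto
  have "mgf \<theta> (s + t) = (\<integral>\<^sup>+\<omega>. transition t (\<lambda>y. ennreal (exp (\<theta> * y))) (X s \<omega>) \<partial>M)"
    unfolding mgf_def by (rule nn_integral_semigroup) (use that in auto)
  also have "\<dots> = (\<integral>\<^sup>+\<omega>. ennreal (exp (\<theta> * X s \<omega>)) * mgf \<theta> t \<partial>M)"
    unfolding transition_def mgf_def
    by (subst nn_integral_cmult[symmetric])
      (use that in \<open>auto simp: max_absorb2 ring_distribs exp_add ennreal_mult\<close>)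
  also have "\<dots> = mgf \<theta> s * mgf \<theta> t"
    unfolding mgf_def by (rule nn_integral_multc) measurable
  finally show ?thesis .
qed

lemma mgf_nonzero: "mgf \<theta> t \<noteq> 0" if "0 \<le> t"
proof
  have [measurable]: "X t \<in> borel_measurable M" using that by auto
  assume "mgf \<theta> t = 0"
  then have "AE \<omega> in M. ennreal (exp (\<theta> * X t \<omega>)) = 0"
    unfolding mgf_def by (subst (asm) nn_integral_0_iff_AE) auto
  then have "AE \<omega> in M. False" by eventually_elim simp
  then show False by simp
qed

lemma X_tendsto_0:
  assumes t: "\<And>n. 0 \<le> t n" "t \<longlonglongrightarrow> 0" and \<omega>: "\<omega> \<in> space M"
  shows "(\<lambda>n. X (t n) \<omega>) \<longlonglongrightarrow> X 0 \<omega>"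
proof -
  have "((\<lambda>s. X s \<omega>) \<longlongrightarrow> X 0 \<omega>) (at 0 within {0..})"
    using X_right[OF \<omega>, of 0] by (simp add: at_within_Ici_at_right)
  then have "continuous (at 0 within {0..}) (\<lambda>s. X s \<omega>)" by (simp add: continuous_within)
  then show ?thesis
    using t unfolding continuous_within_sequentially o_def by blast
qed

text \<open>Right-continuity at 0. Truncating the exponential at 1 allows dominated convergence
  although the moments may be infinite, and it still bounds them from below, which is what the
  functional equation asks for.\<close>

lemma mgf_lower_bound: "\<exists>\<delta>>0. \<forall>t. 0 \<le> t \<longrightarrow> t \<le> \<delta> \<longrightarrow> ennreal (1 / 2) \<le> mgf \<theta> t"
proof (rule ccontr)
  assume "\<not> ?thesis"
  then have "\<forall>n. \<exists>t. 0 \<le> t \<and> t \<le> 1 / real (Suc n) \<and> mgf \<theta> t < ennreal (1 / 2)"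
    by (metis not_le of_nat_0_less_iff zero_less_Suc zero_less_divide_1_iff)
  then obtain t where t: "\<And>n. 0 \<le> t n" "\<And>n. t n \<le> 1 / real (Suc n)" "\<And>n. mgf \<theta> (t n) < ennreal (1 / 2)"
    by metis
  have [measurable]: "X (t n) \<in> borel_measurable M" "X 0 \<in> borel_measurable M" for n using t by auto
  have "t \<longlonglongrightarrow> 0"
    by (rule tendsto_sandwich[OF _ _ tendsto_const LIMSEQ_Suc[OF lim_1_over_n]])
      (use t in \<open>auto intro!: always_eventually\<close>)
  then have lim: "(\<lambda>n. X (t n) \<omega>) \<longlonglongrightarrow> X 0 \<omega>" if "\<omega> \<in> space M" for \<omega>
    using X_tendsto_0 t that by blast
  have "(\<lambda>n. \<integral>\<omega>. min 1 (exp (\<theta> * X (t n) \<omega>)) \<partial>M) \<longlonglongrightarrow> (\<integral>\<omega>. min 1 (exp (\<theta> * X 0 \<omega>)) \<partial>M)"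
  proof (rule integral_dominated_convergence[where w="\<lambda>_. 1"])
    show "AE \<omega> in M. (\<lambda>n. min 1 (exp (\<theta> * X (t n) \<omega>))) \<longlonglongrightarrow> min 1 (exp (\<theta> * X 0 \<omega>))"
      by (intro AE_I2 tendsto_intros lim)
  qed auto
  moreover have "(\<integral>\<omega>. min 1 (exp (\<theta> * X 0 \<omega>)) \<partial>M) = 1"
  proof -
    have "(\<integral>\<omega>. min 1 (exp (\<theta> * X 0 \<omega>)) \<partial>M) = (\<integral>\<omega>. 1 \<partial>M)"
      using X_0 by (intro integral_cong_AE) (auto elim!: eventually_mono)
    then show ?thesis by (simp add: prob_space)
  qed
  moreover have "(\<integral>\<omega>. min 1 (exp (\<theta> * X (t n) \<omega>)) \<partial>M) \<le> 1 / 2" for n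
  proof (rule integral_real_bounded)
    have "(\<integral>\<^sup>+\<omega>. ennreal (min 1 (exp (\<theta> * X (t n) \<omega>))) \<partial>M) \<le> mgf \<theta> (t n)"
      unfolding mgf_def by (intro nn_integral_mono ennreal_leI) auto
    then show "(\<integral>\<^sup>+\<omega>. ennreal (min 1 (exp (\<theta> * X (t n) \<omega>))) \<partial>M) \<le> ennreal (1 / 2)"
      using t(3)[of n] by (meson less_imp_le order.trans)
  qed simp
  ultimately have "(1 :: real) \<le> 1 / 2"
    by (intro LIMSEQ_le_const2[where X="\<lambda>n. \<integral>\<omega>. min 1 (exp (\<theta> * X (t n) \<omega>)) \<partial>M"]) auto
  then show False by simp
qed

text \<open>Finiteness at time 1 spreads to all times by the multiplicative law, since no factor is
  zero; the logarithm is then additive and locally bounded below, hence linear.\<close>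

lemma mgf_eq:
  assumes fin: "mgf \<theta> 1 < \<infinity>" and t: "0 \<le> t"
  shows "mgf \<theta> t = ennreal (exp (t * ln (enn2real (mgf \<theta> 1))))"
proof -
  have fin_le1: "mgf \<theta> s < \<infinity>" if "0 \<le> s" "s \<le> 1" for s
  proof -
    have "mgf \<theta> 1 = mgf \<theta> s * mgf \<theta> (1 - s)" using mgf_add[of s "1 - s"] that by simp
    moreover have "mgf \<theta> (1 - s) \<noteq> 0" using mgf_nonzero[of "1 - s"] that by simp
    ultimately show ?thesis using fin by (auto simp: less_top[symmetric] ennreal_mult_eq_top_iff)
  qed
  have fin_nat: "mgf \<theta> (real n + s) < \<infinity>" if "0 \<le> s" "s \<le> 1" for n s
  proof (induction n)
    case (Suc n)
    have "mgf \<theta> (real (Suc n) + s) = mgf \<theta> 1 * mgf \<theta> (real n + s)"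
      using mgf_add[of 1 "real n + s"] that by (simp add: add_ac)
    then show ?case using Suc fin by (simp add: ennreal_mult_less_top)
  qed (use fin_le1 that in simp)
  have fin_all: "mgf \<theta> s < \<infinity>" if "0 \<le> s" for s
    using fin_nat[of "s - real (nat \<lfloor>s\<rfloor>)" "nat \<lfloor>s\<rfloor>"] that by simp linarith
  have pos: "0 < enn2real (mgf \<theta> s)" if "0 \<le> s" for s
    using fin_all[OF that] mgf_nonzero[OF that, of \<theta>]
      by (simp add: enn2real_positive_iff zero_less_iff_neq_zero)
  obtain \<delta> where \<delta>: "0 < \<delta>" "\<And>t. 0 \<le> t \<Longrightarrow> t \<le> \<delta> \<Longrightarrow> ennreal (1 / 2) \<le> mgf \<theta> t"
    using mgf_lower_bound by blast
  have "ln (enn2real (mgf \<theta> t)) = t * ln (enn2real (mgf \<theta> 1))"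
  proof (rule additive_bounded_below_imp_linear[OF _ \<delta>(1) _ t])
    show "ln (enn2real (mgf \<theta> (s + t))) = ln (enn2real (mgf \<theta> s)) + ln (enn2real (mgf \<theta> t))"
      if "0 \<le> s" "0 \<le> t" for s t
      using pos[OF that(1)] pos[OF that(2)] by (simp add: mgf_add[OF that] enn2real_mult ln_mult)
    show "ln (1 / 2) \<le> ln (enn2real (mgf \<theta> t))" if "0 \<le> t" "t \<le> \<delta>" for t
    proof -
      have "1 / 2 \<le> enn2real (mgf \<theta> t)"
      proof -
        have "enn2real (ennreal (1 / 2)) \<le> enn2real (mgf \<theta> t)"
          using fin_all[OF that(1)] by (intro enn2real_mono \<delta>(2) that) auto
        then show ?thesis by (subst (asm) enn2real_ennreal) auto
      qed
      then show ?thesis using pos[OF that(1)] by (simp add: ln_le_cancel_iff)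
    qed
  qed
  then have "exp (t * ln (enn2real (mgf \<theta> 1))) = enn2real (mgf \<theta> t)"
    using pos[OF t] by (metis exp_ln)
  then show ?thesis
    using fin_all[OF t] by simp
qed

end

section \<open>Resolvent measures\<close>

context levy
begin

text \<open>Built as an image of a weighted product measure, so that signed integrals can be
  transported as well as nonnegative ones.\<close>

definition resolvent_measure :: "real \<Rightarrow> real measure" where
  "resolvent_measure p = distr (density (M \<Otimes>\<^sub>M lborel) (\<lambda>(\<omega>, t). indicator {0..} t *
      ennreal (exp (- p * t)))) borel
     (\<lambda>(\<omega>, t). X (max 0 t) \<omega>)"

lemma sets_resolvent_measure [simp, measurable_cong]: "sets (resolvent_measure p) = sets borel"
  and space_resolvent_measure [simp]: "space (resolvent_measure p) = UNIV"
  by (simp_all add: resolvent_measure_def)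

lemma nn_integral_resolvent_measure:
  assumes [measurable]: "f \<in> borel_measurable borel"
  shows "(\<integral>\<^sup>+y. f y \<partial>resolvent_measure p) =
    (\<integral>\<^sup>+t. indicator {0..} t * ennreal (exp (- p * t)) * (\<integral>\<^sup>+\<omega>. f (X (max 0 t) \<omega>) \<partial>M) \<partial>lborel)"
proof -
  interpret P: pair_sigma_finite M lborel by unfold_locales
  have [measurable]: "(\<lambda>x. f (X (max 0 (snd x)) (fst x))) \<in> borel_measurable (M \<Otimes>\<^sub>M lborel)"
    by measurable
  have "(\<integral>\<^sup>+y. f y \<partial>resolvent_measure p) = (\<integral>\<^sup>+x. indicator {0..} (snd x) * ennreal (exp (- p * snd x)) *
      f (X (max 0 (snd x)) (fst x)) \<partial>(M \<Otimes>\<^sub>M lborel))"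
    unfolding resolvent_measure_def case_prod_beta'
    by (subst nn_integral_distr) (auto simp: nn_integral_density)
  also have "\<dots> = (\<integral>\<^sup>+t. \<integral>\<^sup>+\<omega>. indicator {0..} t * ennreal (exp (- p * t)) *
      f (X (max 0 t) \<omega>) \<partial>M \<partial>lborel)"
    by (subst P.nn_integral_snd[symmetric]) auto
  also have "\<dots> = (\<integral>\<^sup>+t. indicator {0..} t * ennreal (exp (- p * t)) *
      (\<integral>\<^sup>+\<omega>. f (X (max 0 t) \<omega>) \<partial>M) \<partial>lborel)"
    by (intro nn_integral_cong nn_integral_cmult) measurable
  finally show ?thesis .
qed

lemma nn_integral_resolvent_measure_translate:
  assumes [measurable]: "f \<in> borel_measurable borel"
  shows "(\<integral>\<^sup>+y. f (x + y) \<partial>resolvent_measure p) = (\<integral>\<^sup>+t. indicator {0..} t * ennreal (exp (- p * t)) *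
      transition t f x \<partial>lborel)"
  by (subst nn_integral_resolvent_measure) (simp_all add: transition_def)

lemma nn_integral_resolvent_measure_exp:
  assumes fin: "mgf \<theta> 1 < \<infinity>" and less: "ln (enn2real (mgf \<theta> 1)) < p"
  shows "(\<integral>\<^sup>+y. ennreal (exp (\<theta> * y)) \<partial>resolvent_measure p) =
      ennreal (1 / (p - ln (enn2real (mgf \<theta> 1))))"
proof -
  let ?k = "ln (enn2real (mgf \<theta> 1))"
  have "(\<integral>\<^sup>+y. ennreal (exp (\<theta> * y)) \<partial>resolvent_measure p) =
      (\<integral>\<^sup>+t. indicator {0..} t * ennreal (exp (- p * t)) * mgf \<theta> (max 0 t) \<partial>lborel)"
    by (subst nn_integral_resolvent_measure) (simp_all add: mgf_def)
  also have "\<dots> = (\<integral>\<^sup>+t. indicator {0..} t * ennreal (exp (- (p - ?k) * t)) \<partial>lborel)"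
  proof (intro nn_integral_cong)
    fix t :: real
    have eq: "ennreal (exp (- p * t)) * ennreal (exp (t * ?k)) = ennreal (exp (- (p - ?k) * t))"
      by (simp add: algebra_simps flip: ennreal_mult exp_add)
    then show "indicator {0..} t * ennreal (exp (- p * t)) * mgf \<theta> (max 0 t) =
        indicator {0..} t * ennreal (exp (- (p - ?k) * t))"
    proof (cases "0 \<le> t")
      case True
      then have "mgf \<theta> (max 0 t) = ennreal (exp (t * ?k))"
        using mgf_eq[OF fin True] by (simp only: max_absorb2)
      then show ?thesis using eq by (simp add: mult.assoc)
    qed simp
  qed
  also have "\<dots> = ennreal (1 / (p - ?k))"
    using less by (intro nn_integral_exp_decay) simp
  finally show ?thesis .
qed

lemma nn_integral_resolvent_measure_const: "0 < p \<Longrightarrow> (\<integral>\<^sup>+y. C \<partial>resolvent_measure p) = C * ennreal (1 / p)"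
proof -
  assume p: "0 < p"
  have "mgf 0 1 = 1" by (simp add: mgf_def emeasure_space_1)
  then have "(\<integral>\<^sup>+y. ennreal (exp (0 * y)) \<partial>resolvent_measure p) = ennreal (1 / p)"
    using nn_integral_resolvent_measure_exp[of 0 p] p by simp
  then show ?thesis by simp
qed

end

section \<open>The Laplace exponent and its right inverse\<close>

locale levy_scale = levy M X for M :: "'a measure" and X +
  fixes W :: "real \<Rightarrow> real \<Rightarrow> real"
  assumes W: "\<And>p. 0 \<le> p \<Longrightarrow> is_scale_function (laplace_exponent M X) p (W p)"
begin

abbreviation "\<psi> \<equiv> laplace_exponent M X"
abbreviation "\<Phi> \<equiv> right_inverse \<psi>"

lemma W_meas [measurable]:
  assumes "0 \<le> p"
  shows "W p \<in> borel_measurable borel"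
proof -
  have "(\<lambda>x. indicator {0..} x *\<^sub>R W p x) \<in> borel_measurable borel"
    using W[OF assms] by (intro borel_measurable_continuous_on_indicator) (auto simp:
        is_scale_function_def)
  moreover have "(\<lambda>x. indicator {0..} x *\<^sub>R W p x) = W p"
    using W[OF assms] by (auto simp: is_scale_function_def indicator_def fun_eq_iff)
  ultimately show ?thesis by simp
qed

lemma W_facts:
  assumes "0 \<le> p"
  shows "0 \<le> W p x" "x < 0 \<Longrightarrow> W p x = 0" "0 < x \<Longrightarrow> 0 < W p x"
proof -
  show *: "0 \<le> W p x" for x using W[OF assms] by (simp add: is_scale_function_def)
  show "x < 0 \<Longrightarrow> W p x = 0" using W[OF assms] by (simp add: is_scale_function_def)
  assume "0 < x"
  then have "W p 0 < W p x"
    using W[OF assms] by (auto simp: is_scale_function_def strict_mono_on_def)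
  then show "0 < W p x" using *[of 0] by simp
qed

text \<open>The second claim reads positivity back from the transform: \<open>W p\<close> is
  positive on the open half-line, so the integral cannot be 0, whereas
  \<open>\<psi> \<theta> \<le> p\<close> would make the right-hand side 0, in the case of equality
  through division by zero.\<close>

lemma W_laplace:
  assumes "0 \<le> p" "\<Phi> p < \<theta>"
  shows "(\<integral>\<^sup>+x. ennreal (exp (- \<theta> * x) * W p x) \<partial>lborel) = ennreal (1 / (\<psi> \<theta> - p))" "p < \<psi> \<theta>"
proof -
  have [measurable]: "W p \<in> borel_measurable borel" using assms by simp
  let ?f = "\<lambda>x. exp (- \<theta> * x) * W p x"
  have eq: "(\<lambda>x. indicator {0..} x *\<^sub>R ?f x) = ?f"
    using W_facts[OF assms(1)] by (auto simp: indicator_def fun_eq_iff)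
  have "set_integrable lborel {0..} ?f \<and> (LBINT x:{0..}. ?f x) = 1 / (\<psi> \<theta> - p)"
    using W[OF assms(1)] assms(2) unfolding is_scale_function_def by blast
  then have int: "integrable lborel ?f" and val: "(\<integral>x. ?f x \<partial>lborel) = 1 / (\<psi> \<theta> - p)"
    unfolding set_integrable_def set_lebesgue_integral_def by (simp_all only: eq)
  show nn: "(\<integral>\<^sup>+x. ennreal (?f x) \<partial>lborel) = ennreal (1 / (\<psi> \<theta> - p))"
    unfolding val[symmetric] using W_facts[OF assms(1)] by (intro nn_integral_eq_integral int) auto
  show "p < \<psi> \<theta>"
  proof (rule ccontr)
    assume "\<not> p < \<psi> \<theta>"
    then have "ennreal (1 / (\<psi> \<theta> - p)) = 0" by (simp add: ennreal_eq_0_iff divide_nonneg_nonpos)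
    then have "(\<integral>\<^sup>+x. ennreal (?f x) \<partial>lborel) = 0"
      by (simp only: nn)
    then have "AE x in lborel. ennreal (?f x) = 0"
      by (subst (asm) nn_integral_0_iff_AE) auto
    then have "AE x in lborel. x \<notin> {0<..<1 :: real}"
    proof eventually_elim
      case (elim x)
      then show ?case using W_facts(3)[OF assms(1), of x] W_facts(1)[OF assms(1), of x] 
        by (auto simp: ennreal_eq_0_iff mult_le_0_iff)
    qed
    then have "emeasure lborel {0<..<1 :: real} = 0"
      by (subst (asm) AE_iff_measurable[of "{0<..<1}"]) auto
    then show False by simp
  qed
qed

text \<open>
  An infinite exponential moment would give \<open>\<psi>\<close> the junk value \<open>ln 0 = 0\<close>, whereas the scale function
  for \<open>p = 0\<close> forces \<open>\<psi> > 0\<close> beyond \<open>\<Phi> 0\<close>.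
\<close>

lemma integrable_exp_X: "0 \<le> \<theta> \<Longrightarrow> integrable M (\<lambda>\<omega>. exp (\<theta> * X 1 \<omega>))"
proof -
  assume \<theta>: "0 \<le> \<theta>"
  define \<theta>' where "\<theta>' = max \<theta> (\<Phi> 0 + 1)"
  have "0 < \<psi> \<theta>'" by (rule W_laplace) (auto simp: \<theta>'_def)
  then have int: "integrable M (\<lambda>\<omega>. exp (\<theta>' * X 1 \<omega>))"
    unfolding laplace_exponent_def by (metis ln_0 not_integrable_integral_eq order_less_irrefl)
  show ?thesis
  proof (rule Bochner_Integration.integrable_bound)
    show "integrable M (\<lambda>\<omega>. exp (0 * X 1 \<omega>) + exp (\<theta>' * X 1 \<omega>))" using int by simp
    show "AE \<omega> in M. norm (exp (\<theta> * X 1 \<omega>)) \<le> norm (exp (0 * X 1 \<omega>) + exp (\<theta>' * X 1 \<omega>))"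
    proof (rule AE_I2)
      fix \<omega>
      show "norm (exp (\<theta> * X 1 \<omega>)) \<le> norm (exp (0 * X 1 \<omega>) + exp (\<theta>' * X 1 \<omega>))"
        using exp_le_exp_endpoints[of 0 \<theta> \<theta>' "X 1 \<omega>"] \<theta> by (simp add: \<theta>'_def)
    qed
  qed measurable
qed

definition "mgf1 \<theta> = (\<integral>\<omega>. exp (\<theta> * X 1 \<omega>) \<partial>M)"

lemma mgf1_pos: "0 \<le> \<theta> \<Longrightarrow> 0 < mgf1 \<theta>"
  and mgf_eq_mgf1: "0 \<le> \<theta> \<Longrightarrow> mgf \<theta> 1 = ennreal (mgf1 \<theta>)"
proof -
  assume \<theta>: "0 \<le> \<theta>"
  show eq: "mgf \<theta> 1 = ennreal (mgf1 \<theta>)"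
    unfolding mgf_def mgf1_def by (intro nn_integral_eq_integral integrable_exp_X \<theta>) auto
  show "0 < mgf1 \<theta>" using mgf_nonzero[of 1 \<theta>] eq by (auto simp: ennreal_eq_0_iff not_le)
qed

lemma \<psi>_eq: "\<psi> \<theta> = ln (mgf1 \<theta>)"
  by (simp add: laplace_exponent_def mgf1_def)

lemma exp_\<psi>: "0 \<le> \<theta> \<Longrightarrow> exp (\<psi> \<theta>) = mgf1 \<theta>"
  by (simp add: \<psi>_eq mgf1_pos)

text \<open>Convexity of \<open>exp\<close> between 0 and
  \<open>\<theta> * X 1 \<omega> - \<psi> \<theta>\<close>: the exponential of the latter has mean
  1, so its power with exponent \<open>a\<close> has mean at most 1.\<close>

lemma \<psi>_star:
  assumes a: "0 \<le> a" "a \<le> 1" and \<theta>: "0 \<le> \<theta>"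
  shows "\<psi> (a * \<theta>) \<le> a * \<psi> \<theta>"
proof -
  have i: "integrable M (\<lambda>\<omega>. exp (a * \<theta> * X 1 \<omega>))" "integrable M (\<lambda>\<omega>. exp (\<theta> * X 1 \<omega>))"
    using a \<theta> by (auto intro!: integrable_exp_X)
  have "mgf1 (a * \<theta>) * exp (- a * \<psi> \<theta>) = (\<integral>\<omega>. exp (a * \<theta> * X 1 \<omega>) * exp (- a * \<psi> \<theta>) \<partial>M)"
    using i by (simp add: mgf1_def)
  also have "\<dots> \<le> (\<integral>\<omega>. (1 - a) + a * (exp (\<theta> * X 1 \<omega>) * exp (- \<psi> \<theta>)) \<partial>M)"
  proof (rule integral_mono)
    fix \<omega>
    show "exp (a * \<theta> * X 1 \<omega>) * exp (- a * \<psi> \<theta>) \<le> (1 - a) + a * (exp (\<theta> * X 1 \<omega>) * exp (- \<psi> \<theta>))"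
      using exp_convex_ineq[OF a, of 0 "\<theta> * X 1 \<omega> - \<psi> \<theta>"]
      by (simp add: algebra_simps flip: exp_add)
  qed (use i in auto)
  also have "\<dots> = (1 - a) + a * (mgf1 \<theta> * exp (- \<psi> \<theta>))"
    using i by (simp add: mgf1_def prob_space)
  also have "\<dots> = 1"
    using exp_\<psi>[OF \<theta>] by (simp add: exp_minus flip: exp_\<psi>[OF \<theta>])
  finally have "mgf1 (a * \<theta>) \<le> exp (a * \<psi> \<theta>)"
    by (simp add: exp_minus field_simps)
  then show ?thesis
    using exp_\<psi>[of "a * \<theta>"] a \<theta> by (metis exp_le_cancel_iff mult_nonneg_nonneg)
qed

text \<open>The moment generating function is convex, and convex functions are continuous on open
  intervals. As 0 is excluded, the intermediate value argument below starts from a positive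
  point.\<close>

lemma continuous_on_\<psi>: "continuous_on {0<..} \<psi>"
proof -
  have "convex_on {0<..} mgf1"
  proof (rule convex_onI)
    fix t x y :: real assume t: "0 < t" "t < 1" and xy: "x \<in> {0<..}" "y \<in> {0<..}"
    have i: "integrable M (\<lambda>\<omega>. exp (x * X 1 \<omega>))" "integrable M (\<lambda>\<omega>. exp (y * X 1 \<omega>))"
       "integrable M (\<lambda>\<omega>. exp (((1 - t) * x + t * y) * X 1 \<omega>))"
      using t xy by (auto intro!: integrable_exp_X)
    have "mgf1 ((1 - t) * x + t * y) \<le> (\<integral>\<omega>. (1 - t) * exp (x * X 1 \<omega>) + t * exp (y * X 1 \<omega>) \<partial>M)"
      unfolding mgf1_def
    proof (rule integral_mono)
      show "exp (((1 - t) * x + t * y) * X 1 \<omega>) \<le> (1 - t) * exp (x * X 1 \<omega>) + t * exp (y * X 1 \<omega>)" for \<omega>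
        using exp_convex_ineq[of t "x * X 1 \<omega>" "y * X 1 \<omega>"] t by (simp add: algebra_simps)
    qed (use i in auto)
    also have "\<dots> = (1 - t) * mgf1 x + t * mgf1 y" using i by (simp add: mgf1_def)
    finally show "mgf1 ((1 - t) *\<^sub>R x + t *\<^sub>R y) \<le> (1 - t) * mgf1 x + t * mgf1 y" by simp
  qed simp
  then have "continuous_on {0<..} mgf1" by (intro convex_on_continuous) auto
  then show ?thesis unfolding \<psi>_eq[abs_def] using mgf1_pos
    by (intro continuous_on_ln) (auto simp: less_imp_neq[symmetric])
qed

text \<open>Existence by the intermediate value theorem; uniqueness because
  \<open>\<psi>_star\<close> keeps \<psi> strictly below a positive level to the left of any root.
  The supremum is thus over a single point.\<close>

lemma \<Phi>_root:
  assumes p: "0 < p"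
  shows "0 < \<Phi> p" "\<psi> (\<Phi> p) = p"
proof -
  define b where "b = max 1 (\<Phi> p + 1)"
  have b: "p < \<psi> b" "1 \<le> b" using W_laplace(2)[of p b] p by (auto simp: b_def)
  \<comment> \<open>Small enough that \<open>\<psi> a \<le> a * \<psi> 1 \<le> p\<close>; the 1 in
    the denominator avoids division by zero.\<close>
  define a where "a = min 1 (p / (1 + \<bar>\<psi> 1\<bar>))"
  have a: "0 < a" "a \<le> 1" using p by (auto simp: a_def)
  have "\<psi> a \<le> a * \<psi> 1" using \<psi>_star[of a 1] a by simp
  also have "\<dots> \<le> a * \<bar>\<psi> 1\<bar>" using a by (intro mult_left_mono) auto
  also have "\<dots> \<le> p / (1 + \<bar>\<psi> 1\<bar>) * \<bar>\<psi> 1\<bar>" by (intro mult_right_mono) (auto simp: a_def)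
  also have "\<dots> \<le> p" using p by (simp add: field_simps)
  finally obtain s where s: "a \<le> s" "s \<le> b" "\<psi> s = p"
    using IVT'[of \<psi> a p b] a b continuous_on_subset[OF continuous_on_\<psi>, of "{a..b}"]
    by (meson atLeastAtMost_iff greaterThan_iff less_eq_real_def less_le_trans order.trans subsetI)
  have uniq: "s' = s" if s': "0 \<le> s'" "\<psi> s' = p" for s'
  proof -
    have lt: "\<psi> x < p" if "0 \<le> x" "x < y" "\<psi> y = p" for x y
    proof -
      have "\<psi> x \<le> x / y * p" using \<psi>_star[of "x / y" y] that by simp
      also have "\<dots> < 1 * p" using that p by (intro mult_strict_right_mono) auto
      finally show ?thesis by simp
    qed
    show ?thesis using lt[of s s'] lt[of s' s] s s' a by (cases s s' rule: linorder_cases) auto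
  qed
  have "{s. 0 \<le> s \<and> \<psi> s = p} = {s}" using uniq s a by auto
  then have "\<Phi> p = s" by (simp add: right_inverse_def)
  then show "0 < \<Phi> p" "\<psi> (\<Phi> p) = p" using s a by auto
qed

text \<open>Beyond \<open>\<Phi> r\<close> the exponent exceeds \<open>r\<close>, so the root of the
  lower level cannot lie there.\<close>

lemma \<Phi>_less:
  assumes "0 < p" "p < r"
  shows "\<Phi> p < \<Phi> r"
proof (rule ccontr)
  assume "\<not> \<Phi> p < \<Phi> r"
  then consider "\<Phi> p = \<Phi> r" | "\<Phi> r < \<Phi> p" by linarith
  then show False
  proof cases
    case 1
    then show ?thesis using \<Phi>_root(2)[of p] \<Phi>_root(2)[of r] assms by simp
  next
    case 2
    then show ?thesis using W_laplace(2)[of r "\<Phi> p"] \<Phi>_root(2)[of p] assms by simp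
  qed
qed

lemma \<psi>_less: 
  assumes p: "0 < p" and \<theta>: "0 \<le> \<theta>" "\<theta> < \<Phi> p"
  shows "\<psi> \<theta> < p"
proof -
  have "\<psi> \<theta> \<le> \<theta> / \<Phi> p * p" using \<psi>_star[of "\<theta> / \<Phi> p" "\<Phi> p"] \<Phi>_root[OF p] \<theta> by simp
  also have "\<dots> < 1 * p" using \<theta> p by (intro mult_strict_right_mono) auto
  finally show ?thesis by simp
qed

lemma resolvent_measure_exp:
  assumes p: "0 < p" and \<theta>: "0 \<le> \<theta>" "\<theta> < \<Phi> p"
  shows "(\<integral>\<^sup>+y. ennreal (exp (\<theta> * y)) \<partial>resolvent_measure p) = ennreal (1 / (p - \<psi> \<theta>))"
  using nn_integral_resolvent_measure_exp[of \<theta> p] \<psi>_less[OF assms] mgf_eq_mgf1[OF \<theta>(1)] mgf1_pos[OF \<theta>(1)]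
    by (simp add: \<psi>_eq)

text \<open>The auxiliary rate is taken to be \<open>p + 1\<close>; any rate above \<open>p\<close>
  would serve.\<close>

lemma scale_resolvent:
  assumes p: "0 < p"
  shows "scale_resolvent \<psi> p (p + 1) (\<Phi> p) (\<Phi> (p + 1)) (resolvent_measure p) (resolvent_measure (p +
      1)) (W p)"
proof
  show "\<And>x. 0 \<le> W p x" "\<And>x. x < 0 \<Longrightarrow> W p x = 0" using W_facts[of p] p by auto
  show "\<And>\<theta>. \<Phi> p < \<theta> \<Longrightarrow> (\<integral>\<^sup>+x. ennreal (exp (- \<theta> * x) * W p x) \<partial>lborel) = ennreal (1 / (\<psi> \<theta> - p))"
    using W_laplace(1)[of p] p by simp
qed (use p \<Phi>_root \<Phi>_less \<psi>_star resolvent_measure_exp in auto)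

text \<open>Only the exponential rate matters to the users of this fact: the constant cancels in the
  renewal equation and drops out when the occupation measure is compared with the resolvent.\<close>

lemma resolvent_measure_pos:
  assumes p: "0 < p"
  obtains c where "0 < c" "\<And>f. f \<in> borel_measurable borel \<Longrightarrow>
    (\<integral>\<^sup>+y. indicator {0<..} y * f y \<partial>resolvent_measure p) =
        (\<integral>\<^sup>+y. indicator {0<..} y * (ennreal (c * exp (- \<Phi> p * y)) * f y) \<partial>lborel)"
proof -
  interpret scale_resolvent \<psi> p "p + 1" "\<Phi> p" "\<Phi> (p + 1)" "resolvent_measure p" "resolvent_measure (p +
      1)" "W p"
    by (rule scale_resolvent[OF p])
  show ?thesis using that c_pos nn_integral_V_pos by blast
qed

lemma resolvent_measure_density:
  assumes p: "0 < p"
  shows "resolvent_measure p = density lborel (\<lambda>u. ennreal (resolvent_density \<psi> W p u))"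
    "AE u in lborel. 0 \<le> resolvent_density \<psi> W p u"
    "resolvent_density \<psi> W p \<in> borel_measurable borel"
proof -
  interpret scale_resolvent \<psi> p "p + 1" "\<Phi> p" "\<Phi> (p + 1)" "resolvent_measure p" "resolvent_measure (p +
      1)" "W p"
    by (rule scale_resolvent[OF p])
  have "deriv \<psi> (\<Phi> p) = 1 / c" using \<psi>_has_derivative by (rule DERIV_imp_deriv)
  then have "resolvent_density \<psi> W p = dens"
    by (auto simp: fun_eq_iff resolvent_density_def dens_def)
  then show "resolvent_measure p = density lborel (\<lambda>u. ennreal (resolvent_density \<psi> W p u))"
    "AE u in lborel. 0 \<le> resolvent_density \<psi> W p u"
    "resolvent_density \<psi> W p \<in> borel_measurable borel"
    using V_eq AE_dens_nonneg dens_meas by simp_all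
qed

end

section \<open>The renewal equation on the half-line\<close>

locale levy_sampled = levy_scale M X W for M :: "'a measure" and X W +
  fixes q lam :: real
  assumes q: "0 < q" and lam: "0 < lam"
begin

abbreviation "\<beta> \<equiv> \<Phi> (q + lam)"
abbreviation "\<phi> \<equiv> \<Phi> q"

lemma \<phi>_pos: "0 < \<phi>" and \<phi>_less: "\<phi> < \<beta>"
  using \<Phi>_root[OF q] \<Phi>_less[OF q, of "q + lam"] lam by auto

definition resolvent_op :: "(real \<Rightarrow> ennreal) \<Rightarrow> real \<Rightarrow> ennreal" where
  "resolvent_op f x = (\<integral>\<^sup>+y. f (x + y) \<partial>resolvent_measure (q + lam))"

text \<open>A gap has density \<open>lam * exp (- lam * t)\<close> and is discounted by
  \<open>exp (- q * t)\<close>, whence the factor \<open>lam\<close> and the rate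
  \<open>q + lam\<close>. Only landings in \<open>A\<close> count.\<close>

definition step_op :: "real set \<Rightarrow> (real \<Rightarrow> ennreal) \<Rightarrow> real \<Rightarrow> ennreal" where
  "step_op A g x = ennreal lam * resolvent_op (\<lambda>y. indicator A y * g y) x"

text \<open>The candidate for the discounted occupation functional of the walk from 0 killed on
  leaving the positive half-line, with the starting point not counted.\<close>

definition nu :: "(real \<Rightarrow> ennreal) \<Rightarrow> ennreal" where
  "nu f = (\<integral>\<^sup>+y. indicator {0<..} y * (ennreal ((\<beta> - \<phi>) * exp (- \<phi> * y)) * f y) \<partial>lborel)"

lemma finite_measure_resolvent_measure: "0 < p \<Longrightarrow> finite_measure (resolvent_measure p)"
  using nn_integral_resolvent_measure_const[of p 1] by (intro finite_measureI) (simp add: less_top)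

lemma resolvent_op_meas [measurable (raw)]:
  assumes [measurable]: "f \<in> borel_measurable borel" "h \<in> borel_measurable N"
  shows "(\<lambda>x. resolvent_op f (h x)) \<in> borel_measurable N"
proof -
  interpret finite_measure "resolvent_measure (q + lam)" using q lam
    by (intro finite_measure_resolvent_measure) simp
  show ?thesis unfolding resolvent_op_def by measurable
qed

lemma step_op_meas [measurable (raw)]:
  assumes [measurable]: "A \<in> sets borel" "f \<in> borel_measurable borel" "h \<in> borel_measurable N"
  shows "(\<lambda>x. step_op A f (h x)) \<in> borel_measurable N"
  unfolding step_op_def by measurable

lemma step_op_pow_meas [measurable]:
  assumes [measurable]: "A \<in> sets borel" "f \<in> borel_measurable borel"
  shows "(step_op A ^^ n) f \<in> borel_measurable borel"
  by (induction n) (use step_op_meas[where h="\<lambda>x. x" and N=borel] in auto)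

lemma step_op_mono: "(\<And>x. f x \<le> g x) \<Longrightarrow> A \<subseteq> B \<Longrightarrow> step_op A f x \<le> step_op B g x"
  unfolding step_op_def resolvent_op_def
  by (intro mult_left_mono nn_integral_mono mult_mono) (auto simp: indicator_def)

lemma step_op_pow_mono: "(\<And>x. f x \<le> g x) \<Longrightarrow> A \<subseteq> B \<Longrightarrow> (step_op A ^^ n) f x \<le> (step_op B ^^ n) g x"
  by (induction n arbitrary: x) (auto intro!: step_op_mono)

lemma nu_mono: "(\<And>x. f x \<le> g x) \<Longrightarrow> nu f \<le> nu g"
  unfolding nu_def by (intro nn_integral_mono mult_left_mono) auto

lemma nu_const: "nu (\<lambda>_. C) = C * ennreal ((\<beta> - \<phi>) / \<phi>)"
proof -
  have "nu (\<lambda>_. C) = (\<integral>\<^sup>+y. C * ennreal (\<beta> - \<phi>) * (indicator {0..} y * ennreal (exp (- \<phi> * y))) \<partial>lborel)"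
    unfolding nu_def
  proof (intro nn_integral_cong_AE)
    have "AE y in lborel. y \<noteq> (0 :: real)" by (rule AE_lborel_singleton)
    then show "AE y in lborel. indicator {0<..} y * (ennreal ((\<beta> - \<phi>) * exp (- \<phi> * y)) * C) =
        C * ennreal (\<beta> - \<phi>) * (indicator {0..} y * ennreal (exp (- \<phi> * y)))"
      by eventually_elim (use \<phi>_less in \<open>auto simp: indicator_def ennreal_mult mult_ac\<close>)
  qed
  also have "\<dots> = C * ennreal (\<beta> - \<phi>) * (\<integral>\<^sup>+y. indicator {0..} y * ennreal (exp (- \<phi> * y)) \<partial>lborel)"
    by (rule nn_integral_cmult) measurable
  also have "\<dots> = C * ennreal (\<beta> - \<phi>) * ennreal (1 / \<phi>)"
    by (simp only: nn_integral_exp_decay[OF \<phi>_pos])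
  also have "\<dots> = C * ennreal ((\<beta> - \<phi>) / \<phi>)"
    using \<phi>_pos \<phi>_less by (simp add: mult.assoc flip: ennreal_mult)
  finally show ?thesis .
qed

text \<open>In terms of the landing point \<open>w\<close>, both terms on the right integrate
  \<open>g\<close> against \<open>k w\<close> times a weight: \<open>I w\<close> collects the
  exponentially tilted steps below \<open>w\<close>, \<open>J w\<close> those from \<open>w\<close>
  on. The tilted step law has mass 1, so the weights add up to 1. The exponential form above 0 is
  what makes the single step from 0 equal to \<open>k w * J w\<close>.\<close>

lemma nu_renewal:
  assumes g [measurable]: "g \<in> borel_measurable borel"
  shows "nu g = step_op {0<..} g 0 + nu (step_op {0<..} g)"
proof -
  have p: "0 < q + lam" using q lam by simp
  interpret V: finite_measure "resolvent_measure (q + lam)" using p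
    by (rule finite_measure_resolvent_measure)
  interpret P: pair_sigma_finite lborel "resolvent_measure (q + lam)" by unfold_locales
  obtain c where c: "0 < c" and Vpos: "\<And>f. f \<in> borel_measurable borel \<Longrightarrow>
    (\<integral>\<^sup>+y. indicator {0<..} y * f y \<partial>resolvent_measure (q + lam)) =
        (\<integral>\<^sup>+y. indicator {0<..} y * (ennreal (c * exp (- \<beta> * y)) * f y) \<partial>lborel)"
    using resolvent_measure_pos[OF p] by blast
  define k where "k w = ennreal ((\<beta> - \<phi>) * exp (- \<phi> * w))" for w
  define I where "I w = ennreal lam * (\<integral>\<^sup>+z. indicator {..<w} z *
      ennreal (exp (\<phi> * z)) \<partial>resolvent_measure (q + lam))" for w
  define J where "J w = ennreal (lam * c * exp (- (\<beta> - \<phi>) * w) / (\<beta> - \<phi>))" for w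
  have [measurable]: "k \<in> borel_measurable borel" unfolding k_def[abs_def] by measurable
  have [measurable]: "I \<in> borel_measurable borel"
    unfolding I_def[abs_def] indicator_def lessThan_def by measurable
  have IJ: "I w + J w = 1" if "0 < w" for w
  proof -
    have "(\<integral>\<^sup>+z. ennreal (exp (\<phi> * z)) \<partial>resolvent_measure (q + lam)) =
        (\<integral>\<^sup>+z. indicator {..<w} z * ennreal (exp (\<phi> * z)) + indicator {0<..} z * (indicator {w..} z *
            ennreal (exp (\<phi> * z))) \<partial>resolvent_measure (q + lam))"
      using that by (intro nn_integral_cong) (auto simp: indicator_def)
    also have "\<dots> = (\<integral>\<^sup>+z. indicator {..<w} z * ennreal (exp (\<phi> * z)) \<partial>resolvent_measure (q + lam)) +
        (\<integral>\<^sup>+z. indicator {0<..} z * (indicator {w..} z * ennreal (exp (\<phi> * z))) \<partial>resolvent_measure (q +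
            lam))"
      by (rule nn_integral_add) measurable
    also have "(\<integral>\<^sup>+z. indicator {0<..} z * (indicator {w..} z * ennreal (exp (\<phi> * z))) \<partial>resolvent_measure
        (q + lam)) =
        (\<integral>\<^sup>+z. indicator {0<..} z * (ennreal (c * exp (- \<beta> * z)) * (indicator {w..} z *
            ennreal (exp (\<phi> * z)))) \<partial>lborel)"
      by (rule Vpos) measurable
    also have "\<dots> = (\<integral>\<^sup>+z. ennreal c * (indicator {w..} z * ennreal (exp (- (\<beta> - \<phi>) * z))) \<partial>lborel)"
      using c that by (intro nn_integral_cong)
        (auto simp: indicator_def ring_distribs mult.assoc simp flip: ennreal_mult exp_add)
    also have "\<dots> = ennreal c * (\<integral>\<^sup>+z. indicator {w..} z * ennreal (exp (- (\<beta> - \<phi>) * z)) \<partial>lborel)"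
      by (rule nn_integral_cmult) measurable
    also have "\<dots> = ennreal c * ennreal (exp (- (\<beta> - \<phi>) * w) / (\<beta> - \<phi>))"
      using \<phi>_less by (subst nn_integral_exp_tail) auto
    finally have "ennreal lam * (\<integral>\<^sup>+z. ennreal (exp (\<phi> * z)) \<partial>resolvent_measure (q + lam)) =
        I w + ennreal lam * (ennreal c * ennreal (exp (- (\<beta> - \<phi>) * w) / (\<beta> - \<phi>)))"
      by (simp only: I_def distrib_left)
    also have "ennreal lam * (ennreal c * ennreal (exp (- (\<beta> - \<phi>) * w) / (\<beta> - \<phi>))) = J w"
      using c lam \<phi>_less by (simp add: J_def mult.assoc flip: ennreal_mult)
    \<comment> \<open>\<open>\<psi> \<phi> = q\<close> turns
      \<open>1 / (q + lam - \<psi> \<phi>)\<close> into \<open>1 / lam\<close>.\<close>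
    also have "(\<integral>\<^sup>+z. ennreal (exp (\<phi> * z)) \<partial>resolvent_measure (q + lam)) = ennreal (1 / lam)"
      using resolvent_measure_exp[OF p, of \<phi>] \<phi>_pos \<phi>_less \<Phi>_root(2)[OF q] by simp
    also have "ennreal lam * ennreal (1 / lam) = 1"
      using lam by (simp flip: ennreal_mult)
    finally show ?thesis by simp
  qed
  have kJ: "k w * J w = ennreal lam * ennreal (c * exp (- \<beta> * w))" for w
  proof -
    have "(\<beta> - \<phi>) * exp (- \<phi> * w) * (lam * c * exp (- (\<beta> - \<phi>) * w) / (\<beta> - \<phi>)) =
        lam * (c * exp (- \<beta> * w))"
      using \<phi>_less by (simp add: left_diff_distrib exp_diff exp_minus field_simps)
    then show ?thesis
      using c lam \<phi>_less by (simp add: k_def J_def flip: ennreal_mult)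
  qed
  have K0: "step_op {0<..} g 0 = (\<integral>\<^sup>+w. indicator {0<..} w * (k w * J w * g w) \<partial>lborel)"
  proof -
    have "step_op {0<..} g 0 = ennreal lam * (\<integral>\<^sup>+y. indicator {0<..} y * (ennreal (c * exp (- \<beta> * y)) *
        g y) \<partial>lborel)"
      by (simp add: step_op_def resolvent_op_def Vpos)
    also have "\<dots> = (\<integral>\<^sup>+y. ennreal lam * (indicator {0<..} y * (ennreal (c * exp (- \<beta> * y)) *
        g y)) \<partial>lborel)"
      by (rule nn_integral_cmult[symmetric]) measurable
    also have "\<dots> = (\<integral>\<^sup>+w. indicator {0<..} w * (k w * J w * g w) \<partial>lborel)"
      by (intro nn_integral_cong) (subst kJ, simp only: mult_ac)
    finally show ?thesis .
  qed
  have nuK: "nu (step_op {0<..} g) = (\<integral>\<^sup>+w. indicator {0<..} w * (k w * I w * g w) \<partial>lborel)"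
  proof -
    have "nu (step_op {0<..} g) = (\<integral>\<^sup>+y. \<integral>\<^sup>+z. indicator {0<..} y *
        (k y * (ennreal lam * (indicator {0<..} (y + z) * g (y + z)))) \<partial>resolvent_measure (q +
        lam) \<partial>lborel)"
      unfolding nu_def step_op_def resolvent_op_def k_def[symmetric]
      by (intro nn_integral_cong) (simp add: nn_integral_cmult[symmetric] mult.assoc)
    also have "\<dots> = (\<integral>\<^sup>+z. \<integral>\<^sup>+y. indicator {0<..} y * (k y * (ennreal lam * (indicator {0<..} (y + z) *
        g (y + z)))) \<partial>lborel \<partial>resolvent_measure (q + lam))"
      by (rule P.Fubini'[symmetric]) measurable
    also have "\<dots> = (\<integral>\<^sup>+z. \<integral>\<^sup>+w. indicator {0<..} w * (k w * (ennreal lam * (indicator {..<w} z *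
        ennreal (exp (\<phi> * z)))) * g w) \<partial>lborel \<partial>resolvent_measure (q + lam))"
    proof (rule nn_integral_cong)
      fix z
      \<comment> \<open>The exponential kernel factorises under translation, which separates step
        size and landing point.\<close>
      have kz: "k (w - z) = k w * ennreal (exp (\<phi> * z))" for w
        using \<phi>_less by (simp add: k_def algebra_simps flip: ennreal_mult exp_add)
      have "(\<integral>\<^sup>+y. indicator {0<..} y * (k y * (ennreal lam * (indicator {0<..} (y + z) * g (y + z))))
          \<partial>lborel) =
          (\<integral>\<^sup>+w. indicator {0<..} (w - z) * (k (w - z) * (ennreal lam * (indicator {0<..} w *
              g w))) \<partial>lborel)"
        by (subst nn_integral_real_affine[where c=1 and t="- z"]) (auto simp: algebra_simps)
      also have "\<dots> = (\<integral>\<^sup>+w. indicator {0<..} w * (k w * (ennreal lam * (indicator {..<w} z *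
          ennreal (exp (\<phi> * z)))) * g w) \<partial>lborel)"
        by (intro nn_integral_cong) (auto simp: kz indicator_def mult_ac)
      finally show "(\<integral>\<^sup>+y. indicator {0<..} y * (k y * (ennreal lam * (indicator {0<..} (y + z) *
          g (y + z)))) \<partial>lborel) =
          (\<integral>\<^sup>+w. indicator {0<..} w * (k w * (ennreal lam * (indicator {..<w} z * ennreal (exp (\<phi> * z))))
              * g w) \<partial>lborel)" .
    qed
    also have "\<dots> = (\<integral>\<^sup>+w. \<integral>\<^sup>+z. indicator {0<..} w * (k w * (ennreal lam * (indicator {..<w} z *
        ennreal (exp (\<phi> * z)))) * g w) \<partial>resolvent_measure (q + lam) \<partial>lborel)"
      by (rule P.Fubini') (unfold indicator_def lessThan_def, measurable)
    also have "\<dots> = (\<integral>\<^sup>+w. indicator {0<..} w * (k w * I w * g w) \<partial>lborel)"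
    proof (intro nn_integral_cong)
      fix w
      have "(\<integral>\<^sup>+z. indicator {0<..} w * (k w * (ennreal lam * (indicator {..<w} z *
          ennreal (exp (\<phi> * z)))) * g w) \<partial>resolvent_measure (q + lam)) =
          (\<integral>\<^sup>+z. (indicator {0<..} w * k w * ennreal lam * g w) * (indicator {..<w} z *
              ennreal (exp (\<phi> * z))) \<partial>resolvent_measure (q + lam))"
        by (intro nn_integral_cong) (simp only: mult_ac)
      also have "\<dots> = (indicator {0<..} w * k w * ennreal lam * g w) * (\<integral>\<^sup>+z. indicator {..<w} z *
          ennreal (exp (\<phi> * z)) \<partial>resolvent_measure (q + lam))"
        by (rule nn_integral_cmult) measurable
      finally show "(\<integral>\<^sup>+z. indicator {0<..} w * (k w * (ennreal lam * (indicator {..<w} z *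
          ennreal (exp (\<phi> * z)))) * g w) \<partial>resolvent_measure (q + lam)) =
          indicator {0<..} w * (k w * I w * g w)"
        by (simp only: I_def mult_ac)
    qed
    finally show ?thesis .
  qed
  have [measurable]: "J \<in> borel_measurable borel" unfolding J_def[abs_def] by measurable
  have "nu g = (\<integral>\<^sup>+w. indicator {0<..} w * (k w * J w * g w) + indicator {0<..} w * (k w * I w *
      g w) \<partial>lborel)"
    unfolding nu_def k_def[symmetric]
  proof (intro nn_integral_cong)
    fix w
    show "indicator {0<..} w * (k w * g w) = indicator {0<..} w * (k w * J w * g w) +
        indicator {0<..} w * (k w * I w * g w)"
    proof (cases "0 < w")
      case True
      have "k w * g w = k w * (I w + J w) * g w" using IJ[OF True] by simp
      also have "\<dots> = k w * J w * g w + k w * I w * g w" by (simp add: ring_distribs add.commute)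
      finally show ?thesis using True by simp
    qed simp
  qed
  also have "\<dots> = step_op {0<..} g 0 + nu (step_op {0<..} g)"
    unfolding K0 nuK by (rule nn_integral_add) measurable
  finally show ?thesis .
qed

lemma nu_iterate:
  assumes [measurable]: "g \<in> borel_measurable borel"
  shows "nu g = (\<Sum>k<n. (step_op {0<..} ^^ Suc k) g 0) + nu ((step_op {0<..} ^^ n) g)"
proof (induction n)
  case (Suc n)
  have "nu ((step_op {0<..} ^^ n) g) = (step_op {0<..} ^^ Suc n) g 0 + nu ((step_op {0<..} ^^ Suc n) g)"
    using nu_renewal[of "(step_op {0<..} ^^ n) g"] by simp
  then show ?case using Suc by (simp add: add.assoc)
qed simp

lemma step_op_le_const: "(\<And>x. g x \<le> C) \<Longrightarrow> step_op A g x \<le>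
    ennreal lam * (\<integral>\<^sup>+y. C \<partial>resolvent_measure (q + lam))"
  unfolding step_op_def resolvent_op_def
  by (intro mult_left_mono nn_integral_mono) (auto simp: indicator_def)

text \<open>Every step has total mass at most \<open>lam / (q + lam)\<close>, below 1 because of the
  discount.\<close>

lemma step_op_pow_bounded:
  assumes "\<And>x. g x \<le> C"
  shows "(step_op A ^^ n) g x \<le> C * ennreal ((lam / (q + lam)) ^ n)"
proof (induction n arbitrary: x)
  case (Suc n)
  have "step_op A ((step_op A ^^ n) g) x \<le>
      ennreal lam * (\<integral>\<^sup>+y. C * ennreal ((lam / (q + lam)) ^ n) \<partial>resolvent_measure (q + lam))"
    by (rule step_op_le_const[OF Suc])
  also have "\<dots> = C * ennreal ((lam / (q + lam)) ^ n) * (ennreal lam * ennreal (1 / (q + lam)))"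
    using q lam by (subst nn_integral_resolvent_measure_const) (simp_all add: mult_ac)
  also have "ennreal lam * ennreal (1 / (q + lam)) = ennreal (lam / (q + lam))"
    using q lam by (simp flip: ennreal_mult)
  also have "C * ennreal ((lam / (q + lam)) ^ n) * ennreal (lam / (q + lam)) =
      C * ennreal ((lam / (q + lam)) ^ Suc n)"
    using q lam by (subst mult.assoc, subst ennreal_mult[symmetric]) (auto simp: mult.commute)
  finally show ?case by simp
qed (use assms in simp)

text \<open>For bounded \<open>g\<close> the remainder in the iterated renewal equation decays
  geometrically.\<close>

lemma nu_eq_suminf_bounded:
  assumes [measurable]: "g \<in> borel_measurable borel" and bd: "\<And>x. g x \<le> ennreal C" and C: "0 \<le> C"
  shows "nu g = (\<Sum>k. (step_op {0<..} ^^ Suc k) g 0)"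
proof -
  let ?r = "lam / (q + lam)" and ?S = "\<lambda>n. \<Sum>k<n. (step_op {0<..} ^^ Suc k) g 0"
  have r: "0 \<le> ?r" "?r < 1" using q lam by auto
  have bound: "nu ((step_op {0<..} ^^ n) g) \<le> ennreal (C * ?r ^ n * ((\<beta> - \<phi>) / \<phi>))" for n
  proof -
    have "nu ((step_op {0<..} ^^ n) g) \<le> nu (\<lambda>_. ennreal C * ennreal (?r ^ n))"
      by (intro nu_mono step_op_pow_bounded bd)
    also have "\<dots> = ennreal (C * ?r ^ n * ((\<beta> - \<phi>) / \<phi>))"
      using r C \<phi>_less \<phi>_pos unfolding nu_const
      by (subst ennreal_mult[symmetric], simp, simp, subst ennreal_mult[symmetric]) auto
    finally show ?thesis .
  qed
  have "(\<lambda>n. nu ((step_op {0<..} ^^ n) g)) \<longlonglongrightarrow> 0"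
  proof (rule tendsto_sandwich[where f="\<lambda>_. 0"])
    have "(\<lambda>n. C * ?r ^ n * ((\<beta> - \<phi>) / \<phi>)) \<longlonglongrightarrow> C * 0 * ((\<beta> - \<phi>) / \<phi>)"
      by (intro tendsto_mult tendsto_const LIMSEQ_realpow_zero r)
    then show "(\<lambda>n. ennreal (C * ?r ^ n * ((\<beta> - \<phi>) / \<phi>))) \<longlonglongrightarrow> 0"
      by (simp add: tendsto_ennreal_iff[symmetric] tendsto_ennrealI[where x=0, simplified])
  qed (use bound in auto)
  moreover have "?S \<longlonglongrightarrow> (\<Sum>k. (step_op {0<..} ^^ Suc k) g 0)"
    by (rule summable_LIMSEQ) simp
  ultimately have "(\<lambda>n. ?S n + nu ((step_op {0<..} ^^ n) g)) \<longlonglongrightarrow> (\<Sum>k. (step_op {0<..} ^^ Suc k) g 0) + 0"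
    by (intro tendsto_add)
  then have "(\<lambda>n::nat. nu g) \<longlonglongrightarrow> (\<Sum>k. (step_op {0<..} ^^ Suc k) g 0)"
    by (simp only: nu_iterate[symmetric, OF assms(1)] add_0_right)
  then show ?thesis by (intro LIMSEQ_unique[OF tendsto_const])
qed

text \<open>A general \<open>g\<close> is the increasing limit of its truncations, for which the
  remainder vanishes. The other inequality holds already for the partial sums, the remainder being
  nonnegative.\<close>

lemma nu_eq_suminf:
  assumes [measurable]: "g \<in> borel_measurable borel"
  shows "nu g = (\<Sum>k. (step_op {0<..} ^^ Suc k) g 0)"
proof (rule antisym)
  show "(\<Sum>k. (step_op {0<..} ^^ Suc k) g 0) \<le> nu g"
  proof (rule suminf_le_const)
    show "(\<Sum>k<n. (step_op {0<..} ^^ Suc k) g 0) \<le> nu g" for n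
      using nu_iterate[OF assms, of n] by simp
  qed simp
  define h where "h i = (\<lambda>x. min (g x) (of_nat i))" for i :: nat
  have [measurable]: "h i \<in> borel_measurable borel" for i unfolding h_def by measurable
  have "nu g = (\<integral>\<^sup>+y. (SUP i. indicator {0<..} y * (ennreal ((\<beta> - \<phi>) * exp (- \<phi> * y)) * h i y)) \<partial>lborel)"
    unfolding nu_def
  proof (intro nn_integral_cong)
    fix y
    have "(SUP i. h i y) = g y"
    proof -
      have "(SUP i. h i y) = (SUP i. inf (g y) (of_nat i))" by (simp add: h_def inf_min)
      also have "\<dots> = inf (g y) (SUP i. of_nat i)" by (rule inf_SUP[symmetric])
      finally show ?thesis by (simp add: ennreal_SUP_of_nat_eq_top)
    qed
    then show "indicator {0<..} y * (ennreal ((\<beta> - \<phi>) * exp (- \<phi> * y)) * g y) =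
        (SUP i. indicator {0<..} y * (ennreal ((\<beta> - \<phi>) * exp (- \<phi> * y)) * h i y))"
      by (simp flip: SUP_mult_left_ennreal)
  qed
  also have "\<dots> = (SUP i. nu (h i))"
    unfolding nu_def
  proof (rule nn_integral_monotone_convergence_SUP)
    show "incseq (\<lambda>i y. indicator {0<..} y * (ennreal ((\<beta> - \<phi>) * exp (- \<phi> * y)) * h i y))"
      by (auto simp: incseq_def le_fun_def h_def intro!: mult_left_mono min.mono)
  qed measurable
  also have "\<dots> \<le> (\<Sum>k. (step_op {0<..} ^^ Suc k) g 0)"
  proof (rule SUP_least)
    fix i
    have "nu (h i) = (\<Sum>k. (step_op {0<..} ^^ Suc k) (h i) 0)"
      by (rule nu_eq_suminf_bounded[where C="real i"]) (auto simp: h_def simp flip: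
          ennreal_of_nat_eq_real_of_nat)
    also have "\<dots> \<le> (\<Sum>k. (step_op {0<..} ^^ Suc k) g 0)"
      by (intro suminf_le step_op_pow_mono) (auto simp: h_def)
    finally show "nu (h i) \<le> (\<Sum>k. (step_op {0<..} ^^ Suc k) g 0)" .
  qed
  finally show "nu g \<le> (\<Sum>k. (step_op {0<..} ^^ Suc k) g 0)" .
qed

end

section \<open>Sampling at the Poisson arrival times\<close>

locale levy_poisson = levy_sampled M X W q lam for M :: "'a measure" and X W q lam +
  fixes T :: "nat \<Rightarrow> 'a \<Rightarrow> real"
  assumes T: "poisson_arrival_times M lam T"
    and indep: "indep_process_arrivals M X T"
begin

definition "gap k \<omega> = T (Suc k) \<omega> - T k \<omega>"

abbreviation "exp_law \<equiv> density lborel (\<lambda>x. ennreal (exponential_density lam x))"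

lemma T_0: "\<omega> \<in> space M \<Longrightarrow> T 0 \<omega> = 0"
  and T_mono: "\<omega> \<in> space M \<Longrightarrow> strict_mono (\<lambda>k. T k \<omega>)"
  using T by (auto simp: poisson_arrival_times_def)

lemma T_less: "\<omega> \<in> space M \<Longrightarrow> j < k \<Longrightarrow> T j \<omega> < T k \<omega>"
  using T_mono strict_monoD by blast

lemma T_nonneg: "\<omega> \<in> space M \<Longrightarrow> 0 \<le> T k \<omega>"
  using T_0[of \<omega>] T_less[of \<omega> 0 k] by (cases k) auto

lemma gap_indep: "indep_vars (\<lambda>_. borel) gap UNIV"
  using T by (simp add: poisson_arrival_times_def gap_def[abs_def])

lemma gap_distr: "distr M borel (gap k) =
    exp_law" and gap_meas [measurable]: "gap k \<in> borel_measurable M"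
proof -
  have d: "distributed M lborel (gap k) (exponential_density lam)"
    using T by (simp add: poisson_arrival_times_def gap_def[abs_def])
  then show [measurable]: "gap k \<in> borel_measurable M" by (simp add: distributed_def)
  have "distr M lborel (gap k) = exp_law" using d by (simp add: distributed_def)
  moreover have "distr M lborel (gap k) = distr M borel (gap k)" by (rule distr_cong) auto
  ultimately show "distr M borel (gap k) = exp_law" by simp
qed

lemma T_eq_sum: "\<omega> \<in> space M \<Longrightarrow> T k \<omega> = (\<Sum>i<k. gap i \<omega>)"
  using sum_lessThan_telescope[of "\<lambda>i. T i \<omega>" k] by (simp add: gap_def T_0)

lemma T_meas [measurable]: "T k \<in> borel_measurable M"
proof -
  have "(\<lambda>\<omega>. \<Sum>i<k. gap i \<omega>) \<in> borel_measurable M" by measurable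
  then show ?thesis by (rule measurable_cong[THEN iffD1, rotated]) (simp add: T_eq_sum)
qed

sublocale exp_law: prob_space exp_law
  by (rule prob_space_exponential_density[OF lam])

sublocale exp_law_prod: product_prob_space "\<lambda>_ :: nat. exp_law" UNIV
  by unfold_locales

lemma sets_exp_law [measurable_cong]: "sets exp_law = sets borel" by simp

lemma sets_PiM_exp_law [measurable_cong]: "sets (PiM I (\<lambda>_. exp_law)) = sets (PiM I (\<lambda>_. borel))"
  by (rule sets_PiM_cong) auto

text \<open>The identity map from \<open>M\<close> to \<open>path_algebra\<close> restricts the
  measure to path events, so independence of path and arrivals becomes a product measure.
  \<open>Suc n\<close> keeps the family of gaps nonempty, as the product form of independence
  requires.\<close>

lemma joint_law:
  "distr M (path_algebra \<Otimes>\<^sub>M PiM {..<Suc n} (\<lambda>_. borel)) (\<lambda>\<omega>. (\<omega>, \<lambda>i\<in>{..<Suc n}. gap i \<omega>)) =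
    distr M path_algebra (\<lambda>\<omega>. \<omega>) \<Otimes>\<^sub>M PiM {..<Suc n} (\<lambda>_. exp_law)"
proof -
  let ?I = "{..<Suc n}" and ?D = "\<lambda>\<omega>. \<lambda>i\<in>{..<Suc n}. gap i \<omega>"
  let ?MT = "vimage_algebra (space M) (\<lambda>\<omega> k. T k \<omega>) (PiM UNIV (\<lambda>_. borel :: real measure))"
  interpret path_algebra: prob_space "distr M path_algebra (\<lambda>\<omega>. \<omega>)" by (rule prob_space_distr) measurable
  interpret P: prob_space "PiM ?I (\<lambda>_. exp_law)"
    by (rule prob_space_PiM) (rule exp_law.prob_space_axioms)
  have [measurable]: "?D \<in> measurable M (PiM ?I (\<lambda>_. borel))"
    by (rule measurable_restrict) simp
  have law: "distr M (PiM ?I (\<lambda>_. borel)) ?D = PiM ?I (\<lambda>_. exp_law)"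
  proof -
    have "indep_vars (\<lambda>_. borel) gap ?I" using gap_indep by (rule indep_vars_subset) simp
    then have "distr M (PiM ?I (\<lambda>_. borel)) ?D = PiM ?I (\<lambda>i. distr M borel (gap i))"
      by (subst (asm) indep_vars_iff_distr_eq_PiM) auto
    then show ?thesis by (simp only: gap_distr)
  qed
  have MT: "?D \<in> measurable ?MT (PiM ?I (\<lambda>_. borel))"
  proof (rule measurable_restrict)
    fix i
    have Tk: "T k \<in> borel_measurable ?MT" for k
    proof -
      have "(\<lambda>\<omega> k. T k \<omega>) \<in> measurable ?MT (PiM UNIV (\<lambda>_. borel))"
        by (rule measurable_vimage_algebra1) (auto simp: space_PiM)
      then show ?thesis by (rule measurable_compose) (auto intro!: measurable_component_singleton)
    qed
    show "gap i \<in> borel_measurable ?MT"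
      unfolding gap_def[abs_def] by (intro borel_measurable_diff Tk)
  qed
  have "distr M path_algebra (\<lambda>\<omega>. \<omega>) \<Otimes>\<^sub>M PiM ?I (\<lambda>_. exp_law) =
      distr M (path_algebra \<Otimes>\<^sub>M PiM ?I (\<lambda>_. borel)) (\<lambda>\<omega>. (\<omega>, ?D \<omega>))"
  proof (rule pair_measure_eqI)
    show "sets (distr M path_algebra (\<lambda>\<omega>. \<omega>) \<Otimes>\<^sub>M PiM ?I (\<lambda>_. exp_law)) =
        sets (distr M (path_algebra \<Otimes>\<^sub>M PiM ?I (\<lambda>_. borel)) (\<lambda>\<omega>. (\<omega>, ?D \<omega>)))"
      using sets_PiM_exp_law[of ?I] by (simp cong: sets_pair_measure_cong)
    fix A B assume "A \<in> sets (distr M path_algebra (\<lambda>\<omega>. \<omega>))" "B \<in> sets (PiM ?I (\<lambda>_. exp_law))"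
    then have A: "A \<in> sets path_algebra" and B: "B \<in> sets (PiM ?I (\<lambda>_. borel))"
        using sets_PiM_exp_law[of ?I] by simp_all
    have AM: "A \<in> sets M" using A sets_path_algebra_subset by blast
    have DB: "?D -` B \<inter> space M \<in> sets ?MT" using measurable_sets[OF MT B] by simp
    have DBM: "?D -` B \<inter> space M \<in> sets M" by (rule measurable_sets[OF _ B]) measurable
    have "emeasure (distr M path_algebra (\<lambda>\<omega>. \<omega>)) A * emeasure (PiM ?I (\<lambda>_. exp_law)) B =
        emeasure M A * emeasure M (?D -` B \<inter> space M)"
      unfolding law[symmetric] using A B sets.sets_into_space[OF AM]
        by (simp add: emeasure_distr Int_absorb2)
    also have "\<dots> = ennreal (prob A * prob (?D -` B \<inter> space M))"
      by (simp add: emeasure_eq_measure ennreal_mult)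
    also have "prob A * prob (?D -` B \<inter> space M) = prob (A \<inter> (?D -` B \<inter> space M))"
      using indep A DB unfolding indep_process_arrivals_def path_algebra_def
        by (intro indep_setD[symmetric]) auto
    also have "ennreal (prob (A \<inter> (?D -` B \<inter> space M))) =
        emeasure (distr M (path_algebra \<Otimes>\<^sub>M PiM ?I (\<lambda>_. borel)) (\<lambda>\<omega>. (\<omega>, ?D \<omega>))) (A \<times> B)"
    proof -
      have "(\<lambda>\<omega>. (\<omega>, ?D \<omega>)) -` (A \<times> B) \<inter> space M = A \<inter> (?D -` B \<inter> space M)" by auto
      then show ?thesis
        using A B by (subst emeasure_distr) (auto simp: emeasure_eq_measure)
    qed
    finally show "emeasure (distr M path_algebra (\<lambda>\<omega>. \<omega>)) A * emeasure (PiM ?I (\<lambda>_. exp_law)) B =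
        emeasure (distr M (path_algebra \<Otimes>\<^sub>M PiM ?I (\<lambda>_. borel)) (\<lambda>\<omega>. (\<omega>, ?D \<omega>))) (A \<times> B)" .
  qed (unfold_locales)
  then show ?thesis by simp
qed

text \<open>Conditioning on the gaps: they become parameters \<open>d\<close>, integrated in the
  outer integral against a product of exponential laws.\<close>

lemma nn_integral_transfer:
  assumes [measurable]: "F \<in> borel_measurable (path_algebra \<Otimes>\<^sub>M PiM {..<Suc n} (\<lambda>_. borel))"
  shows "(\<integral>\<^sup>+\<omega>. F (\<omega>, \<lambda>i\<in>{..<Suc n}. gap i \<omega>) \<partial>M) =
    (\<integral>\<^sup>+d. \<integral>\<^sup>+\<omega>. F (\<omega>, d) \<partial>M \<partial>PiM {..<Suc n} (\<lambda>_. exp_law))"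
proof -
  let ?I = "{..<Suc n}" and ?D = "\<lambda>\<omega>. \<lambda>i\<in>{..<Suc n}. gap i \<omega>"
  interpret path_algebra: prob_space "distr M path_algebra (\<lambda>\<omega>. \<omega>)" by (rule prob_space_distr) measurable
  interpret P: prob_space "PiM ?I (\<lambda>_. exp_law)"
    by (rule prob_space_PiM) (rule exp_law.prob_space_axioms)
  interpret pair: pair_sigma_finite "distr M path_algebra (\<lambda>\<omega>. \<omega>)" "PiM ?I (\<lambda>_. exp_law)"
    by unfold_locales
  have [measurable]: "?D \<in> measurable M (PiM ?I (\<lambda>_. borel))"
    by (rule measurable_restrict) simp
  have F: "F \<in> borel_measurable (distr M path_algebra (\<lambda>\<omega>. \<omega>) \<Otimes>\<^sub>M PiM ?I (\<lambda>_. exp_law))"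
    by measurable
  have "(\<integral>\<^sup>+\<omega>. F (\<omega>, ?D \<omega>) \<partial>M) = (\<integral>\<^sup>+z. F z \<partial>distr M (path_algebra \<Otimes>\<^sub>M PiM ?I (\<lambda>_. borel)) (\<lambda>\<omega>. (\<omega>,
      ?D \<omega>)))"
    by (subst nn_integral_distr) auto
  also have "\<dots> = (\<integral>\<^sup>+d. \<integral>\<^sup>+\<omega>. F (\<omega>, d) \<partial>distr M path_algebra (\<lambda>\<omega>. \<omega>) \<partial>PiM ?I (\<lambda>_. exp_law))"
    unfolding joint_law using pair.nn_integral_snd[OF F] by simp
  also have "\<dots> = (\<integral>\<^sup>+d. \<integral>\<^sup>+\<omega>. F (\<omega>, d) \<partial>M \<partial>PiM ?I (\<lambda>_. exp_law))"
  proof (rule nn_integral_cong)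
    fix d assume "d \<in> space (PiM ?I (\<lambda>_. exp_law))"
    then have [measurable]: "d \<in> space (PiM ?I (\<lambda>_. borel))" by (simp add: space_PiM)
    show "(\<integral>\<^sup>+\<omega>. F (\<omega>, d) \<partial>distr M path_algebra (\<lambda>\<omega>. \<omega>)) = (\<integral>\<^sup>+\<omega>. F (\<omega>, d) \<partial>M)"
      by (subst nn_integral_distr) auto
  qed
  finally show ?thesis .
qed

lemma arrival_restrict_gap:
  assumes "\<omega> \<in> space M" "j \<le> n"
  shows "arrival (\<lambda>i\<in>{..<n}. gap i \<omega>) j = T j \<omega>"
proof -
  have "arrival (\<lambda>i\<in>{..<n}. gap i \<omega>) j = (\<Sum>i<j. gap i \<omega>)"
    unfolding arrival_def using assms T_less[of \<omega>] by (intro sum.cong) (auto simp: gap_def less_imp_le)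
  then show ?thesis using T_eq_sum[OF assms(1)] by simp
qed

lemma arrival_upd: "j \<le> k \<Longrightarrow> arrival (d(k := e)) j = arrival d j"
  by (simp add: arrival_def)

lemma survive_upd: "j \<le> k \<Longrightarrow> survive A j (d(k := e)) = survive A j d"
  by (auto simp: survive_def arrival_upd fun_eq_iff intro!: prod.cong)

lemma survive_Suc: "survive A (Suc k) d \<omega> =
    survive A k d \<omega> * indicator A (X (max 0 (arrival d (Suc k))) \<omega>)"
  by (simp add: survive_def)

lemma arrival_meas:
  assumes "f \<in> measurable N (PiM {..<n} (\<lambda>_. borel))" "j \<le> n"
  shows "(\<lambda>x. arrival (f x) j) \<in> borel_measurable N"
  unfolding arrival_def
proof (rule borel_measurable_sum)
  fix i assume "i \<in> {..<j}"
  then have "(\<lambda>x. f x i) \<in> borel_measurable N"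
    using assms by (intro measurable_compose[OF assms(1) measurable_component_singleton]) auto
  then show "(\<lambda>x. \<bar>f x i\<bar>) \<in> borel_measurable N" by measurable
qed

lemma survive_meas:
  assumes A: "A \<in> sets borel" and f: "f \<in> measurable N (PiM {..<n} (\<lambda>_. borel))" "k \<le>
      n" and h: "h \<in> measurable N path_algebra"
  shows "(\<lambda>x. survive A k (f x) (h x)) \<in> borel_measurable N"
  unfolding survive_def
proof (rule borel_measurable_prod_ennreal)
  fix j assume "j \<in> {1..k}"
  then have "(\<lambda>x. X (max 0 (arrival (f x) j)) (h x)) \<in> borel_measurable N"
    using f by (intro measurable_X_path_algebra h arrival_meas[OF f(1)]) auto
  then show "(\<lambda>x. indicator A (X (max 0 (arrival (f x) j)) (h x)) :: ennreal) \<in> borel_measurable N"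
    by (rule measurable_compose) (use A in simp)
qed

lemma measurable_M_path_algebra: "h \<in> measurable N M \<Longrightarrow> h \<in> measurable N path_algebra"
  by (rule measurable_compose[OF _ measurable_id_path_algebra])

text \<open>Expected discounted reward of the surviving path at the \<open>k\<close>-th arrival,
  with the gaps decoupled from the path.\<close>

definition sampled_op :: "real set \<Rightarrow> nat \<Rightarrow> (real \<Rightarrow> ennreal) \<Rightarrow> ennreal" where
  "sampled_op A k g = (\<integral>\<^sup>+d. ennreal (exp (- q * arrival d k)) *
     (\<integral>\<^sup>+\<omega>. survive A k d \<omega> * g (X (max 0 (arrival d k)) \<omega>) \<partial>M) \<partial>PiM {..<k} (\<lambda>_. exp_law))"

lemma nn_integral_exp_law:
  assumes [measurable]: "h \<in> borel_measurable borel"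
  shows "(\<integral>\<^sup>+e. h e \<partial>exp_law) = (\<integral>\<^sup>+e. indicator {0..} e * ennreal (lam * exp (- lam * e)) *
      h e \<partial>lborel)"
  by (subst nn_integral_density)
    (auto intro!: nn_integral_cong simp: exponential_density_def indicator_def mult.commute)

lemma nn_integral_PiM_Suc:
  assumes [measurable]: "F \<in> borel_measurable (PiM {..<Suc k} (\<lambda>_. borel))"
  shows "(\<integral>\<^sup>+d. F d \<partial>PiM {..<Suc k} (\<lambda>_. exp_law)) =
      (\<integral>\<^sup>+d. \<integral>\<^sup>+e. F (d(k := e)) \<partial>exp_law \<partial>PiM {..<k} (\<lambda>_. exp_law))"
proof -
  have eq: "{..<Suc k} = insert k {..<k}" by auto
  have "F \<in> borel_measurable (PiM (insert k {..<k}) (\<lambda>_. exp_law))"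
    using assms unfolding eq by (simp cong: measurable_cong_sets add: sets_PiM_exp_law)
  then show ?thesis
    unfolding eq by (intro exp_law_prod.product_nn_integral_insert) auto
qed


lemma resolvent_op_eq:
  assumes [measurable]: "f \<in> borel_measurable borel"
  shows "resolvent_op f x = (\<integral>\<^sup>+t. indicator {0..} t * ennreal (exp (- (q + lam) * t)) *
      transition t f x \<partial>lborel)"
  unfolding resolvent_op_def by (rule nn_integral_resolvent_measure_translate) fact

lemma nn_integral_tail_exp_law:
  "(\<integral>\<^sup>+e. indicator {u<..} e \<partial>exp_law) = ennreal (exp (- lam * u))" if "0 \<le> u"
proof -
  have "(\<integral>\<^sup>+e. indicator {u<..} e \<partial>exp_law) =
      (\<integral>\<^sup>+e. indicator {0..} e * ennreal (lam * exp (- lam * e)) * indicator {u<..} e \<partial>lborel)"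
    by (rule nn_integral_exp_law) measurable
  also have "\<dots> = (\<integral>\<^sup>+e. ennreal lam * (indicator {u..} e * ennreal (exp (- lam * e))) \<partial>lborel)"
  proof (rule nn_integral_cong_AE)
    have "AE e in lborel. e \<noteq> u" by (rule AE_lborel_singleton)
    then show "AE e in lborel. indicator {0..} e * ennreal (lam * exp (- lam * e)) * indicator {u<..} e =
        ennreal lam * (indicator {u..} e * ennreal (exp (- lam * e)))"
      by eventually_elim (use that lam in \<open>auto simp: indicator_def ennreal_mult\<close>)
  qed
  also have "\<dots> = ennreal lam * (\<integral>\<^sup>+e. indicator {u..} e * ennreal (exp (- lam * e)) \<partial>lborel)"
    by (rule nn_integral_cmult) measurable
  also have "\<dots> = ennreal lam * ennreal (exp (- lam * u) / lam)"
    by (simp only: nn_integral_exp_tail[OF lam])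
  also have "\<dots> = ennreal (exp (- lam * u))"
    using lam by (simp flip: ennreal_mult)
  finally show ?thesis .
qed

lemma measurable_PiM_I:
  assumes "d \<in> space (PiM I (\<lambda>_. exp_law))"
  shows "(\<lambda>_. d) \<in> measurable N (PiM I (\<lambda>_. borel))"
  using assms by (auto simp: space_PiM)

lemma nn_integral_discounted_path:
  assumes A [measurable]: "A \<in> sets borel" and f [measurable]: "f \<in> borel_measurable borel"
    and d: "d \<in> space (PiM {..<k} (\<lambda>_. exp_law))"
  shows "(\<integral>\<^sup>+u. indicator {0..} u * ennreal (exp (- (q + lam) * u)) *
      (\<integral>\<^sup>+\<omega>. survive A k d \<omega> * f (X (max 0 (arrival d k + u)) \<omega>) \<partial>M) \<partial>lborel) =
    (\<integral>\<^sup>+\<omega>. survive A k d \<omega> * resolvent_op f (X (max 0 (arrival d k)) \<omega>) \<partial>M)"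
proof -
  interpret P: pair_sigma_finite M lborel by unfold_locales
  have surv [measurable (raw)]: "(\<lambda>x. survive A k d (h x)) \<in> borel_measurable N" if "h \<in> measurable N M"
      for h and N :: "'c measure"
    using survive_meas[OF A measurable_PiM_I[OF d] order_refl measurable_M_path_algebra[OF that]] .
  have "(\<integral>\<^sup>+u. indicator {0..} u * ennreal (exp (- (q + lam) * u)) *
      (\<integral>\<^sup>+\<omega>. survive A k d \<omega> * f (X (max 0 (arrival d k + u)) \<omega>) \<partial>M) \<partial>lborel) =
    (\<integral>\<^sup>+u. indicator {0..} u * ennreal (exp (- (q + lam) * u)) *
      (\<integral>\<^sup>+\<omega>. survive A k d \<omega> * transition u f (X (max 0 (arrival d k)) \<omega>) \<partial>M) \<partial>lborel)"
  proof (rule nn_integral_cong)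
    fix u :: real
    show "indicator {0..} u * ennreal (exp (- (q + lam) * u)) * (\<integral>\<^sup>+\<omega>. survive A k d \<omega> *
        f (X (max 0 (arrival d k + u)) \<omega>) \<partial>M) =
        indicator {0..} u * ennreal (exp (- (q + lam) * u)) * (\<integral>\<^sup>+\<omega>. survive A k d \<omega> *
            transition u f (X (max 0 (arrival d k)) \<omega>) \<partial>M)"
    proof (cases "0 \<le> u")
      case True
      show ?thesis by (simp only: nn_integral_markov[OF A f True])
    qed simp
  qed
  also have "\<dots> = (\<integral>\<^sup>+u. \<integral>\<^sup>+\<omega>. survive A k d \<omega> * (indicator {0..} u * ennreal (exp (- (q + lam) * u)) *
      transition u f (X (max 0 (arrival d k)) \<omega>)) \<partial>M \<partial>lborel)"
    by (rule nn_integral_cong, subst nn_integral_cmult[symmetric]) (auto intro!: nn_integral_cong simp: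
        mult_ac)
  also have "\<dots> = (\<integral>\<^sup>+\<omega>. \<integral>\<^sup>+u. survive A k d \<omega> * (indicator {0..} u * ennreal (exp (- (q + lam) * u)) *
      transition u f (X (max 0 (arrival d k)) \<omega>)) \<partial>lborel \<partial>M)"
    by (rule P.Fubini') measurable
  also have "\<dots> = (\<integral>\<^sup>+\<omega>. survive A k d \<omega> * resolvent_op f (X (max 0 (arrival d k)) \<omega>) \<partial>M)"
    by (intro nn_integral_cong) (simp add: resolvent_op_eq nn_integral_cmult)
  finally show ?thesis .
qed

text \<open>The last gap is split off. Integrated with the discount against its exponential law, it
  becomes one application of the step kernel.\<close>

lemma sampled_op_Suc:
  assumes A [measurable]: "A \<in> sets borel" and g [measurable]: "g \<in> borel_measurable borel"
  shows "sampled_op A (Suc k) g = sampled_op A k (step_op A g)"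
proof -
  define F where "F d = ennreal (exp (- q * arrival d (Suc k))) *
     (\<integral>\<^sup>+\<omega>. survive A (Suc k) d \<omega> * g (X (max 0 (arrival d (Suc k))) \<omega>) \<partial>M)" for d
  have F_meas: "F \<in> borel_measurable (PiM {..<Suc k} (\<lambda>_. borel))"
  proof -
    have [measurable]: "(\<lambda>x. arrival (fst x) (Suc k)) \<in> borel_measurable (PiM {..<Suc k} (\<lambda>_.
        borel) \<Otimes>\<^sub>M M)"
      by (rule arrival_meas) auto
    have [measurable]: "(\<lambda>x. survive A (Suc k) (fst x) (snd x)) \<in> borel_measurable (PiM {..<Suc k} (\<lambda>_.
        borel) \<Otimes>\<^sub>M M)"
      by (rule survive_meas[OF A]) (auto intro: measurable_M_path_algebra)
    have [measurable]: "(\<lambda>d. arrival d (Suc k)) \<in> borel_measurable (PiM {..<Suc k} (\<lambda>_. borel))"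
      by (rule arrival_meas) auto
    have "(\<lambda>x. survive A (Suc k) (fst x) (snd x) * g (X (max 0 (arrival (fst x) (Suc k))) (snd x))) \<in>
        borel_measurable (PiM {..<Suc k} (\<lambda>_. borel) \<Otimes>\<^sub>M M)"
      by measurable
    then show ?thesis unfolding F_def[abs_def] by measurable
  qed
  have "sampled_op A (Suc k) g = (\<integral>\<^sup>+d. F d \<partial>PiM {..<Suc k} (\<lambda>_. exp_law))"
    by (simp add: sampled_op_def F_def)
  also have "\<dots> = (\<integral>\<^sup>+d. \<integral>\<^sup>+e. F (d(k := e)) \<partial>exp_law \<partial>PiM {..<k} (\<lambda>_. exp_law))"
    by (rule nn_integral_PiM_Suc[OF F_meas])
  also have "\<dots> = sampled_op A k (step_op A g)"
    unfolding sampled_op_def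
  proof (rule nn_integral_cong)
    fix d assume d: "d \<in> space (PiM {..<k} (\<lambda>_. exp_law))"
    let ?g = "\<lambda>y. indicator A y * g y"
    have surv [measurable (raw)]: "(\<lambda>x. survive A k d (h x)) \<in> borel_measurable N"
        if "h \<in> measurable N M" for h and N :: "'c measure"
      using survive_meas[OF A measurable_PiM_I[OF d] order_refl measurable_M_path_algebra[OF that]] .
    define G where "G e = (\<integral>\<^sup>+\<omega>. survive A k d \<omega> * ?g (X (max 0 (arrival d k + \<bar>e\<bar>)) \<omega>) \<partial>M)" for e
    have [measurable]: "G \<in> borel_measurable borel"
      unfolding G_def[abs_def] by measurable
    have F_eq: "F (d(k := e)) = ennreal (exp (- q * (arrival d k + \<bar>e\<bar>))) * G e" for e
      by (simp add: F_def G_def survive_Suc survive_upd arrival_Suc arrival_upd mult.assoc)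
    have "(\<integral>\<^sup>+e. F (d(k := e)) \<partial>exp_law) = (\<integral>\<^sup>+e. indicator {0..} e * ennreal (lam * exp (- lam * e)) *
        (ennreal (exp (- q * (arrival d k + \<bar>e\<bar>))) * G e) \<partial>lborel)"
      unfolding F_eq by (rule nn_integral_exp_law) measurable
    also have "\<dots> = (\<integral>\<^sup>+e. ennreal (exp (- q * arrival d k) * lam) * (indicator {0..} e *
        ennreal (exp (- (q + lam) * e)) * (\<integral>\<^sup>+\<omega>. survive A k d \<omega> *
        ?g (X (max 0 (arrival d k + e)) \<omega>) \<partial>M)) \<partial>lborel)"
    proof (rule nn_integral_cong)
      fix e :: real
      have "ennreal (lam * exp (- lam * e)) * ennreal (exp (- q * (arrival d k + e))) =
          ennreal (exp (- q * arrival d k) * lam) * ennreal (exp (- (q + lam) * e))"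
        using lam by (simp add: algebra_simps exp_add exp_diff exp_minus divide_inverse flip:
            ennreal_mult)
      then show "indicator {0..} e * ennreal (lam * exp (- lam * e)) *
          (ennreal (exp (- q * (arrival d k + \<bar>e\<bar>))) * G e) =
          ennreal (exp (- q * arrival d k) * lam) * (indicator {0..} e * ennreal (exp (- (q + lam) *
              e)) * (\<integral>\<^sup>+\<omega>. survive A k d \<omega> * ?g (X (max 0 (arrival d k + e)) \<omega>) \<partial>M))"
        by (cases "0 \<le> e") (simp_all add: G_def mult.assoc[symmetric])
    qed
    also have "\<dots> = ennreal (exp (- q * arrival d k) * lam) * (\<integral>\<^sup>+e. indicator {0..} e *
        ennreal (exp (- (q + lam) * e)) * (\<integral>\<^sup>+\<omega>. survive A k d \<omega> * ?g (X (max 0 (arrival d k + e)) \<omega>) \<partial>M)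
        \<partial>lborel)"
      by (rule nn_integral_cmult) measurable
    also have "\<dots> = ennreal (exp (- q * arrival d k) * lam) * (\<integral>\<^sup>+\<omega>. survive A k d \<omega> *
        resolvent_op ?g (X (max 0 (arrival d k)) \<omega>) \<partial>M)"
      by (subst nn_integral_discounted_path[OF A _ d]) auto
    also have "\<dots> = ennreal (exp (- q * arrival d k)) * (\<integral>\<^sup>+\<omega>. survive A k d \<omega> *
        step_op A g (X (max 0 (arrival d k)) \<omega>) \<partial>M)"
      using lam unfolding step_op_def
      by (subst ennreal_mult) (auto simp: mult.assoc mult.left_commute[of _ "ennreal lam"]
          nn_integral_cmult)
    finally show "(\<integral>\<^sup>+e. F (d(k := e)) \<partial>exp_law) =
        ennreal (exp (- q * arrival d k)) * (\<integral>\<^sup>+\<omega>. survive A k d \<omega> *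
        step_op A g (X (max 0 (arrival d k)) \<omega>) \<partial>M)" .
  qed
  finally show ?thesis .
qed

text \<open>Steps are split off from the end, so the induction lets \<open>g\<close> vary; at
  \<open>k = 0\<close> only \<open>X 0 = 0\<close> remains.\<close>

lemma sampled_op_eq:
  assumes A: "A \<in> sets borel" and g: "g \<in> borel_measurable borel"
  shows "sampled_op A k g = (step_op A ^^ k) g 0"
  using g
proof (induction k arbitrary: g)
  case 0
  have "(\<integral>\<^sup>+\<omega>. g (X 0 \<omega>) \<partial>M) = (\<integral>\<^sup>+\<omega>. g 0 \<partial>M)"
    using X_0 by (intro nn_integral_cong_AE) auto
  then show ?case
    using prob_space.emeasure_space_1[OF prob_space_PiM[of "{}" "\<lambda>_ :: nat. exp_law"]]
    by (simp add: sampled_op_def survive_def emeasure_space_1)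
next
  case (Suc k)
  have "step_op A g \<in> borel_measurable borel"
    using A Suc.prems step_op_meas[where h="\<lambda>x. x" and N=borel] by simp
  then show ?case
    using Suc.IH[of "step_op A g"] by (simp only: sampled_op_Suc[OF A Suc.prems] funpow_Suc_right o_def)
qed

lemma sampled_value:
  assumes A [measurable]: "A \<in> sets borel" and g [measurable]: "g \<in> borel_measurable borel"
  shows "(\<integral>\<^sup>+\<omega>. (\<Prod>j\<in>{1..k}. indicator A (X (T j \<omega>) \<omega>)) * (ennreal (exp (- q * T k \<omega>)) *
      g (X (T k \<omega>) \<omega>)) \<partial>M) = (step_op A ^^ k) g 0"
proof (cases k)
  \<comment> \<open>The transfer to product measures covers nonempty families of gaps, so this case
    is direct.\<close>
  case 0
  have "(\<integral>\<^sup>+\<omega>. g (X (T 0 \<omega>) \<omega>) \<partial>M) = (\<integral>\<^sup>+\<omega>. g 0 \<partial>M)"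
    using X_0 T_0 by (intro nn_integral_cong_AE) auto
  then show ?thesis using 0 T_0 by (simp add: emeasure_space_1 cong: nn_integral_cong)
next
  case (Suc n)
  let ?I = "{..<Suc n}"
  define F where "F x = ennreal (exp (- q * arrival (snd x) k)) * (survive A k (snd x) (fst x) *
      g (X (max 0 (arrival (snd x) k)) (fst x)))" for x :: "'a \<times> (nat \<Rightarrow> real)"
  have [measurable]: "(\<lambda>x. arrival (snd x) k) \<in> borel_measurable (path_algebra \<Otimes>\<^sub>M PiM ?I (\<lambda>_. borel))"
    by (rule arrival_meas[where n="Suc n"]) (auto simp: Suc)
  have [measurable]: "(\<lambda>x. survive A k (snd x) (fst x)) \<in> borel_measurable (path_algebra \<Otimes>\<^sub>M PiM ?I (\<lambda>_.
      borel))"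
    by (rule survive_meas[OF A, where n="Suc n"]) (auto simp: Suc)
  have [measurable]: "(\<lambda>x. X (max 0 (arrival (snd x) k)) (fst x)) \<in> borel_measurable (path_algebra \<Otimes>\<^sub>M
      PiM ?I (\<lambda>_. borel))"
    by (rule measurable_X_path_algebra) measurable
  have F: "F \<in> borel_measurable (path_algebra \<Otimes>\<^sub>M PiM ?I (\<lambda>_. borel))"
    unfolding F_def[abs_def] by measurable
  have "(\<integral>\<^sup>+\<omega>. (\<Prod>j\<in>{1..k}. indicator A (X (T j \<omega>) \<omega>)) * (ennreal (exp (- q * T k \<omega>)) *
      g (X (T k \<omega>) \<omega>)) \<partial>M) =
      (\<integral>\<^sup>+\<omega>. F (\<omega>, \<lambda>i\<in>?I. gap i \<omega>) \<partial>M)"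
  proof (rule nn_integral_cong)
    fix \<omega> assume \<omega>: "\<omega> \<in> space M"
    show "(\<Prod>j\<in>{1..k}. indicator A (X (T j \<omega>) \<omega>)) * (ennreal (exp (- q * T k \<omega>)) * g (X (T k \<omega>) \<omega>)) =
        F (\<omega>, \<lambda>i\<in>?I. gap i \<omega>)"
      using T_nonneg[OF \<omega>] unfolding F_def survive_def fst_conv snd_conv
      by (simp add: arrival_restrict_gap[OF \<omega>] Suc max_absorb2 mult.left_commute del: restrict_apply)
  qed
  also have "\<dots> = (\<integral>\<^sup>+d. \<integral>\<^sup>+\<omega>. F (\<omega>, d) \<partial>M \<partial>PiM ?I (\<lambda>_. exp_law))"
    by (rule nn_integral_transfer[OF F])
  also have "\<dots> = sampled_op A k g"
    unfolding sampled_op_def Suc[symmetric]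
  proof (rule nn_integral_cong)
    fix d assume d: "d \<in> space (PiM {..<k} (\<lambda>_. exp_law))"
    have [measurable]: "survive A k d \<in> borel_measurable M"
      using survive_meas[OF A measurable_PiM_I[OF d] order_refl measurable_id_path_algebra] .
    show "(\<integral>\<^sup>+\<omega>. F (\<omega>, d) \<partial>M) = ennreal (exp (- q * arrival d k)) * (\<integral>\<^sup>+\<omega>. survive A k d \<omega> *
        g (X (max 0 (arrival d k)) \<omega>) \<partial>M)"
      unfolding F_def by (simp add: nn_integral_cmult)
  qed
  finally show ?thesis by (simp add: sampled_op_eq[OF A g])
qed

text \<open>Time \<open>u\<close> after arrival \<open>k\<close> precedes the next arrival when the
  gap exceeds \<open>u\<close>, with probability \<open>exp (- lam * u)\<close>. With the discount
  this gives the rate \<open>q + lam\<close>, so the interval contributes a resolvent after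
  \<open>k\<close> steps.\<close>

lemma sampled_integral:
  assumes A [measurable]: "A \<in> sets borel" and f [measurable]: "f \<in> borel_measurable borel"
  shows "(\<integral>\<^sup>+\<omega>. (\<Prod>j\<in>{1..k}. indicator A (X (T j \<omega>) \<omega>)) *
      (\<integral>\<^sup>+s. indicator {T k \<omega>..<T (Suc k) \<omega>} s * (ennreal (exp (- q * s)) * f (X (max 0 s) \<omega>)) \<partial>lborel)
          \<partial>M) = (step_op A ^^ k) (resolvent_op f) 0"
proof -
  let ?I = "{..<Suc k}"
  define H where "H d \<omega> = (\<integral>\<^sup>+s. indicator {arrival d k..<arrival d (Suc k)} s *
      (ennreal (exp (- q * s)) * f (X (max 0 s) \<omega>)) \<partial>lborel)" for d \<omega>
  define F where "F x = survive A k (snd x) (fst x) * H (snd x) (fst x)" for x :: "'a \<times> (nat \<Rightarrow> real)"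
  let ?N = "path_algebra \<Otimes>\<^sub>M PiM ?I (\<lambda>_. borel :: real measure)"
  have F: "F \<in> borel_measurable ?N"
  proof -
    have [measurable]: "(\<lambda>x. survive A k (snd x) (fst x)) \<in> borel_measurable ?N"
      by (rule survive_meas[OF A, where n="Suc k"]) auto
    have [measurable]: "(\<lambda>x. arrival (snd (fst x)) j) \<in> borel_measurable (?N \<Otimes>\<^sub>M borel)" if "j \<le> Suc k"
        for j
      by (rule arrival_meas[where n="Suc k"]) (use that in auto)
    have [measurable]: "(\<lambda>x. X (max 0 (snd x)) (fst (fst x))) \<in> borel_measurable (?N \<Otimes>\<^sub>M borel)"
      by (rule measurable_X_path_algebra) measurable
    have "(\<lambda>x. of_bool (arrival (snd (fst x)) k \<le> snd x \<and> snd x < arrival (snd (fst x)) (Suc k)) *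
        (ennreal (exp (- q * snd x)) * f (X (max 0 (snd x)) (fst (fst x))))) \<in> borel_measurable
        (?N \<Otimes>\<^sub>M borel)"
      by measurable
    then have "(\<lambda>x. H (snd x) (fst x)) \<in> borel_measurable ?N"
      unfolding H_def indicator_def atLeastLessThan_iff by measurable
    then show ?thesis unfolding F_def[abs_def] by measurable
  qed
  have "(\<integral>\<^sup>+\<omega>. (\<Prod>j\<in>{1..k}. indicator A (X (T j \<omega>) \<omega>)) *
      (\<integral>\<^sup>+s. indicator {T k \<omega>..<T (Suc k) \<omega>} s * (ennreal (exp (- q * s)) * f (X (max 0 s) \<omega>)) \<partial>lborel)
          \<partial>M) =
      (\<integral>\<^sup>+\<omega>. F (\<omega>, \<lambda>i\<in>?I. gap i \<omega>) \<partial>M)"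
  proof (rule nn_integral_cong)
    fix \<omega> assume \<omega>: "\<omega> \<in> space M"
    show "(\<Prod>j\<in>{1..k}. indicator A (X (T j \<omega>) \<omega>)) *
      (\<integral>\<^sup>+s. indicator {T k \<omega>..<T (Suc k) \<omega>} s * (ennreal (exp (- q * s)) * f (X (max 0 s) \<omega>)) \<partial>lborel) =
          F (\<omega>, \<lambda>i\<in>?I. gap i \<omega>)"
      using T_nonneg[OF \<omega>] unfolding F_def H_def survive_def fst_conv snd_conv
      by (simp add: arrival_restrict_gap[OF \<omega>] max_absorb2 del: restrict_apply)
  qed
  also have "\<dots> = (\<integral>\<^sup>+d. (\<integral>\<^sup>+\<omega>. F (\<omega>, d) \<partial>M) \<partial>PiM ?I (\<lambda>_. exp_law))"
    by (rule nn_integral_transfer[OF F])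
  also have "\<dots> = (\<integral>\<^sup>+d. \<integral>\<^sup>+e. (\<integral>\<^sup>+\<omega>. F (\<omega>, d(k := e)) \<partial>M) \<partial>exp_law \<partial>PiM {..<k} (\<lambda>_. exp_law))"
  proof (rule nn_integral_PiM_Suc)
    have "(\<lambda>x. F (snd x, fst x)) \<in> borel_measurable (PiM ?I (\<lambda>_. borel) \<Otimes>\<^sub>M M)"
      by (rule measurable_compose[OF _ F]) (auto intro!: measurable_Pair measurable_M_path_algebra)
    then show "(\<lambda>d. \<integral>\<^sup>+\<omega>. F (\<omega>, d) \<partial>M) \<in> borel_measurable (PiM ?I (\<lambda>_. borel))"
      by (intro borel_measurable_nn_integral) (simp add: case_prod_beta')
  qed
  also have "\<dots> = sampled_op A k (resolvent_op f)"
    unfolding sampled_op_def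
  proof (rule nn_integral_cong)
    fix d assume d: "d \<in> space (PiM {..<k} (\<lambda>_. exp_law))"
    have surv [measurable (raw)]: "(\<lambda>x. survive A k d (h x)) \<in> borel_measurable N"
        if "h \<in> measurable N M" for h and N :: "'c measure"
      using survive_meas[OF A measurable_PiM_I[OF d] order_refl measurable_M_path_algebra[OF that]] .
    interpret P1: pair_sigma_finite M lborel by unfold_locales
    interpret P2: pair_sigma_finite exp_law lborel by unfold_locales
    let ?v = "\<lambda>u. ennreal (exp (- q * (arrival d k + u)))"
    let ?w = "\<lambda>u. \<integral>\<^sup>+\<omega>. survive A k d \<omega> * f (X (max 0 (arrival d k + u)) \<omega>) \<partial>M"
    have shift: "H (d(k := e)) \<omega> = (\<integral>\<^sup>+u. indicator {0..} u * indicator {u<..} \<bar>e\<bar> *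
        (?v u * f (X (max 0 (arrival d k + u)) \<omega>)) \<partial>lborel)"
      if "\<omega> \<in> space M" for e \<omega>
    proof -
      have [measurable]: "(\<lambda>s. X (max 0 s) \<omega>) \<in> borel_measurable borel"
        using that by measurable
      show ?thesis
        unfolding H_def
        by (subst nn_integral_real_affine[where c=1 and t="arrival d k"])
          (auto simp: arrival_Suc arrival_upd intro!: nn_integral_cong split: split_indicator)
    qed
    have inner: "(\<integral>\<^sup>+\<omega>. F (\<omega>, d(k := e)) \<partial>M) =
        (\<integral>\<^sup>+u. indicator {0..} u * indicator {u<..} \<bar>e\<bar> * (?v u * ?w u) \<partial>lborel)" for e
    proof -
      have "(\<integral>\<^sup>+\<omega>. F (\<omega>, d(k := e)) \<partial>M) = (\<integral>\<^sup>+\<omega>. \<integral>\<^sup>+u. survive A k d \<omega> * (of_bool (0 \<le>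
          u \<and> u < \<bar>e\<bar>) * (?v u * f (X (max 0 (arrival d k + u)) \<omega>))) \<partial>lborel \<partial>M)"
      proof (rule nn_integral_cong)
        fix \<omega> assume \<omega>: "\<omega> \<in> space M"
        have [measurable]: "(\<lambda>s. X (max 0 (arrival d k + s)) \<omega>) \<in> borel_measurable borel"
          using \<omega> by measurable
        show "F (\<omega>, d(k := e)) = (\<integral>\<^sup>+u. survive A k d \<omega> * (of_bool (0 \<le>
            u \<and> u < \<bar>e\<bar>) * (?v u * f (X (max 0 (arrival d k + u)) \<omega>))) \<partial>lborel)"
          unfolding F_def fst_conv snd_conv shift[OF \<omega>] survive_upd[OF order_refl]
          by (subst nn_integral_cmult[symmetric])
            (auto intro!: nn_integral_cong simp: indicator_def)
      qed
      also have "\<dots> = (\<integral>\<^sup>+u. \<integral>\<^sup>+\<omega>. survive A k d \<omega> * (of_bool (0 \<le>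
          u \<and> u < \<bar>e\<bar>) * (?v u * f (X (max 0 (arrival d k + u)) \<omega>))) \<partial>M \<partial>lborel)"
        by (rule P1.Fubini'[symmetric]) measurable
      also have "\<dots> = (\<integral>\<^sup>+u. indicator {0..} u * indicator {u<..} \<bar>e\<bar> * (?v u * ?w u) \<partial>lborel)"
      proof (rule nn_integral_cong)
        fix u :: real
        have "(\<integral>\<^sup>+\<omega>. survive A k d \<omega> * (of_bool (0 \<le>
            u \<and> u < \<bar>e\<bar>) * (?v u * f (X (max 0 (arrival d k + u)) \<omega>))) \<partial>M) =
            (\<integral>\<^sup>+\<omega>. (of_bool (0 \<le> u \<and> u < \<bar>e\<bar>) * ?v u) * (survive A k d \<omega> *
                f (X (max 0 (arrival d k + u)) \<omega>)) \<partial>M)"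
          by (intro nn_integral_cong) (simp only: mult_ac)
        also have "\<dots> = (of_bool (0 \<le> u \<and> u < \<bar>e\<bar>) * ?v u) * ?w u"
          by (rule nn_integral_cmult) measurable
        finally show "(\<integral>\<^sup>+\<omega>. survive A k d \<omega> * (of_bool (0 \<le>
            u \<and> u < \<bar>e\<bar>) * (?v u * f (X (max 0 (arrival d k + u)) \<omega>))) \<partial>M) =
            indicator {0..} u * indicator {u<..} \<bar>e\<bar> * (?v u * ?w u)"
          by (simp add: indicator_def mult.assoc)
      qed
      finally show ?thesis .
    qed
    have "(\<integral>\<^sup>+e. (\<integral>\<^sup>+\<omega>. F (\<omega>, d(k := e)) \<partial>M) \<partial>exp_law) =
        (\<integral>\<^sup>+e. \<integral>\<^sup>+u. indicator {0..} u * of_bool (u < \<bar>e\<bar>) * (?v u * ?w u) \<partial>lborel \<partial>exp_law)"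
      unfolding inner by (simp add: indicator_def)
    also have "\<dots> = (\<integral>\<^sup>+u. \<integral>\<^sup>+e. indicator {0..} u * of_bool (u < \<bar>e\<bar>) * (?v u * ?w u) \<partial>exp_law \<partial>lborel)"
      by (rule P2.Fubini'[symmetric]) measurable
    also have "\<dots> = (\<integral>\<^sup>+u. ennreal (exp (- q * arrival d k)) * (indicator {0..} u *
        ennreal (exp (- (q + lam) * u)) * ?w u) \<partial>lborel)"
    proof (rule nn_integral_cong)
      fix u :: real
      show "(\<integral>\<^sup>+e. indicator {0..} u * of_bool (u < \<bar>e\<bar>) * (?v u * ?w u) \<partial>exp_law) =
          ennreal (exp (- q * arrival d k)) * (indicator {0..} u * ennreal (exp (- (q + lam) * u)) *
          ?w u)"
      proof (cases "0 \<le> u")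
        case True
        \<comment> \<open>Removes the absolute value built into \<open>arrival\<close>.\<close>
        have "AE e in exp_law. 0 \<le> e"
          by (subst AE_density) (auto simp: exponential_density_def)
        then have "(\<integral>\<^sup>+e. indicator {0..} u * of_bool (u < \<bar>e\<bar>) * (?v u * ?w u) \<partial>exp_law) =
            (\<integral>\<^sup>+e. indicator {u<..} e * (?v u * ?w u) \<partial>exp_law)"
          using True by (intro nn_integral_cong_AE) (auto simp: indicator_def elim!: eventually_mono)
        also have "\<dots> = ennreal (exp (- lam * u)) * (?v u * ?w u)"
          by (subst nn_integral_multc) (use nn_integral_tail_exp_law[OF True] in auto)
        also have "\<dots> = (ennreal (exp (- lam * u)) * ?v u) * ?w u" by (simp only: mult.assoc)
        also have "ennreal (exp (- lam * u)) * ?v u =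
            ennreal (exp (- q * arrival d k)) * ennreal (exp (- (q + lam) * u))"
          by (simp add: algebra_simps flip: ennreal_mult exp_add)
        finally show ?thesis using True by (simp add: mult.assoc)
      qed simp
    qed
    also have "\<dots> = ennreal (exp (- q * arrival d k)) * (\<integral>\<^sup>+u. indicator {0..} u *
        ennreal (exp (- (q + lam) * u)) * ?w u \<partial>lborel)"
      by (rule nn_integral_cmult) measurable
    also have "\<dots> = ennreal (exp (- q * arrival d k)) * (\<integral>\<^sup>+\<omega>. survive A k d \<omega> *
        resolvent_op f (X (max 0 (arrival d k)) \<omega>) \<partial>M)"
      by (simp only: nn_integral_discounted_path[OF A f d])
    finally show "(\<integral>\<^sup>+e. (\<integral>\<^sup>+\<omega>. F (\<omega>, d(k := e)) \<partial>M) \<partial>exp_law) =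
        ennreal (exp (- q * arrival d k)) * (\<integral>\<^sup>+\<omega>. survive A k d \<omega> *
        resolvent_op f (X (max 0 (arrival d k)) \<omega>) \<partial>M)" .
  qed
  also have "\<dots> = (step_op A ^^ k) (resolvent_op f) 0"
    by (rule sampled_op_eq[OF A]) (use resolvent_op_meas[where h="\<lambda>x. x" and N=borel] f in simp)
  finally show ?thesis .
qed


section \<open>The Gittins index\<close>

lemma X_T_meas [measurable]: "(\<lambda>\<omega>. X (T k \<omega>) \<omega>) \<in> borel_measurable M"
proof -
  have "(\<lambda>\<omega>. X (max 0 (T k \<omega>)) \<omega>) \<in> borel_measurable M" by measurable
  then show ?thesis
    by (rule measurable_cong[THEN iffD1, rotated]) (simp add: T_nonneg max_absorb2)
qed

lemma sampled_value_UNIV: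
  assumes "g \<in> borel_measurable borel"
  shows "(\<integral>\<^sup>+\<omega>. ennreal (exp (- q * T k \<omega>)) * g (X (T k \<omega>) \<omega>) \<partial>M) = (step_op UNIV ^^ k) g 0"
  using sampled_value[of UNIV g k] assms by simp

text \<open>The discount factors have means at most \<open>(lam / (q + lam)) ^ k\<close>, so their
  sum is finite almost surely and they tend to 0. This is what makes the intervals between arrivals
  exhaust the half-line.\<close>

lemma T_unbounded: "AE \<omega> in M. \<forall>s. \<exists>k. s < T k \<omega>"
proof -
  let ?r = "lam / (q + lam)"
  have r: "0 \<le> ?r" "?r < 1" using q lam by auto
  have "(\<integral>\<^sup>+\<omega>. (\<Sum>k. ennreal (exp (- q * T k \<omega>))) \<partial>M) = (\<Sum>k. \<integral>\<^sup>+\<omega>. ennreal (exp (- q * T k \<omega>)) \<partial>M)"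
    by (rule nn_integral_suminf) measurable
  also have "\<dots> \<le> (\<Sum>k. ennreal (?r ^ k))"
  proof (rule suminf_le)
    fix k
    have "(\<integral>\<^sup>+\<omega>. ennreal (exp (- q * T k \<omega>)) \<partial>M) = (step_op UNIV ^^ k) (\<lambda>_. 1) 0"
      using sampled_value_UNIV[of "\<lambda>_. 1" k] by simp
    also have "\<dots> \<le> 1 * ennreal (?r ^ k)" by (rule step_op_pow_bounded) simp
    finally show "(\<integral>\<^sup>+\<omega>. ennreal (exp (- q * T k \<omega>)) \<partial>M) \<le> ennreal (?r ^ k)" by simp
  qed auto
  also have "\<dots> < \<infinity>"
  proof -
    have "summable (\<lambda>k. ?r ^ k)" using r
      by (intro summable_geometric) (simp only: real_norm_def abs_of_nonneg)
    then show ?thesis using r by (subst suminf_ennreal2) auto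
  qed
  finally have "(\<integral>\<^sup>+\<omega>. (\<Sum>k. ennreal (exp (- q * T k \<omega>))) \<partial>M) \<noteq> \<infinity>" by simp
  then have "AE \<omega> in M. (\<Sum>k. ennreal (exp (- q * T k \<omega>))) \<noteq> \<infinity>"
    by (intro nn_integral_noteq_infinite) measurable
  then show ?thesis
  proof eventually_elim
    case (elim \<omega>)
    have "summable (\<lambda>k. exp (- q * T k \<omega>))"
      by (rule summable_suminf_not_top) (use elim in auto)
    then have lim: "(\<lambda>k. exp (- q * T k \<omega>)) \<longlonglongrightarrow> 0" by (rule summable_LIMSEQ_zero)
    show ?case
    proof
      fix s
      obtain k where "exp (- q * T k \<omega>) < exp (- q * s)"
        using order_tendstoD(2)[OF lim, of "exp (- q * s)"] by (auto simp: eventually_sequentially)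
      then show "\<exists>k. s < T k \<omega>" using q by auto
    qed
  qed
qed

text \<open>The event that time \<open>s\<close> precedes the passage time. The level cancels
  against the starting point, and the clipped time keeps the event jointly measurable.\<close>

definition alive :: "'a \<Rightarrow> real \<Rightarrow> bool" where
  "alive \<omega> s \<longleftrightarrow> 0 \<le> s \<and> (\<forall>j. 1 \<le> j \<longrightarrow> X (max 0 (T j \<omega>)) \<omega> \<le> 0 \<longrightarrow> s < T j \<omega>)"

text \<open>Strictness has to survive the infimum: since the arrivals increase, the infimum over a
  nonempty set of them is attained at its least index.\<close>

lemma less_passage_time_iff:
  assumes \<omega>: "\<omega> \<in> space M"
  shows "0 \<le> s \<and> ereal s < passage_time T (\<lambda>t \<omega>. x + X t \<omega>) x \<omega> \<longleftrightarrow> alive \<omega> s"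
proof -
  define J where "J = {k. 1 \<le> k \<and> X (T k \<omega>) \<omega> \<le> 0}"
  have pt: "passage_time T (\<lambda>t \<omega>. x + X t \<omega>) x \<omega> = Inf ((\<lambda>k. ereal (T k \<omega>)) ` J)"
    unfolding passage_time_def J_def by (intro arg_cong[where f=Inf]) auto
  have al: "alive \<omega> s \<longleftrightarrow> 0 \<le> s \<and> (\<forall>j\<in>J. s < T j \<omega>)"
    using T_nonneg[OF \<omega>] by (auto simp: alive_def J_def max_absorb2)
  have "ereal s < Inf ((\<lambda>k. ereal (T k \<omega>)) ` J) \<longleftrightarrow> (\<forall>j\<in>J. s < T j \<omega>)"
  proof
    assume *: "ereal s < Inf ((\<lambda>k. ereal (T k \<omega>)) ` J)"
    show "\<forall>j\<in>J. s < T j \<omega>"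
    proof
      fix j assume "j \<in> J"
      then have "Inf ((\<lambda>k. ereal (T k \<omega>)) ` J) \<le> ereal (T j \<omega>)" by (rule INF_lower)
      with * have "ereal s < ereal (T j \<omega>)" by (rule less_le_trans)
      then show "s < T j \<omega>" by simp
    qed
  next
    assume *: "\<forall>j\<in>J. s < T j \<omega>"
    show "ereal s < Inf ((\<lambda>k. ereal (T k \<omega>)) ` J)"
    proof (cases "J = {}")
      case True
      then show ?thesis by (simp add: top_ereal_def)
    next
      case False
      define j where "j = (LEAST j. j \<in> J)"
      have j: "j \<in> J" "\<And>k. k \<in> J \<Longrightarrow> j \<le> k"
        using False by (auto simp: j_def intro: LeastI Least_le)
      have "ereal (T j \<omega>) \<le> Inf ((\<lambda>k. ereal (T k \<omega>)) ` J)"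
        using j(2) T_less[OF \<omega>] by (intro INF_greatest) (auto simp: le_less)
      moreover have "ereal s < ereal (T j \<omega>)" using * j(1) by simp
      ultimately show ?thesis by (rule less_le_trans[rotated])
    qed
  qed
  then show ?thesis unfolding pt al by blast
qed

lemma alive_meas [measurable]: "(\<lambda>x. alive (fst x) (snd x)) \<in> measurable (M \<Otimes>\<^sub>M borel) (count_space
    UNIV)"
  unfolding alive_def by measurable

text \<open>For nonnegative \<open>s\<close> exactly one interval between successive arrivals
  contains it; being alive there means that all arrivals up to its left end found the path above the
  level.\<close>

lemma alive_eq_suminf:
  assumes \<omega>: "\<omega> \<in> space M" and unb: "\<forall>s. \<exists>k. s < T k \<omega>"
  shows "(of_bool (alive \<omega> s) :: ennreal) =
    (\<Sum>k. (\<Prod>j\<in>{1..k}. indicator {0<..} (X (T j \<omega>) \<omega>)) * indicator {T k \<omega>..<T (Suc k) \<omega>} s)"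
    (is "_ = (\<Sum>k. ?f k)")
proof (cases "0 \<le> s")
  case False
  then have "\<not> T k \<omega> \<le> s" for k using T_nonneg[OF \<omega>, of k] by simp
  then have f0: "?f = (\<lambda>_. 0)" by (simp add: fun_eq_iff)
  show ?thesis unfolding f0 using False by (simp add: alive_def)
next
  case True
  \<comment> \<open>The first index with arrival time after \<open>s\<close>, which exists by
    unboundedness; its predecessor is the index of the interval.\<close>
  define n where "n = (LEAST n. s < T n \<omega>)"
  have n: "s < T n \<omega>" "\<And>j. j < n \<Longrightarrow> \<not> s < T j \<omega>"
    using unb by (auto simp: n_def intro: LeastI_ex dest: not_less_Least)
  have "n \<noteq> 0" using n(1) T_0[OF \<omega>] True by (cases n) auto
  then obtain k where k: "n = Suc k" by (cases n) auto
  have mono: "i \<le> j \<Longrightarrow> T i \<omega> \<le> T j \<omega>" for i j using T_less[OF \<omega>, of i j] by (cases "i = j") auto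
  have le_iff: "T j \<omega> \<le> s \<longleftrightarrow> j \<le> k" for j
  proof
    assume "T j \<omega> \<le> s"
    then show "j \<le> k" using n(1) mono[of n j] k by (cases "j \<le> k") auto
  next
    assume "j \<le> k"
    then show "T j \<omega> \<le> s" using n(2)[of j] k by simp
  qed
  have ind: "indicator {T i \<omega>..<T (Suc i) \<omega>} s = (of_bool (i = k) :: ennreal)" for i
    using le_iff[of i] le_iff[of "Suc i"] by (auto simp: indicator_def not_less[symmetric])
  have "(\<Sum>i. ?f i) = (\<Sum>i\<in>{k}. ?f i)"
    by (rule suminf_finite) (auto simp: ind)
  also have "\<dots> = (\<Prod>j\<in>{1..k}. indicator {0<..} (X (T j \<omega>) \<omega>))" by (simp add: ind)
  also have "\<dots> = of_bool (alive \<omega> s)"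
  proof (cases "\<forall>j\<in>{1..k}. 0 < X (T j \<omega>) \<omega>")
    case pos: True
    have "alive \<omega> s"
      unfolding alive_def using True pos le_iff T_nonneg[OF \<omega>]
        by (fastforce simp: max_absorb2 not_less[symmetric])
    then show ?thesis using pos by (simp add: prod.neutral)
  next
    case neg: False
    then obtain j where j: "j \<in> {1..k}" "X (T j \<omega>) \<omega> \<le> 0" by force
    then have "\<not> alive \<omega> s"
      using le_iff[of j] T_nonneg[OF \<omega>, of j] by (auto simp: alive_def max_absorb2 not_less[symmetric])
    moreover have "(\<Prod>j\<in>{1..k}. indicator {0<..} (X (T j \<omega>) \<omega>)) = (0 :: ennreal)"
      using j by (intro prod_zero) (auto simp: indicator_def intro!: bexI[of _ j])
    ultimately show ?thesis by simp
  qed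
  finally show ?thesis by simp
qed

text \<open>The integrand of the Gittins index without the reward, with the factor
  \<open>lam\<close> included so that its occupation functional is exactly
  \<open>nu\<close>.\<close>

definition weight :: "'a \<Rightarrow> real \<Rightarrow> real" where
  "weight \<omega> s = of_bool (alive \<omega> s) * (exp (- q * s) * (lam * indicator {0<..} (X (max 0 s) \<omega>)))"

lemma weight_meas [measurable]: "(\<lambda>x. weight (fst x) (snd x)) \<in> borel_measurable (M \<Otimes>\<^sub>M borel)"
  unfolding weight_def by measurable

lemma weight_nonneg: "0 \<le> weight \<omega> s"
  using lam by (simp add: weight_def)

text \<open>The lifetime is cut at the arrivals. The \<open>k\<close>-th piece is \<open>k\<close>
  killed steps followed by the resolvent of \<open>lam\<close> times the restricted function, which
  amounts to one more step; the series of pieces is the one that represents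
  \<open>nu\<close>.\<close>

lemma nn_integral_occupation:
  assumes f [measurable]: "f \<in> borel_measurable borel"
  shows "(\<integral>\<^sup>+\<omega>. \<integral>\<^sup>+s. ennreal (weight \<omega> s) * f (X (max 0 s) \<omega>) \<partial>lborel \<partial>M) = nu f"
proof -
  let ?A = "{0<..} :: real set"
  let ?f = "\<lambda>y. ennreal lam * (indicator ?A y * f y)"
  let ?P = "\<lambda>k \<omega>. \<Prod>j\<in>{1..k}. indicator ?A (X (T j \<omega>) \<omega>) :: ennreal"
  let ?S = "\<lambda>k \<omega> s. indicator {T k \<omega>..<T (Suc k) \<omega>} s * (ennreal (exp (- q * s)) *
      ?f (X (max 0 s) \<omega>)) :: ennreal"
  have S_meas: "(\<lambda>x. ?S k (fst x) (snd x)) \<in> borel_measurable (M \<Otimes>\<^sub>M lborel)" for k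
  proof -
    have "(\<lambda>x. of_bool (T k (fst x) \<le> snd x \<and> snd x < T (Suc k) (fst x)) * (ennreal (exp (- q * snd x)) *
        ?f (X (max 0 (snd x)) (fst x)))) \<in> borel_measurable (M \<Otimes>\<^sub>M lborel)"
      by measurable
    then show ?thesis by (simp add: indicator_def)
  qed
  have S_meas1 [measurable]: "(\<lambda>s. ?S k \<omega> s) \<in> borel_measurable lborel" if "\<omega> \<in> space M" for k \<omega>
    using measurable_compose[OF _ S_meas, of "\<lambda>s. (\<omega>, s)"] that by simp
  have I_meas [measurable]: "(\<lambda>\<omega>. \<integral>\<^sup>+s. ?S k \<omega> s \<partial>lborel) \<in> borel_measurable M" for k
    using S_meas[of k] by (intro lborel.borel_measurable_nn_integral) (simp add: case_prod_beta')
  have P_meas [measurable]: "?P k \<in> borel_measurable M" for k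
    by (intro borel_measurable_prod_ennreal) measurable
  have "(\<integral>\<^sup>+\<omega>. \<integral>\<^sup>+s. ennreal (weight \<omega> s) * f (X (max 0 s) \<omega>) \<partial>lborel \<partial>M) =
      (\<integral>\<^sup>+\<omega>. (\<Sum>k. ?P k \<omega> * (\<integral>\<^sup>+s. ?S k \<omega> s \<partial>lborel)) \<partial>M)"
  proof (rule nn_integral_cong_AE)
    show "AE \<omega> in M. (\<integral>\<^sup>+s. ennreal (weight \<omega> s) * f (X (max 0 s) \<omega>) \<partial>lborel) =
        (\<Sum>k. ?P k \<omega> * (\<integral>\<^sup>+s. ?S k \<omega> s \<partial>lborel))"
      using T_unbounded AE_space
    proof eventually_elim
      case (elim \<omega>)
      have "ennreal (weight \<omega> s) * f (X (max 0 s) \<omega>) = (\<Sum>k. ?P k \<omega> * ?S k \<omega> s)" for s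
      proof -
        have "ennreal (weight \<omega> s) * f (X (max 0 s) \<omega>) =
            of_bool (alive \<omega> s) * (ennreal (exp (- q * s)) * ?f (X (max 0 s) \<omega>))"
          using lam by (auto simp: weight_def indicator_def ennreal_mult mult.assoc)
        also have "\<dots> = (\<Sum>k. ?P k \<omega> * indicator {T k \<omega>..<T (Suc k) \<omega>} s) * (ennreal (exp (- q * s)) *
            ?f (X (max 0 s) \<omega>))"
          by (simp only: alive_eq_suminf[OF elim(2,1)])
        also have "\<dots> = (\<Sum>k. ?P k \<omega> * ?S k \<omega> s)"
          by (simp only: ennreal_suminf_multc[symmetric] mult.assoc)
        finally show ?thesis .
      qed
      then have "(\<integral>\<^sup>+s. ennreal (weight \<omega> s) * f (X (max 0 s) \<omega>) \<partial>lborel) =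
          (\<integral>\<^sup>+s. (\<Sum>k. ?P k \<omega> * ?S k \<omega> s) \<partial>lborel)"
        by simp
      also have "\<dots> = (\<Sum>k. \<integral>\<^sup>+s. ?P k \<omega> * ?S k \<omega> s \<partial>lborel)"
        by (rule nn_integral_suminf) (intro borel_measurable_times_ennreal S_meas1[OF elim(2)]
            borel_measurable_const)
      also have "\<dots> = (\<Sum>k. ?P k \<omega> * (\<integral>\<^sup>+s. ?S k \<omega> s \<partial>lborel))"
        by (intro arg_cong[where f=suminf] ext nn_integral_cmult S_meas1[OF elim(2)])
      finally show ?case .
    qed
  qed
  also have "\<dots> = (\<Sum>k. \<integral>\<^sup>+\<omega>. ?P k \<omega> * (\<integral>\<^sup>+s. ?S k \<omega> s \<partial>lborel) \<partial>M)"
    by (rule nn_integral_suminf) measurable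
  also have "\<dots> = (\<Sum>k. (step_op ?A ^^ k) (resolvent_op ?f) 0)"
    by (intro arg_cong[where f=suminf] ext sampled_integral) measurable
  also have "resolvent_op ?f = step_op ?A f"
    unfolding step_op_def resolvent_op_def by (intro ext nn_integral_cmult) measurable
  also have "(\<Sum>k. (step_op ?A ^^ k) (step_op ?A f) 0) = (\<Sum>k. (step_op ?A ^^ Suc k) f 0)"
    by (simp add: funpow_swap1)
  also have "\<dots> = nu f" by (rule nu_eq_suminf[OF f, symmetric])
  finally show ?thesis .
qed

definition nu_density :: "real \<Rightarrow> real" where
  "nu_density y = indicator {0<..} y * ((\<beta> - \<phi>) * exp (- \<phi> * y))"

lemma nu_density_meas [measurable]: "nu_density \<in> borel_measurable borel"
  unfolding nu_density_def[abs_def] by measurable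

lemma nu_density_nonneg: "0 \<le> nu_density y"
  using \<phi>_less by (simp add: nu_density_def)

lemma nu_eq_nu_density: "nu f = (\<integral>\<^sup>+y. ennreal (nu_density y) * f y \<partial>lborel)"
  unfolding nu_def nu_density_def by (intro nn_integral_cong) (auto simp: indicator_def)

text \<open>Equality of nonnegative functionals recast as equality of measures, which is what allows
  signed rewards to be integrated.\<close>

lemma occupation_measure:
  "distr (density (M \<Otimes>\<^sub>M lborel) (\<lambda>x. ennreal (weight (fst x) (snd x)))) borel (\<lambda>x.
      X (max 0 (snd x)) (fst x)) =
    density lborel (\<lambda>y. ennreal (nu_density y))"
    (is "?O = ?N")
proof (rule measure_eqI)
  fix B assume "B \<in> sets (?O)"
  then have B [measurable]: "B \<in> sets borel" by simp
  have [measurable]: "(\<lambda>x. weight (fst x) (snd x)) \<in> borel_measurable (M \<Otimes>\<^sub>M lborel)" by measurable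
  have "emeasure (?O) B =
      (\<integral>\<^sup>+y. indicator B y \<partial>?O)"
    by simp
  also have "\<dots> = (\<integral>\<^sup>+x. ennreal (weight (fst x) (snd x)) *
      indicator B (X (max 0 (snd x)) (fst x)) \<partial>(M \<Otimes>\<^sub>M lborel))"
    by (subst nn_integral_distr) (auto simp: nn_integral_density)
  also have "\<dots> = (\<integral>\<^sup>+\<omega>. \<integral>\<^sup>+s. ennreal (weight \<omega> s) * indicator B (X (max 0 s) \<omega>) \<partial>lborel \<partial>M)"
    by (subst lborel.nn_integral_fst[symmetric]) auto
  also have "\<dots> = nu (indicator B)" by (rule nn_integral_occupation) measurable
  also have "\<dots> = emeasure (?N) B"
    unfolding nu_eq_nu_density by (simp add: emeasure_density)
  finally show "emeasure (?O) B =
      emeasure (?N) B" .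
qed simp

lemma integral_occupation:
  assumes [measurable]: "R \<in> borel_measurable borel" and fin: "nu (\<lambda>y. ennreal \<bar>R (x + y)\<bar>) < \<infinity>"
  defines "S \<equiv> \<lambda>\<omega>. {s. 0 \<le> s \<and> ereal s < passage_time T (\<lambda>t \<omega>. x + X t \<omega>) x \<omega>}"
  shows "lam * (\<integral>\<omega>. (LBINT s:S \<omega>. exp (- q * s) * R (x + X s \<omega>) * indicator {x<..} (x + X s \<omega>)) \<partial>M) =
    (\<integral>y. nu_density y * R (x + y) \<partial>lborel)"
proof -
  interpret P: pair_sigma_finite M lborel by unfold_locales
  let ?D = "density (M \<Otimes>\<^sub>M lborel) (\<lambda>x. ennreal (weight (fst x) (snd x)))"
  let ?F = "\<lambda>z. weight (fst z) (snd z) * R (x + X (max 0 (snd z)) (fst z))"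
  have [measurable]: "(\<lambda>x. weight (fst x) (snd x)) \<in> borel_measurable (M \<Otimes>\<^sub>M lborel)" by measurable
  have "integrable (density lborel (\<lambda>y. ennreal (nu_density y))) (\<lambda>y. R (x + y))"
  proof (rule integrableI_bounded)
    show "(\<integral>\<^sup>+y. ennreal (norm (R (x + y))) \<partial>density lborel (\<lambda>y. ennreal (nu_density y))) < \<infinity>"
      using fin by (simp add: nn_integral_density nu_eq_nu_density)
  qed measurable
  then have "integrable ?D (\<lambda>z. R (x + X (max 0 (snd z)) (fst z)))"
    unfolding occupation_measure[symmetric] by (subst (asm) integrable_distr_eq) auto
  then have int: "integrable (M \<Otimes>\<^sub>M lborel) ?F"
    by (subst (asm) integrable_density) (auto simp: weight_nonneg)
  have "(\<integral>y. nu_density y * R (x + y) \<partial>lborel) =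
      (\<integral>y. R (x + y) \<partial>density lborel (\<lambda>y. ennreal (nu_density y)))"
    by (subst integral_density) (auto simp: nu_density_nonneg)
  also have "\<dots> = (\<integral>z. R (x + X (max 0 (snd z)) (fst z)) \<partial>?D)"
    unfolding occupation_measure[symmetric] by (subst integral_distr) auto
  also have "\<dots> = (\<integral>z. ?F z \<partial>(M \<Otimes>\<^sub>M lborel))"
    by (subst integral_density) (auto simp: weight_nonneg)
  also have "\<dots> = (\<integral>\<omega>. \<integral>s. ?F (\<omega>, s) \<partial>lborel \<partial>M)"
    by (rule P.integral_fst'[OF int, symmetric])
  also have "\<dots> = (\<integral>\<omega>. lam * (LBINT s:S \<omega>. exp (- q * s) * R (x + X s \<omega>) * indicator {x<..} (x +
      X s \<omega>)) \<partial>M)"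
  proof (rule Bochner_Integration.integral_cong[OF refl])
    fix \<omega> assume \<omega>: "\<omega> \<in> space M"
    have "?F (\<omega>, s) = lam * (indicator (S \<omega>) s *\<^sub>R (exp (- q * s) * R (x + X s \<omega>) * indicator {x<..} (x +
        X s \<omega>)))" for s
      using less_passage_time_iff[OF \<omega>, of s x]
      by (auto simp: weight_def S_def indicator_def alive_def max_absorb2)
    then show "(\<integral>s. ?F (\<omega>, s) \<partial>lborel) = lam * (LBINT s:S \<omega>. exp (- q * s) * R (x + X s \<omega>) *
        indicator {x<..} (x + X s \<omega>))"
      unfolding set_lebesgue_integral_def by simp
  qed
  finally show ?thesis by simp
qed

lemma gittins_index_eq:
  assumes R [measurable]: "R \<in> borel_measurable borel" and fin: "nu (\<lambda>y. ennreal \<bar>R (x + y)\<bar>) < \<infinity>"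
  shows "gittins_index M X T q lam R x =
    \<phi> / \<beta> * (R x + (\<beta> - \<phi>) * (LBINT y:{0..}. R (x + y) * exp (- \<phi> * y)))"
proof -
  let ?E = "\<lambda>f. \<integral>\<omega>. (LBINT s:{s. 0 \<le> s \<and> ereal s < passage_time T (\<lambda>t \<omega>. x + X t \<omega>) x \<omega>}.
                   exp (- q * s) * f (x + X s \<omega>) * indicator {x<..} (x + X s \<omega>)) \<partial>M"
  have nu_density_int: "(\<integral>y. nu_density y * f y \<partial>lborel) =
      (\<beta> - \<phi>) * (LBINT y:{0..}. f y * exp (- \<phi> * y))"
    if [measurable]: "f \<in> borel_measurable borel" for f
  proof -
    have "(\<integral>y. nu_density y * f y \<partial>lborel) =
        (\<integral>y. (\<beta> - \<phi>) * (indicator {0..} y *\<^sub>R (f y * exp (- \<phi> * y))) \<partial>lborel)"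
    proof (rule integral_cong_AE)
      have "AE y in lborel. y \<noteq> (0 :: real)" by (rule AE_lborel_singleton)
      then show "AE y in lborel. nu_density y * f y =
          (\<beta> - \<phi>) * (indicator {0..} y *\<^sub>R (f y * exp (- \<phi> * y)))"
        by eventually_elim (auto simp: nu_density_def indicator_def)
    qed measurable
    then show ?thesis by (simp add: set_lebesgue_integral_def)
  qed
  have ER: "lam * ?E R = (\<beta> - \<phi>) * (LBINT y:{0..}. R (x + y) * exp (- \<phi> * y))"
    unfolding integral_occupation[OF R fin] by (rule nu_density_int) measurable
  have nu1: "nu (\<lambda>_. 1) = ennreal ((\<beta> - \<phi>) / \<phi>)" using nu_const[of 1] by simp
  have "lam * ?E (\<lambda>_. 1) = (\<integral>y. nu_density y * 1 \<partial>lborel)"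
    by (rule integral_occupation[of "\<lambda>_. 1"]) (simp_all add: nu1)
  also have "\<dots> = (\<beta> - \<phi>) / \<phi>"
    using nu1 \<phi>_pos \<phi>_less unfolding nu_eq_nu_density
    by (subst integral_eq_nn_integral) (auto simp: nu_density_nonneg)
  finally have E1: "lam * ?E (\<lambda>_. 1) = (\<beta> - \<phi>) / \<phi>" .
  \<comment> \<open>The denominator of the index; its reciprocal is the prefactor.\<close>
  have "1 + (\<beta> - \<phi>) / \<phi> = \<beta> / \<phi>" using \<phi>_pos by (simp add: field_simps)
  then show ?thesis
    unfolding gittins_index_def Let_def ER E1 using \<phi>_pos \<phi>_less by (simp add: field_simps)
qed

text \<open>What remains is integrability of the reward against \<open>nu\<close>. The killed series
  is dominated by the series without killing, and the latter is the assumed expectation without its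
  term at time 0.\<close>

lemma gittins_index_problem1:
  assumes R: "strict_mono R"
    and fin: "(\<integral>\<^sup>+\<omega>. (\<Sum>k. ennreal (exp (- q * T k \<omega>) * \<bar>R (x + X (T k \<omega>) \<omega>)\<bar>)) \<partial>M) < \<infinity>"
  shows "gittins_index M X T q lam R x =
    \<phi> / \<beta> * (R x + (\<beta> - \<phi>) * (LBINT y:{0..}. R (x + y) * exp (- \<phi> * y)))"
proof (rule gittins_index_eq)
  show [measurable]: "R \<in> borel_measurable borel"
    using R by (intro borel_measurable_mono strict_mono_mono)
  let ?g = "\<lambda>y. ennreal \<bar>R (x + y)\<bar>"
  have "nu ?g = (\<Sum>k. (step_op {0<..} ^^ Suc k) ?g 0)" by (rule nu_eq_suminf) measurable
  also have "\<dots> \<le> (\<Sum>k. (step_op UNIV ^^ Suc k) ?g 0)"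
    by (intro suminf_le step_op_pow_mono) auto
  also have "\<dots> \<le> (\<Sum>k. (step_op UNIV ^^ k) ?g 0)"
  proof (rule suminf_le_const)
    fix n
    have "(\<Sum>k<n. (step_op UNIV ^^ Suc k) ?g 0) \<le> (\<Sum>k<Suc n. (step_op UNIV ^^ k) ?g 0)"
      unfolding sum.lessThan_Suc_shift by simp
    also have "\<dots> \<le> (\<Sum>k. (step_op UNIV ^^ k) ?g 0)" by (rule sum_le_suminf) auto
    finally show "(\<Sum>k<n. (step_op UNIV ^^ Suc k) ?g 0) \<le> (\<Sum>k. (step_op UNIV ^^ k) ?g 0)" .
  qed simp
  also have "\<dots> = (\<Sum>k. \<integral>\<^sup>+\<omega>. ennreal (exp (- q * T k \<omega>)) * ?g (X (T k \<omega>) \<omega>) \<partial>M)"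
    by (intro arg_cong[where f=suminf] ext sampled_value_UNIV[symmetric]) measurable
  also have "\<dots> = (\<integral>\<^sup>+\<omega>. (\<Sum>k. ennreal (exp (- q * T k \<omega>)) * ?g (X (T k \<omega>) \<omega>)) \<partial>M)"
    by (rule nn_integral_suminf[symmetric]) measurable
  also have "\<dots> < \<infinity>" using fin by (simp add: ennreal_mult)
  finally show "nu ?g < \<infinity>" .
qed

section \<open>Rewards given by a resolvent\<close>

lemma nn_integral_resolvent_measure_Fubini:
  assumes [measurable]: "f \<in> borel_measurable borel"
  shows "(\<integral>\<^sup>+y. f y \<partial>resolvent_measure p) = (\<integral>\<^sup>+\<omega>. \<integral>\<^sup>+t. ennreal (indicator {0..} t * exp (- p * t)) *
      f (X (max 0 t) \<omega>) \<partial>lborel \<partial>M)"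
proof -
  interpret P: pair_sigma_finite M lborel by unfold_locales
  have "(\<integral>\<^sup>+y. f y \<partial>resolvent_measure p) = (\<integral>\<^sup>+t. \<integral>\<^sup>+\<omega>. ennreal (indicator {0..} t * exp (- p * t)) *
      f (X (max 0 t) \<omega>) \<partial>M \<partial>lborel)"
    by (subst nn_integral_resolvent_measure) (auto intro!: nn_integral_cong simp: nn_integral_cmult
        indicator_def)
  also have "\<dots> = (\<integral>\<^sup>+\<omega>. \<integral>\<^sup>+t. ennreal (indicator {0..} t * exp (- p * t)) *
      f (X (max 0 t) \<omega>) \<partial>lborel \<partial>M)"
    by (rule P.Fubini') measurable
  finally show ?thesis .
qed

lemma resolvent_eq_integral:
  assumes [measurable]: "r \<in> borel_measurable borel"
    and fin: "(\<integral>\<^sup>+y. ennreal \<bar>r (x + y)\<bar> \<partial>resolvent_measure p) < \<infinity>"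
  shows "integrable (resolvent_measure p) (\<lambda>y. r (x + y))" "resolvent M X p r x =
      (\<integral>y. r (x + y) \<partial>resolvent_measure p)"
proof -
  interpret P: pair_sigma_finite M lborel by unfold_locales
  let ?k = "\<lambda>z. indicator {0..} (snd z) * exp (- p * snd z) :: real"
  have resolvent_measure: "resolvent_measure p =
      distr (density (M \<Otimes>\<^sub>M lborel) (\<lambda>z. ennreal (?k z))) borel (\<lambda>z. X (max 0 (snd z)) (fst z))"
    unfolding resolvent_measure_def case_prod_beta'
    by (intro arg_cong[where f="\<lambda>g. distr (density (M \<Otimes>\<^sub>M lborel) g) borel (\<lambda>z.
        X (max 0 (snd z)) (fst z))"] ext)
      (auto simp: indicator_def)
  let ?F = "\<lambda>z. ?k z * r (x + X (max 0 (snd z)) (fst z))"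
  show int: "integrable (resolvent_measure p) (\<lambda>y. r (x + y))"
    by (rule integrableI_bounded) (use fin in auto)
  then have "integrable (density (M \<Otimes>\<^sub>M lborel) (\<lambda>z. ennreal (?k z))) (\<lambda>z. r (x +
      X (max 0 (snd z)) (fst z)))"
    unfolding resolvent_measure by (subst (asm) integrable_distr_eq) auto
  then have intF: "integrable (M \<Otimes>\<^sub>M lborel) ?F"
    by (subst (asm) integrable_density) auto
  have "(\<integral>y. r (x + y) \<partial>resolvent_measure p) =
      (\<integral>z. r (x + X (max 0 (snd z)) (fst z)) \<partial>density (M \<Otimes>\<^sub>M lborel) (\<lambda>z. ennreal (?k z)))"
    unfolding resolvent_measure by (subst integral_distr) auto
  also have "\<dots> = (\<integral>z. ?F z \<partial>(M \<Otimes>\<^sub>M lborel))"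
    by (subst integral_density) auto
  also have "\<dots> = (\<integral>\<omega>. \<integral>t. ?F (\<omega>, t) \<partial>lborel \<partial>M)"
    by (rule P.integral_fst'[OF intF, symmetric])
  also have "\<dots> = resolvent M X p r x"
    unfolding resolvent_def set_lebesgue_integral_def
    by (intro Bochner_Integration.integral_cong refl) (auto simp: indicator_def max_absorb2)
  finally show "resolvent M X p r x = (\<integral>y. r (x + y) \<partial>resolvent_measure p)" by simp
qed

lemma resolvent_measure_mono: "p \<le> p' \<Longrightarrow> f \<in> borel_measurable borel \<Longrightarrow> (\<integral>\<^sup>+y. f y \<partial>resolvent_measure p') \<le>
    (\<integral>\<^sup>+y. f y \<partial>resolvent_measure p)"
  by (auto simp: nn_integral_resolvent_measure indicator_def mult_right_mono intro!: nn_integral_mono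
      mult_right_mono)

text \<open>The resolvent equation with a term dropped: composing the rates \<open>q\<close> and
  \<open>q + lam\<close> gives \<open>1 / lam\<close> times the difference of the two resolvents.
  With total time \<tau> and first time \<open>s\<close> the weight is
  \<open>exp (- lam * (\<tau> - s))\<close> times the discount
  \<open>exp (- q * \<tau>)\<close>.\<close>

lemma resolvent_composition_le:
  assumes F [measurable]: "F \<in> borel_measurable borel"
  shows "(\<integral>\<^sup>+y. resolvent_op F (x + y) \<partial>resolvent_measure q) \<le>
      ennreal (1 / lam) * (\<integral>\<^sup>+y. F (x + y) \<partial>resolvent_measure q)"
proof -
  interpret P: pair_sigma_finite M lborel by unfold_locales
  let ?e = "\<lambda>p t. indicator {0..} t * ennreal (exp (- p * t))"
  have transition_resolvent_op: "transition s (resolvent_op F) x =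
      (\<integral>\<^sup>+t. ?e (q + lam) t * transition (s + t) F x \<partial>lborel)" if "0 \<le> s" for s
  proof -
    have "transition s (resolvent_op F) x =
        (\<integral>\<^sup>+\<omega>. \<integral>\<^sup>+t. ?e (q + lam) t * transition t F (x + X (max 0 s) \<omega>) \<partial>lborel \<partial>M)"
      by (simp add: transition_def[of s] resolvent_op_eq[OF F])
    also have "\<dots> = (\<integral>\<^sup>+t. \<integral>\<^sup>+\<omega>. ?e (q + lam) t * transition t F (x + X (max 0 s) \<omega>) \<partial>M \<partial>lborel)"
      by (rule P.Fubini'[symmetric]) measurable
    also have "\<dots> = (\<integral>\<^sup>+t. ?e (q + lam) t * transition s (transition t F) x \<partial>lborel)"
      unfolding transition_def[of s] by (intro nn_integral_cong nn_integral_cmult) measurable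
    also have "\<dots> = (\<integral>\<^sup>+t. ?e (q + lam) t * transition (s + t) F x \<partial>lborel)"
      by (intro nn_integral_cong) (auto simp: indicator_def transition_semigroup[OF F _ that])
    finally show ?thesis .
  qed
  have inner: "(\<integral>\<^sup>+s. indicator {..\<tau>} s * ennreal (exp (- lam * (\<tau> - s))) \<partial>lborel) = ennreal (1 / lam)"
      for \<tau> :: real
  proof -
    have "(\<integral>\<^sup>+s. indicator {..\<tau>} s * ennreal (exp (- lam * (\<tau> - s))) \<partial>lborel) =
        (\<integral>\<^sup>+u. indicator {0..} u * ennreal (exp (- lam * u)) \<partial>lborel)"
      by (subst nn_integral_real_affine[where c="-1" and t=\<tau>]) (auto simp: indicator_def intro!:
          nn_integral_cong)
    then show ?thesis using nn_integral_exp_decay[OF lam] by simp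
  qed
  have VF [measurable]: "resolvent_op F \<in> borel_measurable borel"
    using resolvent_op_meas[OF F, where h="\<lambda>x. x" and N=borel] by simp
  have "(\<integral>\<^sup>+y. resolvent_op F (x + y) \<partial>resolvent_measure q) =
      (\<integral>\<^sup>+s. ?e q s * transition s (resolvent_op F) x \<partial>lborel)"
    by (rule nn_integral_resolvent_measure_translate) measurable
  also have "\<dots> = (\<integral>\<^sup>+s. \<integral>\<^sup>+\<tau>. (indicator {0..} s * indicator {s..} \<tau>) *
      (ennreal (exp (- lam * (\<tau> - s))) * (ennreal (exp (- q * \<tau>)) * transition \<tau> F x)) \<partial>lborel \<partial>lborel)"
  proof (rule nn_integral_cong)
    fix s :: real
    show "?e q s * transition s (resolvent_op F) x =
        (\<integral>\<^sup>+\<tau>. (indicator {0..} s * indicator {s..} \<tau>) * (ennreal (exp (- lam * (\<tau> - s))) *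
        (ennreal (exp (- q * \<tau>)) * transition \<tau> F x)) \<partial>lborel)"
    proof (cases "0 \<le> s")
      case True
      have "?e q s * transition s (resolvent_op F) x =
          (\<integral>\<^sup>+t. ?e q s * (?e (q + lam) t * transition (s + t) F x) \<partial>lborel)"
        unfolding transition_resolvent_op[OF True] by (rule nn_integral_cmult[symmetric]) measurable
      also have "\<dots> = (\<integral>\<^sup>+\<tau>. ?e q s * (?e (q + lam) (\<tau> - s) * transition \<tau> F x) \<partial>lborel)"
        by (subst nn_integral_real_affine[where c=1 and t="- s"]) (auto simp: algebra_simps)
      also have "\<dots> = (\<integral>\<^sup>+\<tau>. (indicator {0..} s * indicator {s..} \<tau>) * (ennreal (exp (- lam * (\<tau> - s))) *
          (ennreal (exp (- q * \<tau>)) * transition \<tau> F x)) \<partial>lborel)"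
      proof (rule nn_integral_cong)
        fix \<tau> :: real
        have "ennreal (exp (- q * s)) * ennreal (exp (- (q + lam) * (\<tau> - s))) =
            ennreal (exp (- lam * (\<tau> - s))) * ennreal (exp (- q * \<tau>))"
          by (simp add: algebra_simps flip: ennreal_mult exp_add)
        then show "?e q s * (?e (q + lam) (\<tau> - s) * transition \<tau> F x) =
            (indicator {0..} s * indicator {s..} \<tau>) * (ennreal (exp (- lam * (\<tau> - s))) *
            (ennreal (exp (- q * \<tau>)) * transition \<tau> F x))"
          by (cases "s \<le> \<tau>") (simp_all add: True mult.assoc[symmetric])
      qed
      finally show ?thesis .
    qed simp
  qed
  \<comment> \<open>Letting \<open>s\<close> range over all values up to \<tau>, negative ones
    included, makes the inner integral exactly \<open>1 / lam\<close>.\<close>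
  also have "\<dots> \<le> (\<integral>\<^sup>+s. \<integral>\<^sup>+\<tau>. (indicator {0..} \<tau> * of_bool (s \<le> \<tau>)) * (ennreal (exp (- lam * (\<tau> - s))) *
      (ennreal (exp (- q * \<tau>)) * transition \<tau> F x)) \<partial>lborel \<partial>lborel)"
    by (intro nn_integral_mono mult_right_mono) (auto simp: indicator_def)
  also have "\<dots> = (\<integral>\<^sup>+\<tau>. \<integral>\<^sup>+s. (indicator {0..} \<tau> * of_bool (s \<le> \<tau>)) * (ennreal (exp (- lam * (\<tau> - s))) *
      (ennreal (exp (- q * \<tau>)) * transition \<tau> F x)) \<partial>lborel \<partial>lborel)"
    by (rule lborel_pair.Fubini'[symmetric]) measurable
  also have "\<dots> = (\<integral>\<^sup>+\<tau>. ennreal (1 / lam) * (?e q \<tau> * transition \<tau> F x) \<partial>lborel)"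
  proof (rule nn_integral_cong)
    fix \<tau> :: real
    have "(\<integral>\<^sup>+s. (indicator {0..} \<tau> * of_bool (s \<le> \<tau>)) * (ennreal (exp (- lam * (\<tau> - s))) *
        (ennreal (exp (- q * \<tau>)) * transition \<tau> F x)) \<partial>lborel) =
        (\<integral>\<^sup>+s. (indicator {..\<tau>} s * ennreal (exp (- lam * (\<tau> - s)))) *
            (?e q \<tau> * transition \<tau> F x) \<partial>lborel)"
      by (intro nn_integral_cong) (auto simp: indicator_def)
    also have "\<dots> = (\<integral>\<^sup>+s. indicator {..\<tau>} s * ennreal (exp (- lam * (\<tau> - s))) \<partial>lborel) *
        (?e q \<tau> * transition \<tau> F x)"
      by (rule nn_integral_multc) measurable
    finally show "(\<integral>\<^sup>+s. (indicator {0..} \<tau> * of_bool (s \<le> \<tau>)) * (ennreal (exp (- lam * (\<tau> - s))) *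
        (ennreal (exp (- q * \<tau>)) * transition \<tau> F x)) \<partial>lborel) =
        ennreal (1 / lam) * (?e q \<tau> * transition \<tau> F x)"
      by (simp only: inner)
  qed
  also have "\<dots> = ennreal (1 / lam) * (\<integral>\<^sup>+\<tau>. ?e q \<tau> * transition \<tau> F x \<partial>lborel)"
    by (rule nn_integral_cmult) measurable
  also have "(\<integral>\<^sup>+\<tau>. ?e q \<tau> * transition \<tau> F x \<partial>lborel) = (\<integral>\<^sup>+y. F (x + y) \<partial>resolvent_measure q)"
    by (rule nn_integral_resolvent_measure_translate[symmetric]) fact
  finally show ?thesis .
qed

text \<open>The point is integrability of the reward against \<open>nu\<close>. The densities of
  \<open>nu\<close> and of the \<open>q\<close>-resolvent on the positive half-line are both
  multiples of \<open>exp (- \<phi> * y)\<close>, so the bound on the composed resolvents reduces it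
  to the assumption on \<open>r\<close>.\<close>

lemma gittins_index_problem2:
  assumes r [measurable]: "r \<in> borel_measurable borel"
    and fin: "\<And>x. (\<integral>\<^sup>+\<omega>. (\<integral>\<^sup>+t\<in>{0..}. ennreal (exp (- q * t) * \<bar>r (x + X t \<omega>)\<bar>) \<partial>lborel) \<partial>M) < \<infinity>"
  defines "g \<equiv> resolvent_density \<psi> W (q + lam)"
  shows "gittins_index M X T q lam (resolvent M X (q + lam) r) x =
    \<phi> / \<beta> * ((LBINT u. r (x + u) * g u) +
      (\<beta> - \<phi>) * (LBINT y:{0..}. exp (- \<phi> * y) * (LBINT u. r (x + y + u) * g u)))"
proof -
  let ?R = "resolvent M X (q + lam) r"
  have p: "0 < q + lam" using q lam by simp
  have fin_q: "(\<integral>\<^sup>+y. ennreal \<bar>r (x + y)\<bar> \<partial>resolvent_measure q) < \<infinity>" for x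
  proof -
    have "(\<integral>\<^sup>+y. ennreal \<bar>r (x + y)\<bar> \<partial>resolvent_measure q) =
        (\<integral>\<^sup>+\<omega>. (\<integral>\<^sup>+t\<in>{0..}. ennreal (exp (- q * t) * \<bar>r (x + X t \<omega>)\<bar>) \<partial>lborel) \<partial>M)"
      by (subst nn_integral_resolvent_measure_Fubini)
        (auto intro!: nn_integral_cong simp: indicator_def max_absorb2 ennreal_mult)
    then show ?thesis using fin[of x] by simp
  qed
  have fin_p: "(\<integral>\<^sup>+y. ennreal \<bar>r (x + y)\<bar> \<partial>resolvent_measure (q + lam)) < \<infinity>" for x
    using resolvent_measure_mono[of q "q + lam" "\<lambda>y. ennreal \<bar>r (x + y)\<bar>"] fin_q[of x] lam
      by (simp add: le_less_trans)
  note R_eq = resolvent_eq_integral[OF r fin_p]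
  interpret V: finite_measure "resolvent_measure (q + lam)" using p
    by (rule finite_measure_resolvent_measure)
  have R_meas [measurable]: "?R \<in> borel_measurable borel"
    unfolding R_eq(2)[abs_def] by measurable
  have R_dens: "?R x = (LBINT u. r (x + u) * g u)" for x
  proof -
    have "?R x = (\<integral>u. g u *\<^sub>R r (x + u) \<partial>lborel)"
      unfolding R_eq(2) resolvent_measure_density(1)[OF p] g_def
      by (rule integral_density) (use resolvent_measure_density(2,3)[OF p] in auto)
    then show ?thesis by (simp add: mult.commute)
  qed
  have R_le: "ennreal \<bar>?R y\<bar> \<le> resolvent_op (\<lambda>y. ennreal \<bar>r y\<bar>) y" for y
    using integral_norm_bound_ennreal[OF R_eq(1)[of y]] by (simp add: R_eq(2) resolvent_op_def)
  have "nu (\<lambda>y. ennreal \<bar>?R (x + y)\<bar>) < \<infinity>"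
  proof -
    let ?F = "\<lambda>y. ennreal \<bar>r y\<bar>"
    obtain c where c: "0 < c" and Vpos: "\<And>f. f \<in> borel_measurable borel \<Longrightarrow>
      (\<integral>\<^sup>+y. indicator {0<..} y * f y \<partial>resolvent_measure q) =
          (\<integral>\<^sup>+y. indicator {0<..} y * (ennreal (c * exp (- \<phi> * y)) * f y) \<partial>lborel)"
      using resolvent_measure_pos[OF q] by blast
    have VF [measurable]: "(\<lambda>y. resolvent_op ?F (x + y)) \<in> borel_measurable borel" by measurable
    have "nu (\<lambda>y. ennreal \<bar>?R (x + y)\<bar>) \<le> nu (\<lambda>y. resolvent_op ?F (x + y))"
      by (intro nu_mono R_le)
    also have "\<dots> = (\<integral>\<^sup>+y. ennreal ((\<beta> - \<phi>) / c) * (indicator {0<..} y * (ennreal (c * exp (- \<phi> * y)) *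
        resolvent_op ?F (x + y))) \<partial>lborel)"
      unfolding nu_def
    proof (rule nn_integral_cong)
      fix y
      have "ennreal ((\<beta> - \<phi>) * exp (- \<phi> * y)) = ennreal ((\<beta> - \<phi>) / c) * ennreal (c * exp (- \<phi> * y))"
        using c \<phi>_less by (simp flip: ennreal_mult)
      then show "indicator {0<..} y * (ennreal ((\<beta> - \<phi>) * exp (- \<phi> * y)) * resolvent_op ?F (x + y)) =
          ennreal ((\<beta> - \<phi>) / c) * (indicator {0<..} y * (ennreal (c * exp (- \<phi> * y)) *
              resolvent_op ?F (x + y)))"
        by (simp only: mult_ac)
    qed
    also have "\<dots> = ennreal ((\<beta> - \<phi>) / c) * (\<integral>\<^sup>+y. indicator {0<..} y * resolvent_op ?F (x +
        y) \<partial>resolvent_measure q)"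
      unfolding Vpos[OF VF] by (rule nn_integral_cmult) measurable
    also have "\<dots> \<le> ennreal ((\<beta> - \<phi>) / c) * (\<integral>\<^sup>+y. resolvent_op ?F (x + y) \<partial>resolvent_measure q)"
      by (intro mult_left_mono nn_integral_mono) (auto simp: indicator_def)
    also have "\<dots> \<le> ennreal ((\<beta> - \<phi>) / c) * (ennreal (1 / lam) * (\<integral>\<^sup>+y. ?F (x + y) \<partial>resolvent_measure q))"
      by (intro mult_left_mono resolvent_composition_le) auto
    also have "\<dots> < \<infinity>" using fin_q[of x] by (simp add: ennreal_mult_less_top)
    finally show ?thesis .
  qed
  then show ?thesis
    using gittins_index_eq[OF R_meas] by (simp add: R_dens mult.commute)
qed

end

theorem proposition4p1:
  fixes M :: "'a measure" and X :: "real \<Rightarrow> 'a \<Rightarrow> real" and T :: "nat \<Rightarrow> 'a \<Rightarrow> real"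
    and \<psi> \<Phi> :: "real \<Rightarrow> real" and W g :: "real \<Rightarrow> real \<Rightarrow> real" and q lam :: real
  assumes X: "spectrally_negative_levy M X"
    and \<psi>: "\<psi> = laplace_exponent M X"
    and \<Phi>: "\<Phi> = right_inverse \<psi>"
    and W: "\<And>p. 0 \<le> p \<Longrightarrow> is_scale_function \<psi> p (W p)"
    and g: "g = resolvent_density \<psi> W"
    and q: "0 < q" and lam: "0 < lam"
    and T: "poisson_arrival_times M lam T"
    and indep: "indep_process_arrivals M X T"
  shows
    "(\<forall>R :: real \<Rightarrow> real.
        strict_mono R \<longrightarrow>
        (\<forall>x. (\<integral>\<^sup>+\<omega>. (\<Sum>k. ennreal (exp (- q * T k \<omega>) * \<bar>R (x + X (T k \<omega>) \<omega>)\<bar>)) \<partial>M) < \<infinity>) \<longrightarrow>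
        (\<forall>x. gittins_index M X T q lam R x =
           \<Phi> q / \<Phi> (q + lam) *
             (R x + (\<Phi> (q + lam) - \<Phi> q) * (LBINT y:{0..}. R (x + y) * exp (- \<Phi> q * y)))))
     \<and>
     (\<forall>r :: real \<Rightarrow> real.
        strict_mono r \<longrightarrow> continuous_on UNIV r \<longrightarrow>
        (\<forall>x. (\<integral>\<^sup>+\<omega>. (\<integral>\<^sup>+t\<in>{0..}. ennreal (exp (- q * t) * \<bar>r (x + X t \<omega>)\<bar>) \<partial>lborel) \<partial>M) < \<infinity>) \<longrightarrow>
        (\<forall>x. gittins_index M X T q lam (resolvent M X (q + lam) r) x =
           \<Phi> q / \<Phi> (q + lam) *
             ((LBINT u. r (x + u) * g (q + lam) u) +
              (\<Phi> (q + lam) - \<Phi> q) *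
                (LBINT y:{0..}. exp (- \<Phi> q * y) * (LBINT u. r (x + y + u) * g (q + lam) u)))))"
proof -
  have levy: "levy_process M X" using X by (simp add: spectrally_negative_levy_def)
  interpret levy_poisson M X W q lam T
  proof (intro levy_poisson.intro levy_sampled.intro levy_scale.intro levy.intro)
    show "prob_space M" using levy by (simp add: levy_process_def)
  qed (unfold_locales, use levy W q lam T indep \<psi> in auto)
  show ?thesis
    unfolding g \<Phi> \<psi>
  proof (intro conjI allI impI, goal_cases)
    case (1 R x)
    have "(\<integral>\<^sup>+\<omega>. (\<Sum>k. ennreal (exp (- q * T k \<omega>) * \<bar>R (x + X (T k \<omega>) \<omega>)\<bar>)) \<partial>M) < \<infinity>"
      using 1(2) by blast
    then show ?case by (rule gittins_index_problem1[OF 1(1)])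
  next
    case (2 r x)
    show ?case by (rule gittins_index_problem2[OF borel_measurable_continuous_onI[OF 2(2)] spec[OF
        2(3)]])
  qed
qed

end
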